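(* Let $(\mathbb{M},\mathbf{d})$ be a metric space, let $X\subset\mathbb{M}$ be a subset with $n+1$ points, let $\sigma_g:\{0,\ldots,n\}\to X$ be a greedy permutation, let $0<\epsilon<1$ and $\alpha\ge0$. Let $x_s=\sigma_g(s)$, and let $r_s(\alpha)$, $B_s^\alpha$, $\mathcal{B}^\alpha$ and the sparse Čech complex $\check{\mathcal{C}}_\alpha(\sigma_g,\epsilon)$ be as defined in the context. Put $$\varphi_s^\alpha(b)=\frac{|r_s(\alpha)-\mathbf{d}(b,x_s)|_+^2}{\sum_{t=0}^n|r_t(\alpha)-\mathbf{d}(b,x_t)|_+^2},\qquad s\in\{0,\ldots,n\},\ b\in\bigcup\mathcal{B}^\alpha.$$ Then there are well-defined maps $$\mathbf{w}_1^\alpha:H^1(\check{\mathcal{C}}_\alpha(\sigma_g,\epsilon);\mathbb{Z}/2)\to\left[\textstyle\bigcup\mathcal{B}^\alpha,\mathbb{R}\mathbf{P}^\infty\right],\quad[\tau]\mapsto[f_\tau^\alpha],$$ where $f_\tau^\alpha:\bigcup\mathcal{B}^\alpha\to\mathbb{R}\mathbf{P}^n$ is given for $b\in B_j^\alpha$ by $$f_\tau^\alpha(b)=\left[(-1)^{\tau_{0j}}\sqrt{\varphi_0^\alpha(b)}:\cdots:(-1)^{\tau_{nj}}\sqrt{\varphi_n^\alpha(b)}\right],$$ and $$\mathbf{c}_1^\alpha:H^2(\check{\mathcal{C}}_\alpha(\sigma_g,\epsilon);\mathbb{Z})\to\left[\textstyle\bigcup\mathcal{B}^\alpha,\mathbb{C}\mathbf{P}^\infty\right],\quad[\eta]\mapsto[f_{\theta,\nu}^\alpha],$$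 where $f^\alpha_{\theta,\nu}:\bigcup\mathcal{B}^\alpha\to\mathbb{C}\mathbf{P}^n$ is given for $b\in B_j^\alpha$ by $$f_{\theta,\nu}^\alpha(b)=\left[e^{2\pi i(\nu_{0j}+\sum_t\varphi_t^\alpha(b)\theta_{0jt})}\sqrt{\varphi_0^\alpha(b)}:\cdots:e^{2\pi i(\nu_{nj}+\sum_t\varphi_t^\alpha(b)\theta_{njt})}\sqrt{\varphi_n^\alpha(b)}\right].$$ Here $\theta\in Z^2(\check{\mathcal{C}}_\alpha(\sigma_g,\epsilon);\mathbb{R})$ is the harmonic cocycle representing $\jmath^*([\eta])\in H^2(\check{\mathcal{C}}_\alpha(\sigma_g,\epsilon);\mathbb{R})$, with $\jmath:\mathbb{Z}\hookrightarrow\mathbb{R}$ the inclusion, and $\nu\in C^1(\check{\mathcal{C}}_\alpha(\sigma_g,\epsilon);\mathbb{R})$ is such that $\theta=\jmath^\#(\eta)-\delta^1(\nu)$. Moreover: (1) if each $B_s^\alpha\in\mathcal{B}^\alpha$ is connected, then $\mathbf{w}_1^\alpha$ is injective; (2) if in addition each $B_s^\alpha$ is locally path-connected and simply connected, and each $B_r^\alpha\cap B_t^\alpha$ is either empty or connected, then $\mathbf{c}_1^\alpha$ is injective.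
   Context: $|x|_+=\max\{x,0\}$. A greedy permutation on $X$ is a bijection $\sigma_g:\{0,\ldots,n\}\to X$ such that, for $s=0,\ldots,n-1$, $\sigma_g(s+1)$ maximizes $x\mapsto\mathbf{d}(x,\{\sigma_g(0),\ldots,\sigma_g(s)\})$ over $x\in X$. The insertion radii are $\lambda_0=\infty$ and $\lambda_s=\mathbf{d}(x_s,\{x_0,\ldots,x_{s-1}\})$ for $s>0$. For $\alpha\ge0$, $$r_s(\alpha)=\begin{cases}\alpha&\text{if }\alpha<\lambda_s(1+\epsilon)/\epsilon,\\ \lambda_s(1+\epsilon)/\epsilon&\text{if }\lambda_s(1+\epsilon)/\epsilon\le\alpha\le\lambda_s(1+\epsilon)^2/\epsilon,\\ 0&\text{if }\alpha>\lambda_s(1+\epsilon)^2/\epsilon.\end{cases}$$ $B_s^\alpha=\{b\in\mathbb{M}:\mathbf{d}(b,x_s)<r_s(\alpha)\}$; $S_\alpha=\{s:\lambda_s\ge\epsilon\alpha/(1+\epsilon)^2\}$; $\mathcal{B}^\alpha=\{B_s^\alpha:s\in S_\alpha\}$; $U_s^\alpha=\bigcup_{0\le\lambda\le\alpha}(B_s^\lambda\times\{\lambda\})\subset\mathbb{M}\times\mathbb{R}$; $\mathcal{U}^\alpha=\{U_s^\alpha: s=0,\ldots,n\}$. The sparse Čech complex $\check{\mathcal{C}}_\alpha(\sigma_g,\epsilon)$ is the nerve $\mathcal{N}(\mathcal{U}^\alpha)$: its simplices are the nonempty sets $\{s_0,\ldots,s_k\}\subset\{0,\ldots,n\}$ with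 $U_{s_0}^\alpha\cap\cdots\cap U_{s_k}^\alpha\neq\emptyset$. For a finite simplicial complex $K$ with vertices in $\{0,\ldots,n\}$ and an abelian group $G$, $C^k(K;G)$ is the group of $G$-valued functions on $k$-simplices, with $\delta^k(\phi)(\{s_0<\cdots<s_{k+1}\})=\sum_j(-1)^j\phi(\{s_0,\ldots,s_{k+1}\}\smallsetminus\{s_j\})$; $Z^k$ and $H^k$ denote cocycles and cohomology. Write $\tau_{rt}=\tau(\{r,t\})$, $\tau_{rr}=0$; for $\nu$ and $\theta$ use the alternating extension to all index tuples ($\nu_{rs}=\nu(\{r,s\})$ for $r<s$, $\nu_{sr}=-\nu_{rs}$, $\nu_{rr}=0$; $\theta_{rst}=\theta(\{r,s,t\})$ for $r<s<t$, with the sign of the sorting permutation otherwise and $0$ on repeated indices). Terms with $\varphi_r^\alpha(b)=0$ or $\varphi^\alpha_t(b)=0$ are read as $0$. $C^k(K;\mathbb{R})$ carries the inner product $\langle\beta_1,\beta_2\rangle=\sum_\sigma\beta_1(\sigma)\beta_2(\sigma)$; $d_{k+1}$ is the adjoint of $\delta^k$; $\theta\in C^k(K;\mathbb{R})$ is harmonic if $(d_{k+1}\delta^k+\delta^{k-1}d_k)(\theta)=0$. Every real cohomology class has a unique harmonic representative. $\jmath^\#$ and $\jmath^*$ are the maps induced by $\jmath$ on cochains and cohomology. $[B,Y]$ is the set of homotopy classes of continuous maps; maps to $\mathbb{F}\mathbf{P}^n$ are regarded as maps to $\mathbb{F}\mathbf{P}^\infty$. Simply connected means path-connected with trivial fundamental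 group; locally path-connected means every point has a neighbourhood basis of path-connected open sets. *)

theory Defs
  imports "HOL-Analysis.Analysis" "HOL-Library.Z2"
begin

section \<open>Greedy permutations and the sparse Cech complex\<close>

text \<open>For a finite nonempty set \<open>A\<close>, \<^term>\<open>infdist b A\<close> is the distance from \<open>b\<close> to \<open>A\<close>.\<close>

definition greedy_permutation :: "'a::metric_space set \<Rightarrow> nat \<Rightarrow> (nat \<Rightarrow> 'a) \<Rightarrow> bool" where
  "greedy_permutation X n x \<longleftrightarrow>
     bij_betw x {0..n} X \<and>
     (\<forall>s<n. \<forall>y\<in>X. infdist y (x ` {0..s}) \<le> infdist (x (Suc s)) (x ` {0..s}))"

definition insertion_radius :: "(nat \<Rightarrow> 'a::metric_space) \<Rightarrow> nat \<Rightarrow> ereal" where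
  "insertion_radius x s = (if s = 0 then \<infinity> else ereal (infdist (x s) (x ` {0..<s})))"

text \<open>\<^const>\<open>real_of_ereal\<close> is applied only where its argument is at most \<open>a\<close>, hence finite.\<close>

definition sparse_radius :: "(nat \<Rightarrow> 'a::metric_space) \<Rightarrow> real \<Rightarrow> real \<Rightarrow> nat \<Rightarrow> real" where
  "sparse_radius x e a s =
     (if ereal a < insertion_radius x s * ereal ((1 + e) / e) then a
      else if ereal a \<le> insertion_radius x s * ereal ((1 + e)\<^sup>2 / e)
        then real_of_ereal (insertion_radius x s * ereal ((1 + e) / e))
      else 0)"

definition sparse_ball :: "(nat \<Rightarrow> 'a::metric_space) \<Rightarrow> real \<Rightarrow> real \<Rightarrow> nat \<Rightarrow> 'a set" where
  "sparse_ball x e a s = {b. dist b (x s) < sparse_radius x e a s}"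

definition sparse_index :: "(nat \<Rightarrow> 'a::metric_space) \<Rightarrow> nat \<Rightarrow> real \<Rightarrow> real \<Rightarrow> nat set" where
  "sparse_index x n e a = {s \<in> {0..n}. insertion_radius x s \<ge> ereal (e * a / (1 + e)\<^sup>2)}"

definition sparse_balls :: "(nat \<Rightarrow> 'a::metric_space) \<Rightarrow> nat \<Rightarrow> real \<Rightarrow> real \<Rightarrow> 'a set set" where
  "sparse_balls x n e a = sparse_ball x e a ` sparse_index x n e a"

definition sparse_tube ::
    "(nat \<Rightarrow> 'a::metric_space) \<Rightarrow> real \<Rightarrow> real \<Rightarrow> nat \<Rightarrow> ('a \<times> real) set" where
  "sparse_tube x e a s = (\<Union>l\<in>{0..a}. sparse_ball x e l s \<times> {l})"

definition nerve :: "nat set \<Rightarrow> (nat \<Rightarrow> 'b set) \<Rightarrow> nat set set" where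
  "nerve I U = {\<sigma>. finite \<sigma> \<and> \<sigma> \<noteq> {} \<and> \<sigma> \<subseteq> I \<and> (\<Inter>s\<in>\<sigma>. U s) \<noteq> {}}"

definition sparse_cech ::
    "(nat \<Rightarrow> 'a::metric_space) \<Rightarrow> nat \<Rightarrow> real \<Rightarrow> real \<Rightarrow> nat set set" where
  "sparse_cech x n e a = nerve {0..n} (sparse_tube x e a)"

definition sparse_weight ::
    "(nat \<Rightarrow> 'a::metric_space) \<Rightarrow> nat \<Rightarrow> real \<Rightarrow> real \<Rightarrow> nat \<Rightarrow> 'a \<Rightarrow> real" where
  "sparse_weight x n e a s b =
     (max (sparse_radius x e a s - dist b (x s)) 0)\<^sup>2 /
     (\<Sum>t=0..n. (max (sparse_radius x e a t - dist b (x t)) 0)\<^sup>2)"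

section \<open>Simplicial cohomology\<close>

definition simplices :: "nat set set \<Rightarrow> nat \<Rightarrow> nat set set" where
  "simplices K k = {\<sigma> \<in> K. card \<sigma> = Suc k}"

text \<open>A cochain is a function on the \<open>k\<close>-simplices, extended by \<open>0\<close> to all other vertex sets.\<close>

definition cochains :: "nat set set \<Rightarrow> nat \<Rightarrow> (nat set \<Rightarrow> 'g::ab_group_add) set" where
  "cochains K k = {\<phi>. \<forall>\<sigma>. \<sigma> \<notin> simplices K k \<longrightarrow> \<phi> \<sigma> = 0}"

definition coboundary ::
    "nat set set \<Rightarrow> nat \<Rightarrow> (nat set \<Rightarrow> 'g::ab_group_add) \<Rightarrow> nat set \<Rightarrow> 'g" where
  "coboundary K k \<phi> \<sigma> =
     (if \<sigma> \<in> simplices K (Suc k)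
      then (\<Sum>j=0..Suc k. (let f = \<phi> (\<sigma> - {sorted_list_of_set \<sigma> ! j})
                          in if even j then f else - f))
      else 0)"

definition cocycles :: "nat set set \<Rightarrow> nat \<Rightarrow> (nat set \<Rightarrow> 'g::ab_group_add) set" where
  "cocycles K k = {\<phi> \<in> cochains K k. coboundary K k \<phi> = (\<lambda>_. 0)}"

definition coboundaries :: "nat set set \<Rightarrow> nat \<Rightarrow> (nat set \<Rightarrow> 'g::ab_group_add) set" where
  "coboundaries K k = (case k of 0 \<Rightarrow> {\<lambda>_. 0} | Suc m \<Rightarrow> coboundary K m ` cochains K m)"

definition cohomology_class ::
    "nat set set \<Rightarrow> nat \<Rightarrow> (nat set \<Rightarrow> 'g::ab_group_add) \<Rightarrow> (nat set \<Rightarrow> 'g) set" where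
  "cohomology_class K k \<phi> = {\<psi> \<in> cocycles K k. (\<lambda>\<sigma>. \<psi> \<sigma> - \<phi> \<sigma>) \<in> coboundaries K k}"

definition cohomology :: "nat set set \<Rightarrow> nat \<Rightarrow> (nat set \<Rightarrow> 'g::ab_group_add) set set" where
  "cohomology K k = cohomology_class K k ` cocycles K k"

definition int_to_real_cochain :: "(nat set \<Rightarrow> int) \<Rightarrow> nat set \<Rightarrow> real" where
  "int_to_real_cochain \<eta> = (\<lambda>\<sigma>. of_int (\<eta> \<sigma>))"

text \<open>The induced map \<open>[\<eta>] \<mapsto> [\<jmath>\<^sup># \<eta>]\<close>; the union is over representatives, all of which give
  the same class.\<close>

definition int_to_real_cohomology ::
    "nat set set \<Rightarrow> nat \<Rightarrow> (nat set \<Rightarrow> int) set \<Rightarrow> (nat set \<Rightarrow> real) set" where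
  "int_to_real_cohomology K k c = (\<Union>\<eta>\<in>c. cohomology_class K k (int_to_real_cochain \<eta>))"

definition cochain_inner ::
    "nat set set \<Rightarrow> nat \<Rightarrow> (nat set \<Rightarrow> real) \<Rightarrow> (nat set \<Rightarrow> real) \<Rightarrow> real" where
  "cochain_inner K k \<beta> \<gamma> = (\<Sum>\<sigma>\<in>simplices K k. \<beta> \<sigma> * \<gamma> \<sigma>)"

text \<open>\<open>coboundary_adjoint K k\<close>, from \<open>(k+1)\<close>-cochains to \<open>k\<close>-cochains, is the adjoint of
  \<open>coboundary K k\<close>; see the lemma \<open>coboundary_adjoint\<close> below for existence and uniqueness.\<close>

definition coboundary_adjoint ::
    "nat set set \<Rightarrow> nat \<Rightarrow> (nat set \<Rightarrow> real) \<Rightarrow> nat set \<Rightarrow> real" where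
  "coboundary_adjoint K k \<beta> =
     (THE \<gamma>. \<gamma> \<in> cochains K k \<and>
        (\<forall>\<phi>\<in>cochains K k. cochain_inner K (Suc k) (coboundary K k \<phi>) \<beta> = cochain_inner K k \<phi> \<gamma>))"

definition harmonic :: "nat set set \<Rightarrow> nat \<Rightarrow> (nat set \<Rightarrow> real) \<Rightarrow> bool" where
  "harmonic K k \<theta> \<longleftrightarrow>
     \<theta> \<in> cochains K k \<and>
     (\<forall>\<sigma>. coboundary_adjoint K k (coboundary K k \<theta>) \<sigma> +
          (case k of 0 \<Rightarrow> 0 | Suc m \<Rightarrow> coboundary K m (coboundary_adjoint K m \<theta>) \<sigma>) = 0)"

lemma coboundary_adjoint:
  assumes "finite K"
  shows "coboundary_adjoint K k \<beta> \<in> cochains K k"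
    and "\<phi> \<in> cochains K k \<Longrightarrow>
      cochain_inner K (Suc k) (coboundary K k \<phi>) \<beta> = cochain_inner K k \<phi> (coboundary_adjoint K k \<beta>)"
proof -
  let ?e = "\<lambda>\<tau> \<sigma>. if \<sigma> = \<tau> then 1 else (0::real)"
  let ?P = "\<lambda>\<gamma>. \<gamma> \<in> cochains K k \<and>
    (\<forall>\<phi>\<in>cochains K k. cochain_inner K (Suc k) (coboundary K k \<phi>) \<beta> = cochain_inner K k \<phi> \<gamma>)"
  have fin: "finite (simplices K m)" for m
    using assms by (simp add: simplices_def)
  have e: "?e \<tau> \<in> cochains K k" if "\<tau> \<in> simplices K k" for \<tau>
    using that by (auto simp: cochains_def)
  have inner_e: "cochain_inner K k (?e \<tau>) \<gamma> = \<gamma> \<tau>" if "\<tau> \<in> simplices K k" for \<tau> \<gamma>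
  proof -
    have "cochain_inner K k (?e \<tau>) \<gamma> = (\<Sum>\<sigma>\<in>simplices K k. if \<sigma> = \<tau> then \<gamma> \<tau> else 0)"
      unfolding cochain_inner_def by (rule sum.cong) auto
    then show ?thesis using that fin by simp
  qed
  define \<gamma> where "\<gamma> = (\<lambda>\<sigma>. if \<sigma> \<in> simplices K k
      then cochain_inner K (Suc k) (coboundary K k (?e \<sigma>)) \<beta> else 0)"
  define c :: "nat \<Rightarrow> real" where "c = (\<lambda>j. if even j then 1 else -1)"
  have cob: "coboundary K k \<phi> \<sigma> = (\<Sum>j=0..Suc k. c j * \<phi> (\<sigma> - {sorted_list_of_set \<sigma> ! j}))"
    if "\<sigma> \<in> simplices K (Suc k)" for \<phi> \<sigma>
    unfolding coboundary_def Let_def if_P[OF that] c_def by (rule sum.cong) simp_all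
  have lin: "coboundary K k \<phi> \<sigma> = (\<Sum>\<tau>\<in>simplices K k. \<phi> \<tau> * coboundary K k (?e \<tau>) \<sigma>)"
    if \<phi>: "\<phi> \<in> cochains K k" for \<phi> \<sigma>
  proof (cases "\<sigma> \<in> simplices K (Suc k)")
    case False
    then show ?thesis by (simp add: coboundary_def)
  next
    case True
    have exp: "\<phi> \<rho> = (\<Sum>\<tau>\<in>simplices K k. \<phi> \<tau> * ?e \<tau> \<rho>)" for \<rho>
    proof -
      have "(\<Sum>\<tau>\<in>simplices K k. \<phi> \<tau> * ?e \<tau> \<rho>) = (\<Sum>\<tau>\<in>simplices K k. if \<tau> = \<rho> then \<phi> \<rho> else 0)"
        by (rule sum.cong) auto
      also have "\<dots> = \<phi> \<rho>" using \<phi> fin by (auto simp: cochains_def)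
      finally show ?thesis by simp
    qed
    let ?r = "\<lambda>j. \<sigma> - {sorted_list_of_set \<sigma> ! j}"
    have "coboundary K k \<phi> \<sigma> = (\<Sum>j=0..Suc k. c j * \<phi> (?r j))"
      by (rule cob[OF True])
    also have "\<dots> = (\<Sum>j=0..Suc k. c j * (\<Sum>\<tau>\<in>simplices K k. \<phi> \<tau> * ?e \<tau> (?r j)))"
      by (rule sum.cong[OF refl], rule arg_cong2[of _ _ _ _ "(*)", OF refl exp])
    also have "\<dots> = (\<Sum>j=0..Suc k. \<Sum>\<tau>\<in>simplices K k. \<phi> \<tau> * (c j * ?e \<tau> (?r j)))"
      by (simp only: sum_distrib_left mult.left_commute)
    also have "\<dots> = (\<Sum>\<tau>\<in>simplices K k. \<Sum>j=0..Suc k. \<phi> \<tau> * (c j * ?e \<tau> (?r j)))"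
      by (rule sum.swap)
    also have "\<dots> = (\<Sum>\<tau>\<in>simplices K k. \<phi> \<tau> * coboundary K k (?e \<tau>) \<sigma>)"
      by (simp only: cob[OF True] sum_distrib_left)
    finally show ?thesis .
  qed
  have ex: "?P \<gamma>"
  proof (intro conjI ballI)
    show "\<gamma> \<in> cochains K k" by (auto simp: \<gamma>_def cochains_def)
  next
    fix \<phi> :: "nat set \<Rightarrow> real" assume \<phi>: "\<phi> \<in> cochains K k"
    have "cochain_inner K (Suc k) (coboundary K k \<phi>) \<beta> =
      (\<Sum>\<sigma>\<in>simplices K (Suc k). (\<Sum>\<tau>\<in>simplices K k. \<phi> \<tau> * coboundary K k (?e \<tau>) \<sigma>) * \<beta> \<sigma>)"
      unfolding cochain_inner_def by (rule sum.cong[OF refl], rule arg_cong2[of _ _ _ _ "(*)", OF lin[OF \<phi>] refl])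
    also have "\<dots> =
      (\<Sum>\<sigma>\<in>simplices K (Suc k). \<Sum>\<tau>\<in>simplices K k. \<phi> \<tau> * (coboundary K k (?e \<tau>) \<sigma> * \<beta> \<sigma>))"
      by (simp only: sum_distrib_right mult.assoc)
    also have "\<dots> =
      (\<Sum>\<tau>\<in>simplices K k. \<Sum>\<sigma>\<in>simplices K (Suc k). \<phi> \<tau> * (coboundary K k (?e \<tau>) \<sigma> * \<beta> \<sigma>))"
      by (rule sum.swap)
    also have "\<dots> = (\<Sum>\<tau>\<in>simplices K k. \<phi> \<tau> * cochain_inner K (Suc k) (coboundary K k (?e \<tau>)) \<beta>)"
      unfolding cochain_inner_def by (simp only: sum_distrib_left)
    also have "\<dots> = cochain_inner K k \<phi> \<gamma>"
      unfolding cochain_inner_def[of K k] \<gamma>_def by (rule sum.cong) auto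
    finally show "cochain_inner K (Suc k) (coboundary K k \<phi>) \<beta> = cochain_inner K k \<phi> \<gamma>" .
  qed
  have "?P (coboundary_adjoint K k \<beta>)"
    unfolding coboundary_adjoint_def
  proof (rule theI[of ?P, OF ex])
    fix \<gamma>' assume P: "?P \<gamma>'"
    show "\<gamma>' = \<gamma>"
    proof
      fix \<tau>
      show "\<gamma>' \<tau> = \<gamma> \<tau>"
      proof (cases "\<tau> \<in> simplices K k")
        case True
        have "cochain_inner K k (?e \<tau>) \<gamma>' = cochain_inner K k (?e \<tau>) \<gamma>"
          using bspec[OF conjunct2[OF P] e[OF True]] bspec[OF conjunct2[OF ex] e[OF True]]
          by (rule trans[OF sym])
        then show ?thesis using inner_e[OF True] by simp
      next
        case False
        then show ?thesis using P ex by (auto simp: cochains_def)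
      qed
    qed
  qed
  note adj = this
  show "coboundary_adjoint K k \<beta> \<in> cochains K k"
    using adj by (rule conjunct1)
  show "cochain_inner K (Suc k) (coboundary K k \<phi>) \<beta> = cochain_inner K k \<phi> (coboundary_adjoint K k \<beta>)"
    if "\<phi> \<in> cochains K k"
    using conjunct2[OF adj] that by (rule bspec)
qed

text \<open>Alternating extension of a real cochain to index tuples. The parity of the number of
  inversions is the sign of the sorting permutation.\<close>

definition alt_ext :: "(nat set \<Rightarrow> real) \<Rightarrow> nat list \<Rightarrow> real" where
  "alt_ext \<phi> ss =
     (if distinct ss
      then (-1) ^ card {(i, j). i < j \<and> j < length ss \<and> ss ! i > ss ! j} * \<phi> (set ss)
      else 0)"

definition sym_ext :: "(nat set \<Rightarrow> bit) \<Rightarrow> nat \<Rightarrow> nat \<Rightarrow> bit" where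
  "sym_ext \<tau> r t = (if r = t then 0 else \<tau> {r, t})"

section \<open>Projective spaces\<close>

definition quotient_topology :: "'a topology \<Rightarrow> ('a \<Rightarrow> 'b) \<Rightarrow> 'b topology" where
  "quotient_topology X q =
     topology (\<lambda>U. U \<subseteq> q ` topspace X \<and> openin X {x \<in> topspace X. q x \<in> U})"

lemma openin_quotient_topology:
  "openin (quotient_topology X q) U \<longleftrightarrow>
     U \<subseteq> q ` topspace X \<and> openin X {x \<in> topspace X. q x \<in> U}"
proof -
  have "istopology (\<lambda>U. U \<subseteq> q ` topspace X \<and> openin X {x \<in> topspace X. q x \<in> U})"
    unfolding istopology_def
  proof (rule conjI; intro allI impI)
    fix S T
    assume S: "S \<subseteq> q ` topspace X \<and> openin X {x \<in> topspace X. q x \<in> S}"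
      and T: "T \<subseteq> q ` topspace X \<and> openin X {x \<in> topspace X. q x \<in> T}"
    have "{x \<in> topspace X. q x \<in> S \<inter> T} = {x \<in> topspace X. q x \<in> S} \<inter> {x \<in> topspace X. q x \<in> T}"
      by auto
    then show "S \<inter> T \<subseteq> q ` topspace X \<and> openin X {x \<in> topspace X. q x \<in> S \<inter> T}"
      using S T by auto
  next
    fix \<K>
    assume K: "\<forall>U\<in>\<K>. U \<subseteq> q ` topspace X \<and> openin X {x \<in> topspace X. q x \<in> U}"
    have "{x \<in> topspace X. q x \<in> \<Union>\<K>} = (\<Union>U\<in>\<K>. {x \<in> topspace X. q x \<in> U})"
      by auto
    then show "\<Union>\<K> \<subseteq> q ` topspace X \<and> openin X {x \<in> topspace X. q x \<in> \<Union>\<K>}"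
      using K by (auto intro!: openin_Union)
  qed
  then show ?thesis by (simp add: quotient_topology_def)
qed

lemma topspace_quotient_topology [simp]: "topspace (quotient_topology X q) = q ` topspace X"
proof
  show "topspace (quotient_topology X q) \<subseteq> q ` topspace X"
    using openin_topspace[of "quotient_topology X q"] unfolding openin_quotient_topology by (rule conjunct1)
  have "{x \<in> topspace X. q x \<in> q ` topspace X} = topspace X" by auto
  then have "openin (quotient_topology X q) (q ` topspace X)"
    by (simp add: openin_quotient_topology)
  then show "q ` topspace X \<subseteq> topspace (quotient_topology X q)"
    by (rule openin_subset)
qed

lemma quotient_map_quotient_topology: "quotient_map X (quotient_topology X q) q"
  by (simp add: quotient_map_def openin_quotient_topology)

text \<open>The space of nonzero vectors \<open>[v 0, \<dots>, v n]\<close>, as sequences vanishing beyond \<open>n\<close>.\<close>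

definition punctured_space :: "nat \<Rightarrow> (nat \<Rightarrow> 'f::real_normed_field) topology" where
  "punctured_space n =
     subtopology (product_topology (\<lambda>_. euclidean) UNIV) {v. (\<exists>i. v i \<noteq> 0) \<and> (\<forall>i>n. v i = 0)}"

text \<open>The point with homogeneous coordinates \<open>[v 0 : v 1 : \<dots>]\<close>.\<close>

definition proj_point :: "(nat \<Rightarrow> 'f::real_normed_field) \<Rightarrow> (nat \<Rightarrow> 'f) set" where
  "proj_point v = {w. \<exists>c. c \<noteq> 0 \<and> w = (\<lambda>i. c * v i)}"

text \<open>Since trailing zeros are not recorded, the standard inclusions \<open>FP^m \<rightarrow> FP^n\<close> (\<open>m \<le> n\<close>) and
  \<open>FP^n \<rightarrow> FP^\<infinity>\<close> are inclusions of sets, and a map into \<open>FP^n\<close> is literally a map into \<open>FP^\<infinity>\<close>.\<close>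

definition proj_space :: "nat \<Rightarrow> (nat \<Rightarrow> 'f::real_normed_field) set topology" where
  "proj_space n = quotient_topology (punctured_space n) proj_point"

text \<open>\<open>FP^\<infinity>\<close> is the direct limit of the \<open>FP^n\<close>.\<close>

definition proj_space_inf :: "(nat \<Rightarrow> 'f::real_normed_field) set topology" where
  "proj_space_inf =
     topology (\<lambda>U. U \<subseteq> (\<Union>n. topspace (proj_space n)) \<and>
                   (\<forall>n. openin (proj_space n) (U \<inter> topspace (proj_space n))))"

lemma openin_proj_space_inf:
  fixes U :: "(nat \<Rightarrow> 'f::real_normed_field) set set"
  shows "openin proj_space_inf U \<longleftrightarrow>
     U \<subseteq> (\<Union>n. topspace (proj_space n)) \<and>
     (\<forall>n. openin (proj_space n) (U \<inter> topspace (proj_space n)))"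
proof -
  have "istopology (\<lambda>U :: (nat \<Rightarrow> 'f) set set. U \<subseteq> (\<Union>n. topspace (proj_space n)) \<and>
                   (\<forall>n. openin (proj_space n) (U \<inter> topspace (proj_space n))))"
    unfolding istopology_def
  proof (rule conjI; intro allI impI)
    fix S T :: "(nat \<Rightarrow> 'f) set set"
    assume S: "S \<subseteq> (\<Union>n. topspace (proj_space n)) \<and>
        (\<forall>n. openin (proj_space n) (S \<inter> topspace (proj_space n)))"
      and T: "T \<subseteq> (\<Union>n. topspace (proj_space n)) \<and>
        (\<forall>n. openin (proj_space n) (T \<inter> topspace (proj_space n)))"
    have "(S \<inter> T) \<inter> topspace (proj_space n) =
      (S \<inter> topspace (proj_space n)) \<inter> (T \<inter> topspace (proj_space n))" for n
      by auto
    then show "S \<inter> T \<subseteq> (\<Union>n. topspace (proj_space n)) \<and>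
        (\<forall>n. openin (proj_space n) (S \<inter> T \<inter> topspace (proj_space n)))"
      using S T by (simp add: openin_Int le_infI1)
  next
    fix \<K> :: "(nat \<Rightarrow> 'f) set set set"
    assume K: "\<forall>U\<in>\<K>. U \<subseteq> (\<Union>n. topspace (proj_space n)) \<and>
        (\<forall>n. openin (proj_space n) (U \<inter> topspace (proj_space n)))"
    have eq: "\<Union>\<K> \<inter> topspace (proj_space n) = (\<Union>U\<in>\<K>. U \<inter> topspace (proj_space n))" for n
      by auto
    have "\<forall>n. openin (proj_space n) (\<Union>\<K> \<inter> topspace (proj_space n))"
      unfolding eq by (intro allI openin_Union) (use K in blast)
    then show "\<Union>\<K> \<subseteq> (\<Union>n. topspace (proj_space n)) \<and>
        (\<forall>n. openin (proj_space n) (\<Union>\<K> \<inter> topspace (proj_space n)))"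
      using K by (simp add: Sup_le_iff)
  qed
  then show ?thesis by (simp add: proj_space_inf_def)
qed

section \<open>Homotopy classes of maps\<close>

text \<open>Functions are total, so a class does not constrain values outside \<^term>\<open>topspace X\<close>; two
  functions that agree on \<^term>\<open>topspace X\<close> have the same class.\<close>

definition homotopy_class :: "'a topology \<Rightarrow> 'b topology \<Rightarrow> ('a \<Rightarrow> 'b) \<Rightarrow> ('a \<Rightarrow> 'b) set" where
  "homotopy_class X Y f = {g. continuous_map X Y g \<and> homotopic_with (\<lambda>_. True) X Y f g}"

definition homotopy_classes :: "'a topology \<Rightarrow> 'b topology \<Rightarrow> ('a \<Rightarrow> 'b) set set" where
  "homotopy_classes X Y = homotopy_class X Y ` {f. continuous_map X Y f}"

section \<open>The classifying maps\<close>

text \<open>The homogeneous coordinates of the two maps at \<open>b\<close>, computed in the chart \<open>j\<close>.\<close>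

definition real_coords ::
    "(nat \<Rightarrow> 'a::metric_space) \<Rightarrow> nat \<Rightarrow> real \<Rightarrow> real \<Rightarrow> (nat set \<Rightarrow> bit) \<Rightarrow>
     nat \<Rightarrow> 'a \<Rightarrow> nat \<Rightarrow> real" where
  "real_coords x n e a \<tau> j b r =
     (if r \<le> n then (-1) ^ of_bit (sym_ext \<tau> r j) * sqrt (sparse_weight x n e a r b) else 0)"

definition complex_coords ::
    "(nat \<Rightarrow> 'a::metric_space) \<Rightarrow> nat \<Rightarrow> real \<Rightarrow> real \<Rightarrow> (nat set \<Rightarrow> real) \<Rightarrow> (nat set \<Rightarrow> real) \<Rightarrow>
     nat \<Rightarrow> 'a \<Rightarrow> nat \<Rightarrow> complex" where
  "complex_coords x n e a \<theta> \<nu> j b r =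
     (if r \<le> n
      then exp (2 * of_real pi * \<i> *
                of_real (alt_ext \<nu> [r, j] +
                         (\<Sum>t=0..n. sparse_weight x n e a t b * alt_ext \<theta> [r, j, t]))) *
           of_real (sqrt (sparse_weight x n e a r b))
      else 0)"

text \<open>\<open>f\<close> is the map \<open>f_\<tau>\<close>: a continuous map to \<open>RP^n\<close> given by the coordinates of every chart
  (in particular the charts agree on overlaps). This determines \<open>f\<close> on the union of the balls.\<close>

definition is_real_map ::
    "(nat \<Rightarrow> 'a::metric_space) \<Rightarrow> nat \<Rightarrow> real \<Rightarrow> real \<Rightarrow> (nat set \<Rightarrow> bit) \<Rightarrow>
     ('a \<Rightarrow> (nat \<Rightarrow> real) set) \<Rightarrow> bool" where
  "is_real_map x n e a \<tau> f \<longleftrightarrow>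
     continuous_map (top_of_set (\<Union>(sparse_balls x n e a))) (proj_space n) f \<and>
     (\<forall>j\<in>{0..n}. \<forall>b\<in>sparse_ball x e a j. f b = proj_point (real_coords x n e a \<tau> j b))"

definition is_complex_map ::
    "(nat \<Rightarrow> 'a::metric_space) \<Rightarrow> nat \<Rightarrow> real \<Rightarrow> real \<Rightarrow> (nat set \<Rightarrow> real) \<Rightarrow> (nat set \<Rightarrow> real) \<Rightarrow>
     ('a \<Rightarrow> (nat \<Rightarrow> complex) set) \<Rightarrow> bool" where
  "is_complex_map x n e a \<theta> \<nu> f \<longleftrightarrow>
     continuous_map (top_of_set (\<Union>(sparse_balls x n e a))) (proj_space n) f \<and>
     (\<forall>j\<in>{0..n}. \<forall>b\<in>sparse_ball x e a j. f b = proj_point (complex_coords x n e a \<theta> \<nu> j b))"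

text \<open>\<open>\<theta>\<close> is the harmonic cocycle representing \<open>\<jmath>\<^sup>*[\<eta>]\<close>.\<close>

definition is_harmonic_rep ::
    "nat set set \<Rightarrow> (nat set \<Rightarrow> int) \<Rightarrow> (nat set \<Rightarrow> real) \<Rightarrow> bool" where
  "is_harmonic_rep K \<eta> \<theta> \<longleftrightarrow>
     \<theta> \<in> cocycles K 2 \<and> harmonic K 2 \<theta> \<and>
     cohomology_class K 2 \<theta> = int_to_real_cohomology K 2 (cohomology_class K 2 \<eta>)"

definition is_correction ::
    "nat set set \<Rightarrow> (nat set \<Rightarrow> int) \<Rightarrow> (nat set \<Rightarrow> real) \<Rightarrow> (nat set \<Rightarrow> real) \<Rightarrow> bool" where
  "is_correction K \<eta> \<theta> \<nu> \<longleftrightarrow>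
     \<nu> \<in> cochains K 1 \<and> \<theta> = (\<lambda>\<sigma>. int_to_real_cochain \<eta> \<sigma> - coboundary K 1 \<nu> \<sigma>)"

end

(* Both maps are read off from the transition functions of line bundles. The coordinate vectors in
   the chart B_j form a frame of a line bundle whose transition functions are (-1)^tau_jk, respectively
   exp(-2 pi i (nu_jk + sum_t phi_t theta_jkt)). Frames with the same transition functions, up to a
   gauge transformation, give homotopic maps, because in infinitely many coordinates one frame can be
   moved to another along a straight line through a copy with disjoint coordinates. Conversely, a
   homotopy of maps transports one tautological line bundle to the other. The transport moves along
   the homotopy by small steps with the help of a substitute for the orthogonal projection; a
   Lipschitz step size replaces paracompactness.

   Under the connectedness hypotheses the resulting gauge transformation has constant sign on each
   ball, respectively a logarithm on each ball, so that it exhibits the difference of the two cocycles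
   as a coboundary on the nerve of the balls. This nerve is the full subcomplex of the sparse Cech
   complex on the vertices still alive at scale alpha, and the link of a dead vertex among the
   vertices preceding it is a cone. Hence the coboundary extends to the whole complex. *)

theory Submission
  imports Defs
begin

section \<open>Frames of lines and maps to projective space\<close>

text \<open>The charts agree because the weights suppress every coordinate whose ball misses b: the
  balls that do contain b span a simplex, and there the cocycle identity is available. In the
  complex case the last index of \<theta> is averaged against the weights. This gives real functions
  whose coboundary, together with that of \<nu>, is the integral cocycle \<eta>, and integers
  disappear under the exponential. Harmonicity makes \<theta> depend on the class alone:
  cohomologous \<eta>, \<eta>' share \<theta>, and what remains, \<nu> - \<nu>' minus an integral
  cochain, is a real 1-cocycle that the same averaging trivialises.

  The obstacle for injectivity is that the domain is a mere metric space and the target carries a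
  limit topology, so the bundle isomorphism is built by hand from scale-invariant, locally finite
  coordinates of lines.

  The constants of the filtration meet in (1+e)^2/e = (1+e)/e + (1+e): at its death scale a ball has
  radius at most (1+e)/e insertion radii, and it lies inside the ball, of radius the full scale, of
  an earlier point at most (1+e) insertion radii away.\<close>

lemma proj_point_eq_iff: "proj_point v = proj_point w \<longleftrightarrow> (\<exists>c. c \<noteq> 0 \<and> v = (\<lambda>i. c * w i))"
proof
  assume eq: "proj_point v = proj_point w"
  have "v \<in> proj_point v"
    unfolding proj_point_def by (auto intro!: exI[of _ 1])
  then show "\<exists>c. c \<noteq> 0 \<and> v = (\<lambda>i. c * w i)"
    unfolding eq by (simp add: proj_point_def)
next
  assume "\<exists>c. c \<noteq> 0 \<and> v = (\<lambda>i. c * w i)"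
  then obtain c where c: "c \<noteq> 0" and v: "v = (\<lambda>i. c * w i)" by blast
  show "proj_point v = proj_point w"
  proof (intro set_eqI iffI)
    fix u assume "u \<in> proj_point v"
    then obtain d where "d \<noteq> 0" "u = (\<lambda>i. d * v i)" by (auto simp: proj_point_def)
    then show "u \<in> proj_point w"
      using c v by (auto simp: proj_point_def intro!: exI[of _ "d * c"])
  next
    fix u assume "u \<in> proj_point w"
    then obtain d where "d \<noteq> 0" "u = (\<lambda>i. d * w i)" by (auto simp: proj_point_def)
    then show "u \<in> proj_point v"
      using c v by (auto simp: proj_point_def intro!: exI[of _ "d / c"])
  qed
qed

lemma proj_point_self: "v \<in> proj_point v"
  unfolding proj_point_def by (auto intro!: exI[of _ 1])

lemma topspace_punctured_space:
  "topspace (punctured_space n) = {v. (\<exists>i. v i \<noteq> 0) \<and> (\<forall>i>n. v i = 0)}"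
  by (simp add: punctured_space_def)

lemma continuous_map_punctured_space:
  "continuous_map X (punctured_space n) v \<longleftrightarrow>
     (\<forall>i. continuous_map X euclidean (\<lambda>b. v b i)) \<and>
     (\<forall>b\<in>topspace X. (\<exists>i. v b i \<noteq> 0) \<and> (\<forall>i>n. v b i = 0))"
  unfolding punctured_space_def
  by (auto simp: continuous_map_in_subtopology continuous_map_componentwise_UNIV Pi_iff)

lemma continuous_map_proj_point: "continuous_map (punctured_space n) (proj_space n) proj_point"
  unfolding proj_space_def by (rule quotient_imp_continuous_map[OF quotient_map_quotient_topology])

lemma topspace_proj_space_inf:
  "topspace proj_space_inf = (\<Union>n. topspace (proj_space n :: (nat \<Rightarrow> 'f::real_normed_field) set topology))"
    (is "_ = ?U")
proof
  show "topspace proj_space_inf \<subseteq> ?U"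
    using openin_topspace[of proj_space_inf] unfolding openin_proj_space_inf by (rule conjunct1)
  have "?U \<inter> topspace (proj_space m) = topspace (proj_space m)" for m
    by (rule Int_absorb1) (rule UN_upper, simp)
  then have "openin proj_space_inf ?U"
    unfolding openin_proj_space_inf by simp
  then show "?U \<subseteq> topspace proj_space_inf"
    by (rule openin_subset)
qed

lemma mem_topspace_proj_space_inf:
  fixes L :: "(nat \<Rightarrow> 'f::real_normed_field) set"
  shows "L \<in> topspace proj_space_inf \<longleftrightarrow>
    (\<exists>v. L = proj_point v \<and> finite {i. v i \<noteq> 0} \<and> (\<exists>i. v i \<noteq> 0))"
proof
  assume "L \<in> topspace proj_space_inf"
  then obtain n v where L: "L = proj_point v" and v: "\<exists>i. v i \<noteq> 0" "\<forall>i>n. v i = 0"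
    by (auto simp: topspace_proj_space_inf proj_space_def topspace_punctured_space)
  have "{i. v i \<noteq> 0} \<subseteq> {..n}" using v(2) by (auto simp: not_less[symmetric])
  then show "\<exists>v. L = proj_point v \<and> finite {i. v i \<noteq> 0} \<and> (\<exists>i. v i \<noteq> 0)"
    using L v(1) by (intro exI[of _ v]) (auto intro: finite_subset)
next
  assume "\<exists>v. L = proj_point v \<and> finite {i. v i \<noteq> 0} \<and> (\<exists>i. v i \<noteq> 0)"
  then obtain v where L: "L = proj_point v" and v: "finite {i. v i \<noteq> 0}" "\<exists>i. v i \<noteq> 0"
    by blast
  from v(1) obtain n where "\<forall>i\<in>{i. v i \<noteq> 0}. i \<le> n"
    using finite_nat_set_iff_bounded_le by blast
  then have "v \<in> topspace (punctured_space n)"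
    using v(2) by (auto simp: topspace_punctured_space)
  then have "L \<in> topspace (proj_space n)"
    unfolding L proj_space_def by simp
  then show "L \<in> topspace proj_space_inf"
    by (auto simp: topspace_proj_space_inf)
qed

lemma continuous_map_proj_space_inf:
  fixes f :: "'a \<Rightarrow> (nat \<Rightarrow> 'f::real_normed_field) set"
  assumes "continuous_map X (proj_space n) f"
  shows "continuous_map X proj_space_inf f"
proof -
  have "continuous_map (proj_space n) proj_space_inf (\<lambda>L :: (nat \<Rightarrow> 'f) set. L)"
    unfolding continuous_map_alt
  proof (intro conjI allI impI)
    fix U :: "(nat \<Rightarrow> 'f) set set" assume "openin proj_space_inf U"
    then have "openin (proj_space n) (U \<inter> topspace (proj_space n))"
      by (simp add: openin_proj_space_inf)
    then show "openin (proj_space n) ((\<lambda>L. L) -` U \<inter> topspace (proj_space n))"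
      by simp
  qed (auto simp: topspace_proj_space_inf)
  from continuous_map_compose[OF assms this] show ?thesis by (simp add: o_def)
qed

text \<open>The universal property of the limit combined with that of each quotient: continuity of a
  function of lines is checked on spanning vectors.\<close>

lemma continuous_map_from_proj_space_inf:
  assumes "\<And>n. continuous_map (punctured_space n) Y (\<lambda>v. F (proj_point v))"
  shows "continuous_map proj_space_inf Y F"
proof -
  have n: "continuous_map (proj_space n) Y F" for n
    unfolding proj_space_def
    by (rule continuous_compose_quotient_map[OF quotient_map_quotient_topology])
       (use assms[of n] in \<open>simp add: o_def\<close>)
  show ?thesis
    unfolding continuous_map_alt
  proof (intro conjI allI impI)
    fix U assume "openin Y U"
    then have "openin (proj_space n) (F -` U \<inter> topspace (proj_space n))" for n
      using n[of n] unfolding continuous_map_alt by blast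
    moreover have "(F -` U \<inter> topspace proj_space_inf) \<inter> topspace (proj_space n) =
        F -` U \<inter> topspace (proj_space n)" for n
      by (auto simp: topspace_proj_space_inf)
    ultimately show "openin proj_space_inf (F -` U \<inter> topspace proj_space_inf)"
      unfolding openin_proj_space_inf by (auto simp: topspace_proj_space_inf)
  next
    show "F \<in> topspace proj_space_inf \<rightarrow> topspace Y"
      using n by (fastforce simp: topspace_proj_space_inf continuous_map_alt)
  qed
qed

text \<open>A line subbundle of a trivial bundle, given by nonvanishing local sections over an open
  cover. The bound \<open>N\<close> is uniform, so that the induced map lands in a single
  \<open>proj_space N\<close>, whose topology is a plain quotient. Values of \<open>v j\<close>
  outside \<open>B j\<close> are unconstrained.\<close>

definition proj_frame ::
    "'a::topological_space set \<Rightarrow> 'j set \<Rightarrow> ('j \<Rightarrow> 'a set) \<Rightarrow> nat \<Rightarrow>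
     ('j \<Rightarrow> 'a \<Rightarrow> nat \<Rightarrow> 'f::real_normed_field) \<Rightarrow> bool" where
  "proj_frame X J B N v \<longleftrightarrow>
     (\<forall>j\<in>J. openin (top_of_set X) (B j)) \<and> X \<subseteq> \<Union>(B ` J) \<and>
     (\<forall>j\<in>J. \<forall>i. continuous_on (B j) (\<lambda>b. v j b i)) \<and>
     (\<forall>j\<in>J. \<forall>b\<in>B j. (\<exists>i. v j b i \<noteq> 0) \<and> (\<forall>i>N. v j b i = 0)) \<and>
     (\<forall>j\<in>J. \<forall>k\<in>J. \<forall>b\<in>B j \<inter> B k. \<exists>c. c \<noteq> 0 \<and> v j b = (\<lambda>i. c * v k b i))"

lemma proj_frame_nonzero:
  assumes "proj_frame X J B N v" "j \<in> J" "b \<in> B j"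
  obtains i where "v j b i \<noteq> 0"
  using assms unfolding proj_frame_def by blast

lemma proj_frame_map:
  assumes "proj_frame X J B N v"
  obtains f where "continuous_map (top_of_set X) (proj_space N) f"
    and "\<And>j b. j \<in> J \<Longrightarrow> b \<in> B j \<Longrightarrow> f b = proj_point (v j b)"
proof -
  have B: "openin (top_of_set X) (B j)" if "j \<in> J" for j
    using assms that by (simp add: proj_frame_def)
  then have BX: "B j \<subseteq> X" if "j \<in> J" for j
    using that openin_imp_subset by blast
  obtain f where f: "continuous_map (top_of_set X) (proj_space N) f"
    and fv: "\<And>b j. j \<in> J \<Longrightarrow> b \<in> topspace (top_of_set X) \<inter> B j \<Longrightarrow> f b = proj_point (v j b)"
  proof (rule pasting_lemma_exists[of "top_of_set X" B J "proj_space N" "\<lambda>j b. proj_point (v j b)"])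
    show "topspace (top_of_set X) \<subseteq> \<Union>(B ` J)"
      using assms by (simp add: proj_frame_def)
    show "openin (top_of_set X) (B j)" if "j \<in> J" for j
      using that by (rule B)
    show "continuous_map (subtopology (top_of_set X) (B j)) (proj_space N) (\<lambda>b. proj_point (v j b))"
      if j: "j \<in> J" for j
    proof -
      have "continuous_map (top_of_set (B j)) (punctured_space N) (v j)"
        using assms j by (simp add: continuous_map_punctured_space proj_frame_def)
      then have "continuous_map (top_of_set (B j)) (proj_space N) (proj_point \<circ> v j)"
        by (rule continuous_map_compose[OF _ continuous_map_proj_point])
      then show ?thesis
        using BX[OF j] by (simp add: o_def subtopology_subtopology Int_absorb1)
    qed
    show "proj_point (v i b) = proj_point (v j b)"
      if "i \<in> J" "j \<in> J" "b \<in> topspace (top_of_set X) \<inter> B i \<inter> B j" for i j b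
      using that assms by (auto simp: proj_point_eq_iff proj_frame_def)
  qed blast
  then show thesis
    using that BX by (auto simp: subset_iff)
qed

text \<open>Disjointness of the coordinates used by \<open>v\<close> and \<open>w\<close> keeps the straight line from \<open>v\<close> to \<open>w\<close> away from zero.\<close>

lemma homotopic_proj_frames_disjoint:
  fixes v w :: "'j \<Rightarrow> 'a::topological_space \<Rightarrow> nat \<Rightarrow> 'f::real_normed_field"
  assumes v: "proj_frame X J B N v" and w: "proj_frame X J B N w"
    and disj: "\<And>j b i. v j b i = 0 \<or> w j b i = 0"
    and trans: "\<And>j k b. j \<in> J \<Longrightarrow> k \<in> J \<Longrightarrow> b \<in> B j \<inter> B k \<Longrightarrow>
      \<exists>c. c \<noteq> 0 \<and> v j b = (\<lambda>i. c * v k b i) \<and> w j b = (\<lambda>i. c * w k b i)"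
    and f: "\<And>j b. j \<in> J \<Longrightarrow> b \<in> B j \<Longrightarrow> f b = proj_point (v j b)"
    and g: "\<And>j b. j \<in> J \<Longrightarrow> b \<in> B j \<Longrightarrow> g b = proj_point (w j b)"
  shows "homotopic_with (\<lambda>_. True) (top_of_set X) proj_space_inf f g"
proof -
  define C where "C j = {0..1::real} \<times> B j" for j
  define u :: "'j \<Rightarrow> real \<times> 'a \<Rightarrow> nat \<Rightarrow> 'f" where
    "u j p i = of_real (1 - fst p) * v j (snd p) i + of_real (fst p) * w j (snd p) i" for j p i
  have cover: "X \<subseteq> \<Union>(B ` J)" using v by (simp add: proj_frame_def)
  \<comment> \<open>The segments form a frame over the cylinder, and \<open>proj_frame_map\<close>
    turns it into the homotopy. On overlaps both ends change by the same factor, hence so does every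
    point between them.\<close>
  have "proj_frame ({0..1} \<times> X) J C N u"
    unfolding proj_frame_def
  proof (intro conjI ballI allI impI)
    fix j assume j: "j \<in> J"
    have "openin (top_of_set X) (B j)" using v j by (simp add: proj_frame_def)
    then show "openin (top_of_set ({0..1} \<times> X)) (C j)"
      unfolding C_def by (metis openin_Times openin_subtopology_self)
    have cv: "continuous_on (C j) (\<lambda>p. v j (snd p) i)" for i
      by (rule continuous_on_compose2[of "B j" "\<lambda>b. v j b i"])
         (use v j in \<open>auto simp: proj_frame_def C_def intro!: continuous_intros\<close>)
    have cw: "continuous_on (C j) (\<lambda>p. w j (snd p) i)" for i
      by (rule continuous_on_compose2[of "B j" "\<lambda>b. w j b i"])
         (use w j in \<open>auto simp: proj_frame_def C_def intro!: continuous_intros\<close>)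
    show "continuous_on (C j) (\<lambda>p. u j p i)" for i
      unfolding u_def by (intro continuous_intros cv cw)
    fix p assume p: "p \<in> C j"
    then have b: "snd p \<in> B j" by (auto simp: C_def)
    obtain i where i: "v j (snd p) i \<noteq> 0" using proj_frame_nonzero[OF v j b] .
    obtain i' where i': "w j (snd p) i' \<noteq> 0" using proj_frame_nonzero[OF w j b] .
    show "\<exists>i. u j p i \<noteq> 0"
    proof (cases "fst p = 1")
      case True
      then show ?thesis using i' disj[of j "snd p" i'] by (auto simp: u_def)
    next
      case False
      then have "of_real (1 - fst p) \<noteq> (0::'f)" by (metis of_real_eq_0_iff right_minus_eq)
      then have "u j p i \<noteq> 0" using i disj[of j "snd p" i] by (auto simp: u_def)
      then show ?thesis by blast
    qed
    show "u j p i = 0" if "i > N" for i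
      using v w j b that by (simp add: u_def proj_frame_def)
  next
    fix j k p assume "j \<in> J" "k \<in> J" "p \<in> C j \<inter> C k"
    then obtain c where "c \<noteq> 0" "v j (snd p) = (\<lambda>i. c * v k (snd p) i)"
      "w j (snd p) = (\<lambda>i. c * w k (snd p) i)"
      using trans[of j k "snd p"] by (auto simp: C_def)
    then show "\<exists>c. c \<noteq> 0 \<and> u j p = (\<lambda>i. c * u k p i)"
      by (auto simp: u_def algebra_simps intro!: exI[of _ c])
  qed (use cover in \<open>auto simp: C_def\<close>)
  then obtain h where h: "continuous_map (top_of_set ({0..1} \<times> X)) (proj_space N) h"
    and hu: "\<And>j p. j \<in> J \<Longrightarrow> p \<in> C j \<Longrightarrow> h p = proj_point (u j p)"
    by (rule proj_frame_map) blast
  show ?thesis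
  proof (subst homotopic_with)
    show "\<exists>h. continuous_map (prod_topology (top_of_set {0..1::real}) (top_of_set X)) proj_space_inf h \<and>
        (\<forall>x\<in>topspace (top_of_set X). h (0, x) = f x) \<and>
        (\<forall>x\<in>topspace (top_of_set X). h (1, x) = g x) \<and> (\<forall>t\<in>{0..1::real}. True)"
    proof (intro exI[of _ h] conjI ballI)
      show "continuous_map (prod_topology (top_of_set {0..1}) (top_of_set X)) proj_space_inf h"
        using continuous_map_proj_space_inf[OF h] by simp
      fix b assume "b \<in> topspace (top_of_set X)"
      then obtain j where j: "j \<in> J" "b \<in> B j" using cover by auto
      have "u j (0, b) = v j b" "u j (1, b) = w j b"
        by (auto simp: u_def)
      then show "h (0, b) = f b" "h (1, b) = g b"
        using hu[of j "(0, b)"] hu[of j "(1, b)"] f[of j b] g[of j b] j by (simp_all add: C_def)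
    qed simp
  qed simp
qed

text \<open>\<open>v\<close> and \<open>w\<close> may use the same coordinates, so a segment between
  them could pass through zero. Both are joined instead to a third frame, \<open>w\<close> shifted
  beyond coordinate \<open>N\<close>. The shift is linear, so it keeps the transition
  factors.\<close>

lemma homotopic_proj_frames:
  fixes v w :: "'j \<Rightarrow> 'a::topological_space \<Rightarrow> nat \<Rightarrow> 'f::real_normed_field"
  assumes v: "proj_frame X J B N v" and w: "proj_frame X J B N w"
    and trans: "\<And>j k b. j \<in> J \<Longrightarrow> k \<in> J \<Longrightarrow> b \<in> B j \<inter> B k \<Longrightarrow>
      \<exists>c. c \<noteq> 0 \<and> v j b = (\<lambda>i. c * v k b i) \<and> w j b = (\<lambda>i. c * w k b i)"
    and f: "\<And>j b. j \<in> J \<Longrightarrow> b \<in> B j \<Longrightarrow> f b = proj_point (v j b)"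
    and g: "\<And>j b. j \<in> J \<Longrightarrow> b \<in> B j \<Longrightarrow> g b = proj_point (w j b)"
  shows "homotopic_with (\<lambda>_. True) (top_of_set X) proj_space_inf f g"
proof -
  \<comment> \<open>Frame vectors are arbitrary outside \<open>B j\<close>, while
    \<open>homotopic_proj_frames_disjoint\<close> asks for disjoint supports everywhere. Truncation
    enforces this and changes no vector over \<open>B j\<close>.\<close>
  define cut where "cut u j b i = (if i \<le> N then u j b i else 0)"
    for u :: "'j \<Rightarrow> 'a \<Rightarrow> nat \<Rightarrow> 'f" and j b i
  define w' where "w' j b i = (if i > N then cut w j b (i - Suc N) else 0)" for j b i
  \<comment> \<open>The last coordinate reached when \<open>0..N\<close> is shifted by
    \<open>Suc N\<close>.\<close>
  let ?M = "2 * N + 1"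
  have cut: "proj_frame X J B ?M (cut u)" and eq: "\<And>j b. j \<in> J \<Longrightarrow> b \<in> B j \<Longrightarrow> cut u j b = u j b"
    if u: "proj_frame X J B N u" for u
  proof -
    show eq: "cut u j b = u j b" if "j \<in> J" "b \<in> B j" for j b
      using u that unfolding cut_def proj_frame_def by (auto simp: not_le)
    have "continuous_on (B j) (\<lambda>b. cut u j b i)" if "j \<in> J" for i j
      using u that by (cases "i \<le> N") (auto simp: cut_def proj_frame_def)
    then show "proj_frame X J B ?M (cut u)"
      using u eq unfolding proj_frame_def by (auto simp: cut_def)
  qed
  have eqv: "cut v j b = v j b" and eqw: "cut w j b = w j b" if "j \<in> J" "b \<in> B j" for j b
    using eq[OF v that] eq[OF w that] .
  have nz: "\<exists>i. w' j b i \<noteq> 0" if "j \<in> J" "b \<in> B j" for j b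
  proof -
    obtain i where "w j b i \<noteq> 0" using w \<open>j \<in> J\<close> \<open>b \<in> B j\<close> by (rule proj_frame_nonzero)
    then have "w' j b (i + Suc N) \<noteq> 0" using eqw[OF that] by (simp add: w'_def)
    then show ?thesis ..
  qed
  have trw: "w' j b = (\<lambda>i. c * w' k b i)" if "w j b = (\<lambda>i. c * w k b i)" for j k b c
    using that by (auto simp: w'_def cut_def fun_eq_iff)
  have w': "proj_frame X J B ?M w'"
    unfolding proj_frame_def
  proof (intro conjI ballI allI impI)
    fix j i assume j: "j \<in> J"
    have "continuous_on (B j) (\<lambda>b. cut w j b i)" for i
      using cut[OF w] j by (simp add: proj_frame_def)
    then show "continuous_on (B j) (\<lambda>b. w' j b i)"
      by (cases "i > N") (auto simp: w'_def)
  next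
    fix j k b assume "j \<in> J" "k \<in> J" "b \<in> B j \<inter> B k"
    then show "\<exists>c. c \<noteq> 0 \<and> w' j b = (\<lambda>i. c * w' k b i)"
      using trans trw by metis
  qed (use w nz in \<open>auto simp: proj_frame_def w'_def cut_def\<close>)
  obtain m where m: "\<And>j b. j \<in> J \<Longrightarrow> b \<in> B j \<Longrightarrow> m b = proj_point (w' j b)"
    by (rule proj_frame_map[OF w']) blast
  have "homotopic_with (\<lambda>_. True) (top_of_set X) proj_space_inf f m"
  proof (rule homotopic_proj_frames_disjoint[OF cut[OF v] w'])
    show "\<exists>c. c \<noteq> 0 \<and> cut v j b = (\<lambda>i. c * cut v k b i) \<and> w' j b = (\<lambda>i. c * w' k b i)"
      if "j \<in> J" "k \<in> J" "b \<in> B j \<inter> B k" for j k b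
      using trans[OF that] trw eqv that by (metis Int_iff)
  qed (use f eqv m in \<open>auto simp: cut_def w'_def\<close>)
  moreover have "homotopic_with (\<lambda>_. True) (top_of_set X) proj_space_inf g m"
  proof (rule homotopic_proj_frames_disjoint[OF cut[OF w] w'])
    show "\<exists>c. c \<noteq> 0 \<and> cut w j b = (\<lambda>i. c * cut w k b i) \<and> w' j b = (\<lambda>i. c * w' k b i)"
      if "j \<in> J" "k \<in> J" "b \<in> B j \<inter> B k" for j k b
      using trans[OF that] trw eqw that by (metis Int_iff)
  qed (use g eqw m in \<open>auto simp: cut_def w'_def\<close>)
  ultimately show ?thesis
    by (meson homotopic_with_symD homotopic_with_trans)
qed

section \<open>Transport of lines along a homotopy\<close>

lemma continuous_on_locallyI:
  fixes f :: "'a::t2_space \<Rightarrow> 'b::topological_space"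
  assumes "\<And>x. x \<in> S \<Longrightarrow> \<exists>U. open U \<and> x \<in> U \<and> continuous_on (S \<inter> U) f"
  shows "continuous_on S f"
  unfolding continuous_on_eq_continuous_within
proof
  fix x assume x: "x \<in> S"
  then obtain U where U: "open U" "x \<in> U" "continuous_on (S \<inter> U) f" using assms by blast
  then have "continuous (at x within S \<inter> U) f"
    using x by (simp add: continuous_on_eq_continuous_within)
  moreover have "at x within S \<inter> U = at x within S"
    using U by (intro at_within_nhd[of x U]) auto
  ultimately show "continuous (at x within S) f"
    by (simp add: continuous_within)
qed

lemma continuous_on_punctured_space:
  "continuous_map (punctured_space n) euclidean F \<longleftrightarrow>
     continuous_on {v. (\<exists>i. v i \<noteq> 0) \<and> (\<forall>i>n. v i = 0)} F"
  by (simp add: punctured_space_def euclidean_product_topology)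

text \<open>For real and complex scalars this is conjugation, written with the operations of a
  normed field. Division by zero gives 0 and the value at \<open>y\<close> has norm
  \<open>norm y\<close>, so continuity also holds at 0.\<close>

lemma continuous_on_norm_squared_divide:
  fixes f :: "'a::topological_space \<Rightarrow> 'f::real_normed_field"
  assumes "continuous_on S f"
  shows "continuous_on S (\<lambda>x. of_real ((norm (f x))\<^sup>2) / f x)"
proof -
  have "isCont (\<lambda>y::'f. of_real ((norm y)\<^sup>2) / y) y" for y
  proof (cases "y = 0")
    case True
    have "((\<lambda>y::'f. of_real ((norm y)\<^sup>2) / y) \<longlongrightarrow> 0) (at 0)"
    proof (rule tendsto_norm_zero_cancel)
      have "norm (of_real ((norm y)\<^sup>2) / y) = norm y" for y :: 'f
        by (cases "y = 0") (simp_all add: norm_divide norm_mult power2_eq_square)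
      then show "((\<lambda>y::'f. norm (of_real ((norm y)\<^sup>2) / y)) \<longlongrightarrow> 0) (at 0)"
        using tendsto_norm_zero[OF tendsto_ident_at[of "0::'f" UNIV]] by simp
    qed
    then show ?thesis using True by (simp add: isCont_def)
  next
    case False
    then show ?thesis by (intro continuous_intros) auto
  qed
  then have "continuous_on UNIV (\<lambda>y::'f. of_real ((norm y)\<^sup>2) / y)"
    by (simp add: continuous_on_eq_continuous_at)
  from continuous_on_compose2[OF this assms] show ?thesis by simp
qed

section \<open>Scale-invariant coordinates of a line and a locally finite projection\<close>

definition coord_norm :: "(nat \<Rightarrow> 'f::real_normed_field) \<Rightarrow> real" where
  "coord_norm v = (\<Sum>i | v i \<noteq> 0. norm (v i))"

text \<open>The choice need not depend continuously on \<open>L\<close>; the quantities formed from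
  it below are unchanged when the representative is rescaled.\<close>

definition line_rep :: "(nat \<Rightarrow> 'f) set \<Rightarrow> nat \<Rightarrow> 'f" where
  "line_rep L = (SOME v. v \<in> L)"

definition coord_share :: "(nat \<Rightarrow> 'f::real_normed_field) set \<Rightarrow> nat \<Rightarrow> real" where
  "coord_share L i = norm (line_rep L i) / coord_norm (line_rep L)"

text \<open>For a spanning vector \<open>v\<close> over the real or complex numbers, entry
  \<open>k\<close> is the conjugate of \<open>v i\<close> times \<open>v k\<close>, divided by the
  square of the l1 norm: up to normalisation, column \<open>i\<close> of the orthogonal projection
  onto \<open>L\<close>. The squared share cancels the pole of \<open>1 / v i\<close>, so the vector
  tends to 0, which is also its value under division by zero, where coordinate \<open>i\<close>
  vanishes.\<close>

definition line_vec :: "(nat \<Rightarrow> 'f::real_normed_field) set \<Rightarrow> nat \<Rightarrow> nat \<Rightarrow> 'f" where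
  "line_vec L i k = of_real ((coord_share L i)\<^sup>2) * (line_rep L k / line_rep L i)"

text \<open>Milnor's trick: since the shares are at most \<open>1\<close>, these weights are locally finite.\<close>

definition line_weight :: "(nat \<Rightarrow> 'f::real_normed_field) set \<Rightarrow> nat \<Rightarrow> real" where
  "line_weight L i = max 0 (coord_share L i - real i * (\<Sum>k<i. coord_share L k))"

lemma coord_norm_eq: "\<forall>i>n. v i = 0 \<Longrightarrow> coord_norm v = (\<Sum>i\<le>n. norm (v i))"
  unfolding coord_norm_def by (rule sum.mono_neutral_left) (auto simp: not_less[symmetric])

lemma coord_norm_scale: "c \<noteq> 0 \<Longrightarrow> coord_norm (\<lambda>i. c * v i) = norm c * coord_norm v"
  by (simp add: coord_norm_def norm_mult sum_distrib_left)

lemma line_rep_proj_point: obtains c where "c \<noteq> 0" "line_rep (proj_point v) = (\<lambda>i. c * v i)"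
proof -
  have "line_rep (proj_point v) \<in> proj_point v"
    unfolding line_rep_def by (rule someI[of _ v]) (rule proj_point_self)
  then show thesis using that by (auto simp: proj_point_def)
qed

lemma coord_share_proj_point: "coord_share (proj_point v) i = norm (v i) / coord_norm v"
proof -
  obtain c where "c \<noteq> 0" "line_rep (proj_point v) = (\<lambda>i. c * v i)"
    by (rule line_rep_proj_point)
  then show ?thesis by (simp add: coord_share_def coord_norm_scale norm_mult)
qed

lemma line_vec_proj_point:
  "line_vec (proj_point v) i k = of_real ((coord_share (proj_point v) i)\<^sup>2) * (v k / v i)"
proof -
  obtain c where "c \<noteq> 0" "line_rep (proj_point v) = (\<lambda>i. c * v i)"
    by (rule line_rep_proj_point)
  then show ?thesis by (simp add: line_vec_def)
qed

lemma coord_norm_pos: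
  assumes "finite {i. v i \<noteq> 0}" "v i \<noteq> 0"
  shows "0 < coord_norm v"
  unfolding coord_norm_def by (rule sum_pos2[OF assms(1), of i]) (use assms in auto)

lemma coord_share_nonneg: "0 \<le> coord_share L i"
  by (simp add: coord_share_def coord_norm_def sum_nonneg)

lemma coord_share_le_1:
  assumes "L \<in> topspace proj_space_inf" shows "coord_share L i \<le> 1"
proof -
  obtain v where v: "L = proj_point v" "finite {i. v i \<noteq> 0}"
    using assms by (auto simp: mem_topspace_proj_space_inf)
  show ?thesis
  proof (cases "v i = 0")
    case False
    have "norm (v i) \<le> coord_norm v"
      unfolding coord_norm_def by (rule member_le_sum) (use False v in auto)
    then show ?thesis using coord_norm_pos[OF v(2) False] by (simp add: v(1) coord_share_proj_point)
  qed (simp add: v(1) coord_share_proj_point)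
qed

lemma continuous_map_coord_share:
  "continuous_map proj_space_inf euclideanreal (\<lambda>L :: (nat \<Rightarrow> 'f::real_normed_field) set. coord_share L i)"
proof (rule continuous_map_from_proj_space_inf)
  fix n
  let ?S = "{v :: nat \<Rightarrow> 'f. (\<exists>i. v i \<noteq> 0) \<and> (\<forall>i>n. v i = 0)}"
  have nz: "(\<Sum>i\<le>n. norm (v i)) \<noteq> 0" if "v \<in> ?S" for v
    using that by (auto simp: sum_nonneg_eq_0_iff) (metis atMost_iff not_le)
  have "continuous_on ?S (\<lambda>v. norm (v i) / (\<Sum>i\<le>n. norm (v i)))"
    by (intro continuous_intros continuous_on_subset[OF continuous_on_product_coordinates] subset_UNIV)
       (use nz in blast)
  then have "continuous_on ?S (\<lambda>v. coord_share (proj_point v) i)"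
    by (rule continuous_on_eq) (auto simp: coord_share_proj_point coord_norm_eq)
  then show "continuous_map (punctured_space n) euclideanreal (\<lambda>v :: nat \<Rightarrow> 'f. coord_share (proj_point v) i)"
    by (simp add: continuous_on_punctured_space)
qed

lemma continuous_map_line_vec:
  "continuous_map proj_space_inf euclidean (\<lambda>L :: (nat \<Rightarrow> 'f::real_normed_field) set. line_vec L i k)"
proof (rule continuous_map_from_proj_space_inf)
  fix n
  let ?S = "{v :: nat \<Rightarrow> 'f. (\<exists>i. v i \<noteq> 0) \<and> (\<forall>i>n. v i = 0)}"
  have nz: "(\<Sum>i\<le>n. norm (v i)) \<noteq> 0" if "v \<in> ?S" for v
    using that by (auto simp: sum_nonneg_eq_0_iff) (metis atMost_iff not_le)
  have "continuous_on ?S (\<lambda>v. of_real (1 / (\<Sum>i\<le>n. norm (v i))\<^sup>2) * (of_real ((norm (v i))\<^sup>2) / v i) * v k)"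
    by (intro continuous_intros continuous_on_norm_squared_divide
          continuous_on_subset[OF continuous_on_product_coordinates] subset_UNIV)
       (use nz in auto)
  then have "continuous_on ?S (\<lambda>v. line_vec (proj_point v) i k)"
    by (rule continuous_on_eq)
       (auto simp: line_vec_proj_point coord_share_proj_point coord_norm_eq power_divide)
  then show "continuous_map (punctured_space n) euclidean (\<lambda>v :: nat \<Rightarrow> 'f. line_vec (proj_point v) i k)"
    by (simp add: continuous_on_punctured_space)
qed

text \<open>Local finiteness of the weights: once share \<open>l\<close> is at least
  \<open>c\<close>, an index \<open>i\<close> that is larger than \<open>l\<close> and at least
  \<open>1 / c\<close> has at least 1 subtracted, while the share itself is at most 1.\<close>

lemma line_weight_eq_0:
  assumes "L \<in> topspace proj_space_inf" "c \<le> coord_share L l" "l < i" "1 \<le> real i * c"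
  shows "line_weight L i = 0"
proof -
  have "c \<le> (\<Sum>k<i. coord_share L k)"
    using member_le_sum[of l "{..<i}" "coord_share L"] assms(2,3) coord_share_nonneg[of L]
    by fastforce
  then have "1 \<le> real i * (\<Sum>k<i. coord_share L k)"
    using assms(4) by (smt (verit) mult_left_mono of_nat_0_le_iff)
  then show ?thesis
    using coord_share_le_1[OF assms(1), of i] by (simp add: line_weight_def)
qed

lemma coord_share_pos_if_weight: "line_weight L i \<noteq> 0 \<Longrightarrow> 0 < coord_share L i"
proof -
  assume "line_weight L i \<noteq> 0"
  then have "0 < coord_share L i - real i * (\<Sum>k<i. coord_share L k)"
    by (simp add: line_weight_def max_def split: if_splits)
  moreover have "0 \<le> real i * (\<Sum>k<i. coord_share L k)"
    by (simp add: coord_share_nonneg sum_nonneg)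
  ultimately show "0 < coord_share L i" by linarith
qed

text \<open>At the first nonzero coordinate all earlier shares vanish, so nothing is subtracted and
  the weight is the share itself.\<close>

lemma line_weight_first:
  assumes "L \<in> topspace proj_space_inf"
  obtains i where "0 < line_weight L i"
proof -
  obtain v i where v: "L = proj_point v" "finite {i. v i \<noteq> 0}" "v i \<noteq> 0"
    using assms by (auto simp: mem_topspace_proj_space_inf)
  define m where "m = (LEAST i. v i \<noteq> 0)"
  have m: "v m \<noteq> 0" unfolding m_def by (rule LeastI[of "\<lambda>i. v i \<noteq> 0", OF v(3)])
  have "coord_share L k = 0" if "k < m" for k
    using not_less_Least[of k "\<lambda>i. v i \<noteq> 0"] that by (simp add: m_def v(1) coord_share_proj_point)
  then have "line_weight L m = coord_share L m"
    using coord_share_nonneg[of L] by (simp add: line_weight_def)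
  moreover have "0 < coord_share L m"
    using m coord_norm_pos[OF v(2) m] by (simp add: v(1) coord_share_proj_point)
  ultimately show thesis using that[of m] by simp
qed

lemma finite_line_weight:
  assumes "L \<in> topspace proj_space_inf" shows "finite {i. line_weight L i \<noteq> 0}"
proof -
  obtain v where v: "L = proj_point v" "finite {i. v i \<noteq> 0}"
    using assms by (auto simp: mem_topspace_proj_space_inf)
  have "{i. line_weight L i \<noteq> 0} \<subseteq> {i. v i \<noteq> 0}"
    using coord_share_pos_if_weight[of L] by (force simp: v(1) coord_share_proj_point)
  then show ?thesis using v(2) by (rule finite_subset)
qed

lemma eq_proj_point:
  assumes "v \<in> L" "L \<in> topspace proj_space_inf"
  shows "proj_point v = L"
proof -
  obtain w where w: "L = proj_point w" using assms(2) by (auto simp: mem_topspace_proj_space_inf)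
  then obtain c where "c \<noteq> 0" "v = (\<lambda>i. c * w i)" using assms(1) by (auto simp: proj_point_def)
  then show ?thesis unfolding w proj_point_eq_iff by blast
qed

text \<open>For \<open>v\<close> in \<open>L\<close> and an index of nonzero weight,
  \<open>v i\<close> times \<open>line_vec L i\<close> is the squared share times \<open>v\<close>.
  Dividing by this sum therefore makes \<open>line_proj\<close> fix every vector of
  \<open>L\<close>.\<close>

definition line_mass :: "(nat \<Rightarrow> 'f::real_normed_field) set \<Rightarrow> real" where
  "line_mass L = (\<Sum>i | line_weight L i \<noteq> 0. line_weight L i * (coord_share L i)\<^sup>2)"

text \<open>A substitute for the orthogonal projection onto the line \<open>L\<close> that involves only finitely many
  coordinates near each line.\<close>

definition line_proj :: "(nat \<Rightarrow> 'f::real_normed_field) set \<Rightarrow> (nat \<Rightarrow> 'f) \<Rightarrow> nat \<Rightarrow> 'f" where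
  "line_proj L u k =
     (\<Sum>i | line_weight L i \<noteq> 0. of_real (line_weight L i) * u i * line_vec L i k) / of_real (line_mass L)"

lemma line_mass_pos:
  assumes "L \<in> topspace proj_space_inf" shows "0 < line_mass L"
proof -
  obtain i where i: "0 < line_weight L i" using line_weight_first[OF assms] .
  then have "0 < line_weight L i * (coord_share L i)\<^sup>2"
    using coord_share_pos_if_weight[of L i] by simp
  then show ?thesis
    unfolding line_mass_def
    by (intro sum_pos2[OF finite_line_weight[OF assms], of i])
       (use i in \<open>auto simp: line_weight_def\<close>)
qed

lemma line_proj_scale: "line_proj L (\<lambda>i. c * u i) k = c * line_proj L u k"
  by (simp add: line_proj_def sum_distrib_left mult_ac)

lemma line_proj_in_line:
  assumes "v \<in> L" "L \<in> topspace proj_space_inf"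
  obtains d where "line_proj L u = (\<lambda>k. d * v k)"
proof -
  have L: "L = proj_point v" using assms by (rule eq_proj_point[symmetric])
  show thesis
  proof
    show "line_proj L u =
      (\<lambda>k. ((\<Sum>i | line_weight L i \<noteq> 0. of_real (line_weight L i) * u i * of_real ((coord_share L i)\<^sup>2) / v i)
        / of_real (line_mass L)) * v k)"
      unfolding line_proj_def
      by (simp add: L line_vec_proj_point sum_distrib_right sum_divide_distrib mult.assoc)
  qed
qed

lemma line_proj_self:
  assumes "v \<in> L" "L \<in> topspace proj_space_inf"
  shows "line_proj L v = v"
proof
  fix k
  have L: "L = proj_point v" using assms by (rule eq_proj_point[symmetric])
  have nz: "v i \<noteq> 0" if "line_weight L i \<noteq> 0" for i
    using coord_share_pos_if_weight[OF that] by (auto simp: L coord_share_proj_point)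
  have "(\<Sum>i | line_weight L i \<noteq> 0. of_real (line_weight L i) * v i * line_vec L i k) =
      (\<Sum>i | line_weight L i \<noteq> 0. of_real (line_weight L i * (coord_share L i)\<^sup>2) * v k)"
    by (rule sum.cong) (use nz in \<open>auto simp: L line_vec_proj_point\<close>)
  also have "\<dots> = of_real (line_mass L) * v k"
    by (simp add: line_mass_def sum_distrib_right)
  finally show "line_proj L v k = v k"
    using line_mass_pos[OF assms(2)] by (simp add: line_proj_def)
qed

lemma line_vec_mem:
  assumes "L \<in> topspace proj_space_inf" "0 < coord_share L l"
  shows "line_vec L l \<in> L"
proof -
  obtain v where v: "L = proj_point v" using assms(1) by (auto simp: mem_topspace_proj_space_inf)
  then have "v l \<noteq> 0" using assms(2) by (auto simp: coord_share_proj_point)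
  moreover have "line_vec L l = (\<lambda>k. (of_real ((coord_share L l)\<^sup>2) / v l) * v k)"
    by (auto simp: v line_vec_proj_point)
  ultimately show ?thesis
    using assms(2) unfolding v proj_point_def
    by (intro CollectI exI[of _ "of_real ((coord_share (proj_point v) l)\<^sup>2) / v l"]) (auto simp: v proj_point_def)
qed

text \<open>The index set of the sum varies with \<open>b\<close>. Around \<open>b0\<close> one
  share stays above half of its value there, and \<open>line_weight_eq_0\<close> then confines all
  contributing indices to a fixed range \<open>{..m}\<close>.\<close>

lemma continuous_on_line_proj:
  fixes f :: "'a::t2_space \<Rightarrow> (nat \<Rightarrow> 'f::real_normed_field) set"
  assumes f: "continuous_map (top_of_set S) proj_space_inf f"
    and u: "\<And>i. continuous_on S (\<lambda>b. u b i)"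
  shows "continuous_on S (\<lambda>b. line_proj (f b) (u b) k)"
proof (rule continuous_on_locallyI)
  fix b0 assume b0: "b0 \<in> S"
  have fS: "f b \<in> topspace proj_space_inf" if "b \<in> S" for b
    using f that by (auto simp: continuous_map_def)
  have share: "continuous_on S (\<lambda>b. coord_share (f b) i)" for i
    using continuous_map_compose[OF f continuous_map_coord_share] by (simp add: o_def)
  have vec: "continuous_on S (\<lambda>b. line_vec (f b) i k)" for i
    using continuous_map_compose[OF f continuous_map_line_vec] by (simp add: o_def)
  have weight: "continuous_on S (\<lambda>b. line_weight (f b) i)" for i
    unfolding line_weight_def by (intro continuous_intros share)
  obtain l where "0 < line_weight (f b0) l" using line_weight_first[OF fS[OF b0]] .
  then have l: "0 < coord_share (f b0) l" by (intro coord_share_pos_if_weight) simp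
  define c where "c = coord_share (f b0) l / 2"
  have c: "0 < c" "c < coord_share (f b0) l" using l by (auto simp: c_def)
  obtain U where U: "open U" "U \<inter> S = {b \<in> S. c < coord_share (f b) l}"
    using continuous_on_open_invariant[THEN iffD1, OF share, rule_format, of "{c<..}" l]
    by (auto simp: vimage_def)
  define m where "m = max l (nat \<lceil>1 / c\<rceil>)"
  have w0: "line_weight (f b) i = 0" if "b \<in> S \<inter> U" "i > m" for b i
  proof (rule line_weight_eq_0[of "f b" c l i])
    have "b \<in> U \<inter> S" using that(1) by blast
    then show "c \<le> coord_share (f b) l" unfolding U(2) by simp
    have "1 / c \<le> real i" using that(2) unfolding m_def by linarith
    then show "1 \<le> real i * c" using c(1) by (simp add: field_simps)
  qed (use that fS m_def in auto)
  show "\<exists>U. open U \<and> b0 \<in> U \<and> continuous_on (S \<inter> U) (\<lambda>b. line_proj (f b) (u b) k)"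
  proof (intro exI[of _ U] conjI)
    show "open U" by fact
    have "b0 \<in> {b \<in> S. c < coord_share (f b) l}" using b0 c(2) by simp
    then show "b0 \<in> U" unfolding U(2)[symmetric] by blast
    have mass: "line_mass (f b) = (\<Sum>i\<le>m. line_weight (f b) i * (coord_share (f b) i)\<^sup>2)"
      if "b \<in> S \<inter> U" for b
      unfolding line_mass_def using w0[OF that]
      by (intro sum.mono_neutral_left) (auto simp: not_less[symmetric])
    have "line_proj (f b) (u b) k =
        (\<Sum>i\<le>m. of_real (line_weight (f b) i) * u b i * line_vec (f b) i k) /
        of_real (\<Sum>i\<le>m. line_weight (f b) i * (coord_share (f b) i)\<^sup>2)" if "b \<in> S \<inter> U" for b
      unfolding line_proj_def mass[OF that, symmetric] using w0[OF that]
      by (intro arg_cong2[of _ _ _ _ "(/)"] sum.mono_neutral_left refl) (auto simp: not_less[symmetric])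
    note eq = this
    have "continuous_on (S \<inter> U) (\<lambda>b.
        (\<Sum>i\<le>m. of_real (line_weight (f b) i) * u b i * line_vec (f b) i k) /
        of_real (\<Sum>i\<le>m. line_weight (f b) i * (coord_share (f b) i)\<^sup>2))"
    proof (intro continuous_intros continuous_on_subset[OF weight] continuous_on_subset[OF u]
        continuous_on_subset[OF vec] continuous_on_subset[OF share])
      show "\<forall>b\<in>S \<inter> U. of_real (\<Sum>i\<le>m. line_weight (f b) i * (coord_share (f b) i)\<^sup>2) \<noteq> (0::'f)"
      proof
        fix b assume b: "b \<in> S \<inter> U"
        then have "0 < line_mass (f b)" using line_mass_pos fS by blast
        then show "of_real (\<Sum>i\<le>m. line_weight (f b) i * (coord_share (f b) i)\<^sup>2) \<noteq> (0::'f)"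
          unfolding mass[OF b] of_real_eq_0_iff by linarith
      qed
    qed auto
    then show "continuous_on (S \<inter> U) (\<lambda>b. line_proj (f b) (u b) k)"
      by (rule continuous_on_eq) (use eq in auto)
  qed
qed

section \<open>Neighbouring lines along a homotopy and the size of a safe step\<close>

text \<open>A point of projective space omits the zero vector, so membership in \<open>L'\<close>
  says that the projection does not annihilate \<open>L\<close>. The relation is directed, since the
  weights in the projection are those of \<open>L'\<close>.\<close>

definition near_lines :: "(nat \<Rightarrow> 'f::real_normed_field) set \<Rightarrow> (nat \<Rightarrow> 'f) set \<Rightarrow> bool" where
  "near_lines L L' \<longleftrightarrow> (\<forall>u\<in>L. line_proj L' u \<in> L')"

lemma mem_line_scale:
  assumes "v \<in> L" "L \<in> topspace proj_space_inf" "c \<noteq> 0"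
  shows "(\<lambda>i. c * v i) \<in> L"
  using assms(3) unfolding eq_proj_point[OF assms(1,2), symmetric] proj_point_def by blast

lemma mem_line_iff:
  assumes "v \<in> L" "L \<in> topspace proj_space_inf"
  shows "w \<in> L \<longleftrightarrow> (\<exists>c. c \<noteq> 0 \<and> w = (\<lambda>i. c * v i))"
  unfolding eq_proj_point[OF assms(1,2), symmetric] by (simp add: proj_point_def)

lemma line_nonempty:
  assumes "L \<in> topspace proj_space_inf" obtains v where "v \<in> L"
  using assms by (auto simp: mem_topspace_proj_space_inf intro: proj_point_self)

lemma near_linesI:
  assumes "L \<in> topspace proj_space_inf" "L' \<in> topspace proj_space_inf"
    and "u \<in> L" "line_proj L' u k \<noteq> 0"
  shows "near_lines L L'"
  unfolding near_lines_def
proof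
  fix w assume "w \<in> L"
  then obtain c where c: "c \<noteq> 0" "w = (\<lambda>i. c * u i)"
    using mem_line_iff[OF assms(3,1)] by blast
  obtain v where v: "v \<in> L'" using line_nonempty[OF assms(2)] .
  obtain d where d: "line_proj L' w = (\<lambda>k. d * v k)" by (rule line_proj_in_line[OF v assms(2)])
  have "line_proj L' w k \<noteq> 0" using assms(4) c by (simp add: line_proj_scale)
  then have "d \<noteq> 0" using d by auto
  then show "line_proj L' w \<in> L'" unfolding d by (rule mem_line_scale[OF v assms(2)])
qed

text \<open>Project \<open>line_vec (H z) l\<close> onto \<open>H z'\<close> and read off coordinate
  \<open>l\<close>. The result is jointly continuous in \<open>z\<close> and \<open>z'\<close>. At
  \<open>(z0, z0)\<close> the projection fixes the vector and the coordinate is a nonzero squared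
  share, so it stays nonzero nearby.\<close>

lemma near_lines_locally:
  fixes H :: "'a::metric_space \<Rightarrow> (nat \<Rightarrow> 'f::real_normed_field) set"
  assumes H: "continuous_map (top_of_set Z) proj_space_inf H" and z0: "z0 \<in> Z"
  obtains U where "open U" "z0 \<in> U" "\<And>z z'. z \<in> U \<inter> Z \<Longrightarrow> z' \<in> U \<inter> Z \<Longrightarrow> near_lines (H z) (H z')"
proof -
  have HZ: "H z \<in> topspace proj_space_inf" if "z \<in> Z" for z
    using H that by (auto simp: continuous_map_def)
  obtain l where "0 < line_weight (H z0) l" using line_weight_first[OF HZ[OF z0]] .
  then have l: "0 < coord_share (H z0) l" by (intro coord_share_pos_if_weight) simp
  define G where "G p = line_proj (H (snd p)) (line_vec (H (fst p)) l) l" for p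
  have fst: "continuous_map (top_of_set (Z \<times> Z)) (top_of_set Z) fst"
    and snd: "continuous_map (top_of_set (Z \<times> Z)) (top_of_set Z) snd"
    by (auto intro!: continuous_intros)
  have "continuous_on (Z \<times> Z) G"
    unfolding G_def
  proof (rule continuous_on_line_proj)
    show "continuous_map (top_of_set (Z \<times> Z)) proj_space_inf (\<lambda>p. H (snd p))"
      using continuous_map_compose[OF snd H] by (simp add: o_def)
    show "continuous_on (Z \<times> Z) (\<lambda>p. line_vec (H (fst p)) l i)" for i
      using continuous_map_compose[OF continuous_map_compose[OF fst H] continuous_map_line_vec]
      by (simp add: o_def)
  qed
  then obtain W where W: "open W" "W \<inter> (Z \<times> Z) = {p \<in> Z \<times> Z. G p \<noteq> 0}"
    using continuous_on_open_invariant[THEN iffD1, rule_format, of "Z \<times> Z" G "- {0}"]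
    by (auto simp: vimage_def)
  have "G (z0, z0) = line_vec (H z0) l l"
    using line_proj_self[OF line_vec_mem[OF HZ[OF z0] l] HZ[OF z0]] by (simp add: G_def)
  moreover have "line_vec (H z0) l l \<noteq> 0"
    using l by (auto simp: line_vec_def coord_share_def)
  ultimately have "(z0, z0) \<in> {p \<in> Z \<times> Z. G p \<noteq> 0}" using z0 by simp
  then have "(z0, z0) \<in> W" unfolding W(2)[symmetric] by blast
  then obtain A B where AB: "open A" "open B" "z0 \<in> A" "z0 \<in> B" "A \<times> B \<subseteq> W"
    using W(1) by (metis open_prod_elim mem_Sigma_iff)
  show thesis
  proof
    show "open (A \<inter> B)" "z0 \<in> A \<inter> B" using AB by auto
    fix z z' assume z: "z \<in> (A \<inter> B) \<inter> Z" "z' \<in> (A \<inter> B) \<inter> Z"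
    then have "(z, z') \<in> W \<inter> (Z \<times> Z)" using AB by auto
    then have nz: "line_proj (H z') (line_vec (H z) l) l \<noteq> 0" unfolding W(2) by (simp add: G_def)
    \<comment> \<open>\<open>line_vec (H z) l\<close> belongs to \<open>H z\<close> only if this
      share is nonzero; otherwise the vector is zero and so is its projection.\<close>
    have "coord_share (H z) l \<noteq> 0"
    proof
      assume "coord_share (H z) l = 0"
      then show False using nz by (simp add: line_proj_def line_vec_def)
    qed
    then have "0 < coord_share (H z) l" using coord_share_nonneg[of "H z" l] by simp
    then show "near_lines (H z) (H z')"
      using near_linesI[OF HZ HZ line_vec_mem nz] z HZ by auto
  qed
qed

text \<open>A Lebesgue number for the cover of the compact fibre \<open>{0..1} \<times> {b0}\<close>
  by the neighbourhoods of \<open>near_lines_locally\<close>.\<close>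

lemma near_lines_uniformly:
  fixes H :: "real \<times> 'a::metric_space \<Rightarrow> (nat \<Rightarrow> 'f::real_normed_field) set"
  assumes H: "continuous_map (top_of_set ({0..1} \<times> X)) proj_space_inf H" and b0: "b0 \<in> X"
  obtains \<epsilon> where "0 < \<epsilon>"
    "\<And>b s t. b \<in> X \<Longrightarrow> dist b0 b < \<epsilon> \<Longrightarrow> s \<in> {0..1} \<Longrightarrow> t \<in> {0..1} \<Longrightarrow> \<bar>s - t\<bar> < \<epsilon> \<Longrightarrow>
       near_lines (H (s, b)) (H (t, b))"
proof -
  define \<U> where "\<U> = {U. open U \<and> (\<forall>z \<in> U \<inter> ({0..1} \<times> X). \<forall>z' \<in> U \<inter> ({0..1} \<times> X). near_lines (H z) (H z'))}"
  have "{0..1::real} \<times> {b0} \<subseteq> \<Union>\<U>"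
  proof
    fix z assume "z \<in> {0..1::real} \<times> {b0}"
    then have "z \<in> {0..1::real} \<times> X" using b0 by auto
    then obtain U where "open U" "z \<in> U"
      "\<And>z z'. z \<in> U \<inter> ({0..1} \<times> X) \<Longrightarrow> z' \<in> U \<inter> ({0..1} \<times> X) \<Longrightarrow> near_lines (H z) (H z')"
      by (rule near_lines_locally[OF H]) blast
    then show "z \<in> \<Union>\<U>" by (intro UnionI[of U]) (simp_all add: \<U>_def)
  qed
  moreover have "compact ({0..1::real} \<times> {b0})" by (simp add: compact_Times)
  moreover have "open U" if "U \<in> \<U>" for U using that by (simp add: \<U>_def)
  ultimately obtain \<epsilon> where \<epsilon>: "0 < \<epsilon>" "\<And>z. z \<in> {0..1} \<times> {b0} \<Longrightarrow> \<exists>U\<in>\<U>. ball z \<epsilon> \<subseteq> U"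
    using Heine_Borel_lemma[of "{0..1::real} \<times> {b0}" \<U>] by metis
  show thesis
  \<comment> \<open>Halved because the product distance is estimated by the sum of the distances in
    the two components.\<close>
  proof (rule that[of "\<epsilon> / 2"])
    show "0 < \<epsilon> / 2" using \<epsilon> by simp
    fix b s t
    assume b: "b \<in> X" "dist b0 b < \<epsilon> / 2" and st: "s \<in> {0..1}" "t \<in> {0..1}" "\<bar>s - t\<bar> < \<epsilon> / 2"
    obtain U where U: "U \<in> \<U>" "ball (s, b0) \<epsilon> \<subseteq> U" using \<epsilon>(2)[of "(s, b0)"] st by auto
    have "dist (s, b0) (r, b) < \<epsilon>" if "\<bar>s - r\<bar> < \<epsilon> / 2" for r
    proof -
      have "dist (s, b0) (r, b) \<le> \<bar>dist s r\<bar> + \<bar>dist b0 b\<bar>"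
        unfolding dist_Pair_Pair by (rule sqrt_sum_squares_le_sum_abs)
      then show ?thesis using that b(2) by (simp add: dist_real_def)
    qed
    then have "(s, b) \<in> U" "(t, b) \<in> U" using U(2) st \<epsilon>(1) by (auto simp: subset_iff)
    then show "near_lines (H (s, b)) (H (t, b))" using U(1) b(1) st by (auto simp: \<U>_def)
  qed
qed

text \<open>If the radius \<open>\<epsilon>\<close> is admissible at \<open>b\<close>, then
  \<open>\<epsilon> - dist b b'\<close> is admissible at \<open>b'\<close>. So the supremum of the
  admissible radii is 1-Lipschitz, and \<open>near_lines_uniformly\<close> makes it
  positive.\<close>

lemma continuous_step_size:
  fixes H :: "real \<times> 'a::metric_space \<Rightarrow> (nat \<Rightarrow> 'f::real_normed_field) set"
  assumes H: "continuous_map (top_of_set ({0..1} \<times> X)) proj_space_inf H"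
  obtains \<delta> :: "'a \<Rightarrow> real" where "continuous_on X \<delta>" "\<And>b. b \<in> X \<Longrightarrow> 0 < \<delta> b"
    "\<And>b s t. b \<in> X \<Longrightarrow> s \<in> {0..1} \<Longrightarrow> t \<in> {0..1} \<Longrightarrow> \<bar>s - t\<bar> \<le> \<delta> b \<Longrightarrow>
       near_lines (H (s, b)) (H (t, b))"
proof -
  define P where "P b \<epsilon> \<longleftrightarrow> (\<forall>b'\<in>X. dist b b' < \<epsilon> \<longrightarrow>
    (\<forall>s\<in>{0..1}. \<forall>t\<in>{0..1}. \<bar>s - t\<bar> < \<epsilon> \<longrightarrow> near_lines (H (s, b')) (H (t, b'))))" for b \<epsilon>
  \<comment> \<open>Membership of 0 keeps the set nonempty and the cap 1 keeps it bounded, so its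
    supremum behaves as expected.\<close>
  define E where "E b = {\<epsilon> \<in> {0..1}. P b \<epsilon>}" for b
  define D where "D b = Sup (E b)" for b
  have E0: "0 \<in> E b" for b by (auto simp: E_def P_def)
  have bdd: "bdd_above (E b)" for b by (rule bdd_aboveI[of _ 1]) (auto simp: E_def)
  have lip: "D b \<le> D b' + dist b b'" for b b'
    unfolding D_def[of b]
  proof (rule cSup_least)
    show "E b \<noteq> {}" using E0 by blast
    fix \<epsilon> assume \<epsilon>: "\<epsilon> \<in> E b"
    have D0: "0 \<le> D b'" unfolding D_def by (rule cSup_upper[OF E0 bdd])
    show "\<epsilon> \<le> D b' + dist b b'"
    proof (cases "\<epsilon> \<le> dist b b'")
      case False
      have "P b' (\<epsilon> - dist b b')"
        unfolding P_def
      proof (intro ballI impI)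
        fix b'' s t
        assume "b'' \<in> X" "dist b' b'' < \<epsilon> - dist b b'" "s \<in> {0..1}" "t \<in> {0..1}" "\<bar>s - t\<bar> < \<epsilon> - dist b b'"
        moreover from this have "dist b b'' < \<epsilon>" using dist_triangle[of b b'' b'] by linarith
        moreover have "\<bar>s - t\<bar> < \<epsilon>" using calculation(5) zero_le_dist[of b b'] by linarith
        ultimately show "near_lines (H (s, b'')) (H (t, b''))"
          using \<epsilon> unfolding E_def P_def by blast
      qed
      moreover have "\<epsilon> - dist b b' \<le> 1" using \<epsilon> zero_le_dist[of b b'] unfolding E_def mem_Collect_eq atLeastAtMost_iff by linarith
      ultimately have "\<epsilon> - dist b b' \<in> E b'" using False by (simp add: E_def)
      then have "\<epsilon> - dist b b' \<le> D b'" unfolding D_def by (rule cSup_upper[OF _ bdd])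
      then show ?thesis by simp
    qed (use D0 in linarith)
  qed
  have Dpos: "0 < D b" if b: "b \<in> X" for b
  proof -
    obtain \<epsilon> where \<epsilon>: "0 < \<epsilon>"
      "\<And>b' s t. b' \<in> X \<Longrightarrow> dist b b' < \<epsilon> \<Longrightarrow> s \<in> {0..1} \<Longrightarrow> t \<in> {0..1} \<Longrightarrow> \<bar>s - t\<bar> < \<epsilon> \<Longrightarrow>
         near_lines (H (s, b')) (H (t, b'))"
      by (rule near_lines_uniformly[OF H b]) blast
    then have "min \<epsilon> 1 \<in> E b" by (auto simp: E_def P_def)
    then have "min \<epsilon> 1 \<le> D b" unfolding D_def by (rule cSup_upper[OF _ bdd])
    then show ?thesis using \<epsilon>(1) by linarith
  qed
  show thesis
  \<comment> \<open>Half of the supremum, so that some admissible radius strictly exceeds the step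
    even if the supremum is not attained.\<close>
  proof (rule that[of "\<lambda>b. D b / 2"])
    have "dist (D b) (D b') \<le> dist b b'" for b b'
      using lip[of b b'] lip[of b' b] by (simp add: dist_real_def dist_commute)
    then have "continuous_on X D" unfolding continuous_on_iff by (meson le_less_trans)
    then show "continuous_on X (\<lambda>b. D b / 2)" by (intro continuous_intros) auto
    show "0 < D b / 2" if "b \<in> X" for b using Dpos[OF that] by simp
    fix b s t assume b: "b \<in> X" and st: "s \<in> {0..1::real}" "t \<in> {0..1}" "\<bar>s - t\<bar> \<le> D b / 2"
    have "\<bar>s - t\<bar> < D b" using st(3) Dpos[OF b] by linarith
    then obtain \<epsilon> where "\<epsilon> \<in> E b" "\<bar>s - t\<bar> < \<epsilon>"
      unfolding D_def using less_cSup_iff[OF _ bdd] E0 by blast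
    moreover have "dist b b < \<epsilon>" using \<open>\<bar>s - t\<bar> < \<epsilon>\<close> by simp
    ultimately show "near_lines (H (s, b)) (H (t, b))"
      using b st(1,2) unfolding E_def P_def by blast
  qed
qed

text \<open>Homotopic maps to projective space pull back isomorphic tautological line bundles.\<close>

theorem homotopic_line_transport:
  fixes f g :: "'a::metric_space \<Rightarrow> (nat \<Rightarrow> 'f::real_normed_field) set"
  assumes "homotopic_with (\<lambda>_. True) (top_of_set X) proj_space_inf f g"
  obtains T :: "'a \<Rightarrow> (nat \<Rightarrow> 'f) \<Rightarrow> nat \<Rightarrow> 'f" where
    "\<And>b c v. T b (\<lambda>i. c * v i) = (\<lambda>i. c * T b v i)"
    "\<And>b v. b \<in> X \<Longrightarrow> v \<in> f b \<Longrightarrow> T b v \<in> g b"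
    "\<And>W V k. W \<subseteq> X \<Longrightarrow> (\<And>b. b \<in> W \<Longrightarrow> V b \<in> f b) \<Longrightarrow> (\<And>i. continuous_on W (\<lambda>b. V b i)) \<Longrightarrow>
       continuous_on W (\<lambda>b. T b (V b) k)"
proof -
  obtain H :: "real \<times> 'a \<Rightarrow> (nat \<Rightarrow> 'f) set" where
    H: "continuous_map (top_of_set ({0..1} \<times> X)) proj_space_inf H"
    and H0: "\<And>b. H (0, b) = f b" and H1: "\<And>b. H (1, b) = g b"
    using assms unfolding homotopic_with_def by auto
  have HX: "H (t, b) \<in> topspace proj_space_inf" if "b \<in> X" "t \<in> {0..1}" for t b
    using H that by (auto simp: continuous_map_def)
  obtain \<delta> where \<delta>: "continuous_on X \<delta>" "\<And>b. b \<in> X \<Longrightarrow> 0 < \<delta> b"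
    and near: "\<And>b s t. b \<in> X \<Longrightarrow> s \<in> {0..1} \<Longrightarrow> t \<in> {0..1} \<Longrightarrow> \<bar>s - t\<bar> \<le> \<delta> b \<Longrightarrow>
       near_lines (H (s, b)) (H (t, b))"
    using continuous_step_size[OF H] by blast
  \<comment> \<open>A clock for each \<open>b\<close>: it advances by at most the safe step and
    stops at 1.\<close>
  define \<tau> where "\<tau> k b = min 1 (real k * \<delta> b)" for k b
  have \<tau>01: "\<tau> k b \<in> {0..1}" if "b \<in> X" for k b
    using \<delta>(2)[OF that] by (simp add: \<tau>_def)
  have \<tau>step: "\<bar>\<tau> k b - \<tau> (Suc k) b\<bar> \<le> \<delta> b" if "b \<in> X" for k b
    using \<delta>(2)[OF that] by (auto simp: \<tau>_def algebra_simps min_def)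
  define R where "R b v = rec_nat v (\<lambda>k u. line_proj (H (\<tau> (Suc k) b, b)) u)" for b v
  have R0: "R b v 0 = v" and RS: "R b v (Suc k) = line_proj (H (\<tau> (Suc k) b, b)) (R b v k)" for b v k
    by (simp_all add: R_def)
  have Rscale: "R b (\<lambda>i. c * v i) k = (\<lambda>i. c * R b v k i)" for b c v k
    by (induction k) (simp_all add: R0 RS line_proj_scale)
  have Rmem: "R b v k \<in> H (\<tau> k b, b)" if "b \<in> X" "v \<in> f b" for b v k
  proof (induction k)
    case 0
    then show ?case using that by (simp add: R0 \<tau>_def H0)
  next
    case (Suc k)
    then show ?case
      using near[OF that(1) \<tau>01[OF that(1)] \<tau>01[OF that(1)] \<tau>step[OF that(1)], of k]
      by (auto simp: RS near_lines_def)
  qed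
  \<comment> \<open>After the clock has stopped, the vector already lies on the line onto which it
    is projected, so further projections fix it.\<close>
  have Rstable: "R b v k = R b v m" if b: "b \<in> X" "v \<in> f b" and m: "1 \<le> real m * \<delta> b" "m \<le> k" for b v m k
    using m(2)
  proof (induction k rule: dec_induct)
    case (step k)
    have "real m * \<delta> b \<le> real k * \<delta> b"
      using step(1) \<delta>(2)[OF b(1)] by (intro mult_right_mono) auto
    then have "1 \<le> real k * \<delta> b" and "1 \<le> real (Suc k) * \<delta> b"
      using m(1) \<delta>(2)[OF b(1)] unfolding of_nat_Suc distrib_right by linarith+
    then have "\<tau> (Suc k) b = \<tau> k b" by (simp add: \<tau>_def)
    then have "R b v (Suc k) = R b v k"
      unfolding RS using line_proj_self[OF Rmem[OF b] HX[OF b(1) \<tau>01[OF b(1)]], of k] by simp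
    then show ?case using step by simp
  qed simp
  \<comment> \<open>Enough ticks to reach time 1. The number jumps as \<open>b\<close> varies; by
    \<open>Rstable\<close> it may be replaced by any larger one, which can be chosen locally
    constant.\<close>
  define N where "N b = nat \<lceil>1 / \<delta> b\<rceil>" for b
  have N: "1 \<le> real m * \<delta> b" if "b \<in> X" "N b \<le> m" for b m
  proof -
    have "1 / \<delta> b \<le> real m" using that(2) unfolding N_def by linarith
    then show ?thesis using \<delta>(2)[OF that(1)] by (simp add: field_simps)
  qed
  show thesis
  proof (rule that[of "\<lambda>b v. R b v (N b)"])
    show "R b (\<lambda>i. c * v i) (N b) = (\<lambda>i. c * R b v (N b) i)" for b c v by (rule Rscale)
    show "R b v (N b) \<in> g b" if "b \<in> X" "v \<in> f b" for b v
      using Rmem[OF that, of "N b"] N[OF that(1), of "N b"] by (simp add: \<tau>_def H1)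
    fix W V k
    assume W: "W \<subseteq> X" and V: "\<And>b. b \<in> W \<Longrightarrow> V b \<in> f b" and cV: "\<And>i. continuous_on W (\<lambda>b. V b i)"
    have cR: "continuous_on W (\<lambda>b. R b (V b) m i)" for m i
    proof (induction m arbitrary: i)
      case 0
      then show ?case by (simp add: R0 cV)
    next
      case (Suc m)
      have "continuous_on W (\<lambda>b. (\<tau> (Suc m) b, b))"
        unfolding \<tau>_def using continuous_on_subset[OF \<delta>(1) W] by (intro continuous_intros)
      moreover have "(\<tau> (Suc m) b, b) \<in> {0..1} \<times> X" if "b \<in> W" for b
        using \<tau>01[of b "Suc m"] W that by auto
      ultimately have "continuous_map (top_of_set W) (top_of_set ({0..1} \<times> X)) (\<lambda>b. (\<tau> (Suc m) b, b))"
        by auto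
      from continuous_map_compose[OF this H]
      have "continuous_map (top_of_set W) proj_space_inf (\<lambda>b. H (\<tau> (Suc m) b, b))" by (simp add: o_def)
      then show ?case unfolding RS by (rule continuous_on_line_proj) (rule Suc)
    qed
    show "continuous_on W (\<lambda>b. R b (V b) (N b) k)"
    proof (rule continuous_on_locallyI)
      fix b0 assume b0: "b0 \<in> W"
      then have pos: "0 < \<delta> b0" using \<delta>(2) W by auto
      obtain U where U: "open U" "U \<inter> W = {b \<in> W. \<delta> b0 / 2 < \<delta> b}"
        using continuous_on_open_invariant[THEN iffD1, OF continuous_on_subset[OF \<delta>(1) W], rule_format, of "{\<delta> b0 / 2<..}"]
        by (auto simp: vimage_def)
      \<comment> \<open>This many ticks suffice wherever the step size exceeds half of its value at
        \<open>b0\<close>.\<close>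
      define m where "m = nat \<lceil>2 / \<delta> b0\<rceil>"
      have "R b (V b) (N b) k = R b (V b) m k" if b: "b \<in> W \<inter> U" for b
      proof -
        have "b \<in> U \<inter> W" using b by blast
        then have half: "\<delta> b0 / 2 < \<delta> b" unfolding U(2) by simp
        have bX: "b \<in> X" using b W by blast
        have "1 / \<delta> b \<le> 2 / \<delta> b0" using half pos by (simp add: field_simps)
        then have "N b \<le> m" unfolding N_def m_def by (intro nat_mono ceiling_mono)
        then show ?thesis using Rstable[OF bX V N[OF bX order_refl], of m] b by simp
      qed
      note eq = this
      show "\<exists>U. open U \<and> b0 \<in> U \<and> continuous_on (W \<inter> U) (\<lambda>b. R b (V b) (N b) k)"
      proof (intro exI[of _ U] conjI)
        show "open U" by fact
        have "b0 \<in> {b \<in> W. \<delta> b0 / 2 < \<delta> b}" using b0 pos by simp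
        then show "b0 \<in> U" unfolding U(2)[symmetric] by blast
        have "continuous_on (W \<inter> U) (\<lambda>b. R b (V b) m k)" by (rule continuous_on_subset[OF cR]) simp
        then show "continuous_on (W \<inter> U) (\<lambda>b. R b (V b) (N b) k)"
          by (rule continuous_on_eq) (use eq in auto)
      qed
    qed
  qed
qed

section \<open>Gauge equivalence\<close>

lemma proj_frame_gauge:
  assumes v: "proj_frame X J B N v"
    and g: "\<And>j. j \<in> J \<Longrightarrow> continuous_on (B j) (g j)" "\<And>j b. j \<in> J \<Longrightarrow> b \<in> B j \<Longrightarrow> g j b \<noteq> 0"
  shows "proj_frame X J B N (\<lambda>j b i. g j b * v j b i)"
  unfolding proj_frame_def
proof (intro conjI ballI allI impI)
  show "continuous_on (B j) (\<lambda>b. g j b * v j b i)" if "j \<in> J" for j i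
    using v g that by (auto simp: proj_frame_def intro!: continuous_intros)
  show "\<exists>i. g j b * v j b i \<noteq> 0" if "j \<in> J" "b \<in> B j" for j b
    using v g(2) that unfolding proj_frame_def by fastforce
  fix j k b assume jk: "j \<in> J" "k \<in> J" "b \<in> B j \<inter> B k"
  then obtain c where "c \<noteq> 0" "v j b = (\<lambda>i. c * v k b i)"
    using v unfolding proj_frame_def by blast
  then show "\<exists>c. c \<noteq> 0 \<and> (\<lambda>i. g j b * v j b i) = (\<lambda>i. c * (g k b * v k b i))"
    using g(2) jk by (intro exI[of _ "g j b * c / g k b"]) auto
qed (use v in \<open>auto simp: proj_frame_def\<close>)

text \<open>Multiplying \<open>w\<close> by \<open>g\<close> leaves its lines unchanged and gives it
  the transition functions \<open>c\<close> of \<open>v\<close>, which is the situation of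
  \<open>homotopic_proj_frames\<close>.\<close>

lemma homotopic_if_gauge_equivalent:
  fixes v w :: "'j \<Rightarrow> 'a::topological_space \<Rightarrow> nat \<Rightarrow> 'f::real_normed_field"
  assumes v: "proj_frame X J B N v" and w: "proj_frame X J B N w"
    and cv: "\<And>j k b. j \<in> J \<Longrightarrow> k \<in> J \<Longrightarrow> b \<in> B j \<inter> B k \<Longrightarrow> v j b = (\<lambda>i. c j k b * v k b i)"
    and cw: "\<And>j k b. j \<in> J \<Longrightarrow> k \<in> J \<Longrightarrow> b \<in> B j \<inter> B k \<Longrightarrow> w j b = (\<lambda>i. d j k b * w k b i)"
    and g: "\<And>j. j \<in> J \<Longrightarrow> continuous_on (B j) (g j)" "\<And>j b. j \<in> J \<Longrightarrow> b \<in> B j \<Longrightarrow> g j b \<noteq> 0"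
    and gauge: "\<And>j k b. j \<in> J \<Longrightarrow> k \<in> J \<Longrightarrow> b \<in> B j \<inter> B k \<Longrightarrow> g j b * d j k b = c j k b * g k b"
    and f: "\<And>j b. j \<in> J \<Longrightarrow> b \<in> B j \<Longrightarrow> f b = proj_point (v j b)"
    and f': "\<And>j b. j \<in> J \<Longrightarrow> b \<in> B j \<Longrightarrow> f' b = proj_point (w j b)"
  shows "homotopic_with (\<lambda>_. True) (top_of_set X) proj_space_inf f f'"
proof (rule homotopic_proj_frames[OF v proj_frame_gauge[OF w g]])
  fix j k b assume jk: "j \<in> J" "k \<in> J" "b \<in> B j \<inter> B k"
  have "c j k b \<noteq> 0"
  proof
    assume "c j k b = 0"
    then have "v j b i = 0" for i using cv[OF jk] by simp
    then show False using proj_frame_nonzero[OF v jk(1)] jk(3) by blast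
  qed
  moreover have "g j b * w j b i = c j k b * (g k b * w k b i)" for i
    using gauge[OF jk] by (simp add: cw[OF jk] mult.assoc[symmetric])
  ultimately show "\<exists>c. c \<noteq> 0 \<and> v j b = (\<lambda>i. c * v k b i) \<and>
      (\<lambda>i. g j b * w j b i) = (\<lambda>i. c * (g k b * w k b i))"
    using cv[OF jk] by blast
next
  fix j b assume jb: "j \<in> J" "b \<in> B j"
  show "f b = proj_point (v j b)" by (rule f[OF jb])
  show "f' b = proj_point (\<lambda>i. g j b * w j b i)"
    unfolding f'[OF jb] proj_point_eq_iff
    using g(2)[OF jb] by (intro exI[of _ "1 / g j b"]) auto
qed (use g in auto)

text \<open>The transport carries \<open>v j b\<close> to a multiple of \<open>w j b\<close>, and
  \<open>g j b\<close> is that factor. It is continuous as a quotient of coordinates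
  \<open>j\<close>, whose denominator \<open>diag\<close> keeps nonzero. Homogeneity of the
  transport yields the gauge relation.\<close>

lemma gauge_equivalent_if_homotopic:
  fixes v w :: "nat \<Rightarrow> 'a::metric_space \<Rightarrow> nat \<Rightarrow> 'f::real_normed_field"
  assumes v: "proj_frame X J B N v" and w: "proj_frame X J B N w"
    and cv: "\<And>j k b. j \<in> J \<Longrightarrow> k \<in> J \<Longrightarrow> b \<in> B j \<inter> B k \<Longrightarrow> v j b = (\<lambda>i. c j k b * v k b i)"
    and cw: "\<And>j k b. j \<in> J \<Longrightarrow> k \<in> J \<Longrightarrow> b \<in> B j \<inter> B k \<Longrightarrow> w j b = (\<lambda>i. d j k b * w k b i)"
    and diag: "\<And>j b. j \<in> J \<Longrightarrow> b \<in> B j \<Longrightarrow> w j b j \<noteq> 0"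
    and f: "\<And>j b. j \<in> J \<Longrightarrow> b \<in> B j \<Longrightarrow> f b = proj_point (v j b)"
    and f': "\<And>j b. j \<in> J \<Longrightarrow> b \<in> B j \<Longrightarrow> f' b = proj_point (w j b)"
    and hom: "homotopic_with (\<lambda>_. True) (top_of_set X) proj_space_inf f f'"
  obtains g where "\<And>j. j \<in> J \<Longrightarrow> continuous_on (B j) (g j)"
    "\<And>j b. j \<in> J \<Longrightarrow> b \<in> B j \<Longrightarrow> g j b \<noteq> 0"
    "\<And>j k b. j \<in> J \<Longrightarrow> k \<in> J \<Longrightarrow> b \<in> B j \<inter> B k \<Longrightarrow> g j b * d j k b = c j k b * g k b"
proof -
  obtain T :: "'a \<Rightarrow> (nat \<Rightarrow> 'f) \<Rightarrow> nat \<Rightarrow> 'f" where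
    Tscale: "\<And>b c v. T b (\<lambda>i. c * v i) = (\<lambda>i. c * T b v i)"
    and Tmem: "\<And>b v. b \<in> X \<Longrightarrow> v \<in> f b \<Longrightarrow> T b v \<in> f' b"
    and Tcont: "\<And>W V k. W \<subseteq> X \<Longrightarrow> (\<And>b. b \<in> W \<Longrightarrow> V b \<in> f b) \<Longrightarrow>
       (\<And>i. continuous_on W (\<lambda>b. V b i)) \<Longrightarrow> continuous_on W (\<lambda>b. T b (V b) k)"
    by (rule homotopic_line_transport[OF hom]) blast
  have BX: "B j \<subseteq> X" if "j \<in> J" for j
    using v that openin_imp_subset unfolding proj_frame_def by blast
  define g where "g j b = T b (v j b) j / w j b j" for j b
  have Tv: "g j b \<noteq> 0 \<and> T b (v j b) = (\<lambda>i. g j b * w j b i)" if jb: "j \<in> J" "b \<in> B j" for j b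
  proof -
    have "T b (v j b) \<in> f' b"
      using jb BX by (intro Tmem) (auto simp: f[OF jb] proj_point_self)
    then obtain s where s: "s \<noteq> 0" "T b (v j b) = (\<lambda>i. s * w j b i)"
      by (auto simp: f'[OF jb] proj_point_def)
    then have "g j b = s" using diag[OF jb] by (simp add: g_def)
    then show ?thesis using s by simp
  qed
  show thesis
  proof
    fix j assume j: "j \<in> J"
    have "continuous_on (B j) (\<lambda>b. T b (v j b) j)"
      using v j by (intro Tcont BX[OF j]) (auto simp: f[OF j] proj_point_self proj_frame_def)
    then show "continuous_on (B j) (g j)"
      unfolding g_def using w j diag[OF j] by (auto simp: proj_frame_def intro!: continuous_intros)
  next
    show "g j b \<noteq> 0" if "j \<in> J" "b \<in> B j" for j b using Tv[OF that] by blast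
  next
    fix j k b assume jk: "j \<in> J" "k \<in> J" "b \<in> B j \<inter> B k"
    \<comment> \<open>Both charts are compared in coordinate \<open>k\<close>, where
      \<open>diag\<close> permits the final cancellation.\<close>
    have "g j b * w j b k = T b (v j b) k" using Tv[of j b] jk by simp
    also have "\<dots> = c j k b * T b (v k b) k" unfolding cv[OF jk] Tscale by simp
    also have "\<dots> = c j k b * (g k b * w k b k)" using Tv[of k b] jk by simp
    finally have "(g j b * d j k b) * w k b k = (c j k b * g k b) * w k b k"
      unfolding cw[OF jk] by (simp add: mult.assoc)
    then show "g j b * d j k b = c j k b * g k b" using diag[of k b] jk by simp
  qed
qed

section \<open>From maps attached to cocycles to a function on cohomology\<close>

lemma homotopy_class_eq:
  assumes "homotopic_with (\<lambda>_. True) X Y f g"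
  shows "homotopy_class X Y f = homotopy_class X Y g"
  unfolding homotopy_class_def using assms by (meson homotopic_with_symD homotopic_with_trans)

lemma homotopic_if_homotopy_class_eq:
  assumes "continuous_map X Y g" "homotopy_class X Y f = homotopy_class X Y g"
  shows "homotopic_with (\<lambda>_. True) X Y f g"
proof -
  have "g \<in> homotopy_class X Y f" unfolding assms(2) using assms(1) by (simp add: homotopy_class_def)
  then show ?thesis by (simp add: homotopy_class_def)
qed

text \<open>Read \<open>P \<phi> f\<close> as: \<open>f\<close> is one of the maps attached to
  \<open>\<phi>\<close>. A relation is used because the complex map also depends on the choice of
  \<open>\<nu>\<close>; \<open>hom\<close> then covers a change of the cocycle within its class and
  a change of such choices at once.\<close>

lemma homotopy_classes_of_cohomology:
  fixes P :: "(nat set \<Rightarrow> 'g::ab_group_add) \<Rightarrow> ('a \<Rightarrow> 'b) \<Rightarrow> bool"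
  assumes ex: "\<And>\<phi>. \<phi> \<in> cocycles K k \<Longrightarrow> \<exists>f. P \<phi> f"
    and cont: "\<And>\<phi> f. \<phi> \<in> cocycles K k \<Longrightarrow> P \<phi> f \<Longrightarrow> continuous_map X Y f"
    and hom: "\<And>\<phi> \<psi> f g. \<phi> \<in> cocycles K k \<Longrightarrow> \<psi> \<in> cocycles K k \<Longrightarrow>
      cohomology_class K k \<phi> = cohomology_class K k \<psi> \<Longrightarrow> P \<phi> f \<Longrightarrow> P \<psi> g \<Longrightarrow>
      homotopic_with (\<lambda>_. True) X Y f g"
  obtains w where "w \<in> cohomology K k \<rightarrow> homotopy_classes X Y"
    "\<And>\<phi> f. \<phi> \<in> cocycles K k \<Longrightarrow> P \<phi> f \<Longrightarrow> w (cohomology_class K k \<phi>) = homotopy_class X Y f"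
proof -
  define R where "R C f \<longleftrightarrow> (\<exists>\<phi>\<in>cocycles K k. C = cohomology_class K k \<phi> \<and> P \<phi> f)"
    for C :: "(nat set \<Rightarrow> 'g) set" and f
  define w where "w C = homotopy_class X Y (SOME f. R C f)" for C
  have w: "w (cohomology_class K k \<phi>) = homotopy_class X Y f" if \<phi>: "\<phi> \<in> cocycles K k" and f: "P \<phi> f" for \<phi> f
  proof -
    have "R (cohomology_class K k \<phi>) f" using \<phi> f by (auto simp: R_def)
    then have "R (cohomology_class K k \<phi>) (SOME f. R (cohomology_class K k \<phi>) f)"
      by (rule someI[of "R (cohomology_class K k \<phi>)"])
    then obtain \<psi> where \<psi>: "\<psi> \<in> cocycles K k" "cohomology_class K k \<phi> = cohomology_class K k \<psi>"
      "P \<psi> (SOME f. R (cohomology_class K k \<phi>) f)" unfolding R_def by blast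
    show ?thesis unfolding w_def by (rule homotopy_class_eq[OF hom[OF \<psi>(1) \<phi> \<psi>(2)[symmetric] \<psi>(3) f]])
  qed
  moreover have "w \<in> cohomology K k \<rightarrow> homotopy_classes X Y"
  proof
    fix C :: "(nat set \<Rightarrow> 'g) set" assume "C \<in> cohomology K k"
    then obtain \<phi> where \<phi>: "\<phi> \<in> cocycles K k" "C = cohomology_class K k \<phi>" by (auto simp: cohomology_def)
    obtain f where f: "P \<phi> f" using ex[OF \<phi>(1)] by blast
    show "w C \<in> homotopy_classes X Y"
      unfolding \<phi>(2) w[OF \<phi>(1) f] homotopy_classes_def using cont[OF \<phi>(1) f] by blast
  qed
  ultimately show thesis by (rule that[rotated])
qed

section \<open>Logarithms on simply connected metric spaces\<close>

text \<open>The Kuratowski embedding, to transfer results stated for subsets of normed spaces.\<close>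

lemma isometric_embedding_into_normed_space:
  obtains \<kappa> :: "'a::metric_space \<Rightarrow> ('a \<Rightarrow>\<^sub>C real)" where "\<And>x y. dist (\<kappa> x) (\<kappa> y) = dist x y"
proof -
  fix o' :: 'a
  define k where "k x = Bcontfun (\<lambda>z. dist x z - dist o' z)" for x
  have "(\<lambda>z. dist x z - dist o' z) \<in> bcontfun" for x
  proof -
    have "\<bar>dist x z - dist o' z\<bar> \<le> dist x o'" for z
      using dist_triangle[of x z o'] dist_triangle[of o' z x] by (simp add: dist_commute)
    then show ?thesis
      unfolding bcontfun_def
      by (auto simp: bounded_iff intro!: continuous_intros exI[of _ "dist x o'"])
  qed
  then have k: "apply_bcontfun (k x) z = dist x z - dist o' z" for x z
    by (simp add: k_def Bcontfun_inverse)
  have "dist (k x) (k y) = dist x y" for x y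
  proof (rule antisym)
    show "dist (k x) (k y) \<le> dist x y"
    proof (rule dist_bound)
      fix z show "dist (apply_bcontfun (k x) z) (apply_bcontfun (k y) z) \<le> dist x y"
        using dist_triangle[of x z y] dist_triangle[of y z x]
        by (simp add: k dist_real_def dist_commute)
    qed
    show "dist x y \<le> dist (k x) (k y)"
      using dist_bounded[of "k x" y "k y"] by (simp add: k dist_real_def)
  qed
  then show thesis by (rule that)
qed

lemma continuous_logarithm_on_simply_connected_metric:
  fixes f :: "'a::metric_space \<Rightarrow> complex"
  assumes contf: "continuous_on S f" and S: "simply_connected S" "locally path_connected S"
    and f: "\<And>z. z \<in> S \<Longrightarrow> f z \<noteq> 0"
  obtains g where "continuous_on S g" "\<And>x. x \<in> S \<Longrightarrow> f x = exp (g x)"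
proof -
  obtain \<kappa> :: "'a \<Rightarrow> ('a \<Rightarrow>\<^sub>C real)" where \<kappa>: "\<And>x y. dist (\<kappa> x) (\<kappa> y) = dist x y"
    using isometric_embedding_into_normed_space by blast
  have inj: "inj \<kappa>"
    using \<kappa> by (metis dist_eq_0_iff injI)
  have cont: "continuous_on S \<kappa>" and cont_inv: "continuous_on (\<kappa> ` S) (inv \<kappa>)"
    unfolding continuous_on_iff by (auto simp: \<kappa> inv_f_f[OF inj])
  have hom: "homeomorphism S (\<kappa> ` S) \<kappa> (inv \<kappa>)"
    using cont cont_inv by (auto simp: homeomorphism_def inv_f_f[OF inj] image_image)
  have "simply_connected (\<kappa> ` S)"
    using S(1) hom homeomorphic_def homeomorphic_simply_connected by blast
  note sc = this
  have lpc: "locally path_connected (\<kappa> ` S)"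
    by (rule homeomorphism_locally_imp[OF S(2) hom])
       (use homeomorphic_def homeomorphic_path_connectedness in blast)
  have cf: "continuous_on (\<kappa> ` S) (f \<circ> inv \<kappa>)"
    by (rule continuous_on_compose[OF cont_inv])
       (use contf in \<open>simp add: image_image inv_f_f[OF inj]\<close>)
  obtain g where g: "continuous_on (\<kappa> ` S) g" "\<And>y. y \<in> \<kappa> ` S \<Longrightarrow> (f \<circ> inv \<kappa>) y = exp (g y)"
    by (rule continuous_logarithm_on_simply_connected[OF cf sc lpc])
       (use f in \<open>auto simp: inv_f_f[OF inj]\<close>)
  show thesis
  proof
    show "continuous_on S (g \<circ> \<kappa>)"
      using cont g(1) by (rule continuous_on_compose)
    show "f x = exp ((g \<circ> \<kappa>) x)" if "x \<in> S" for x
      using g(2)[of "\<kappa> x"] that by (simp add: inv_f_f[OF inj])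
  qed
qed

section \<open>Low-dimensional cochains\<close>

lemma coboundary_set:
  assumes "sorted xs" "distinct xs" "length xs = Suc (Suc k)" "set xs \<in> K"
  shows "coboundary K k \<phi> (set xs) =
    (\<Sum>j=0..Suc k. if even j then \<phi> (set xs - {xs ! j}) else - \<phi> (set xs - {xs ! j}))"
proof -
  have "set xs \<in> simplices K (Suc k)"
    using assms by (simp add: simplices_def distinct_card)
  then show ?thesis
    using assms by (simp add: coboundary_def Let_def sorted_list_of_set.idem_if_sorted_distinct)
qed

lemma coboundary_edge:
  assumes "r < s" "{r, s} \<in> K"
  shows "coboundary K 0 \<phi> {r, s} = \<phi> {s} - \<phi> {r}"
proof -
  have "{r, s} - {r} = {s}" "{r, s} - {s} = {r}" using assms by auto
  then show ?thesis
    using coboundary_set[of "[r, s]" 0 K \<phi>] assms by simp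
qed

lemma coboundary_triangle:
  assumes "r < s" "s < t" "{r, s, t} \<in> K"
  shows "coboundary K 1 \<phi> {r, s, t} = \<phi> {s, t} - \<phi> {r, t} + \<phi> {r, s}"
proof -
  have "{r, s, t} - {r} = {s, t}" "{r, s, t} - {s} = {r, t}" "{r, s, t} - {t} = {r, s}"
    using assms by auto
  moreover have "{0..Suc 1} = {0, 1, 2::nat}" by auto
  ultimately show ?thesis
    using coboundary_set[of "[r, s, t]" 1 K \<phi>] assms by (simp del: One_nat_def)
qed

lemma coboundary_tetrahedron:
  assumes "r < s" "s < t" "t < u" "{r, s, t, u} \<in> K"
  shows "coboundary K 2 \<phi> {r, s, t, u} = \<phi> {s, t, u} - \<phi> {r, t, u} + \<phi> {r, s, u} - \<phi> {r, s, t}"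
proof -
  have "{r, s, t, u} - {r} = {s, t, u}" "{r, s, t, u} - {s} = {r, t, u}"
    "{r, s, t, u} - {t} = {r, s, u}" "{r, s, t, u} - {u} = {r, s, t}"
    using assms by auto
  moreover have "{0..3} = {0, 1, 2, 3::nat}" by auto
  ultimately show ?thesis
    using coboundary_set[of "[r, s, t, u]" 2 K \<phi>] assms by simp
qed

section \<open>Alternating extensions of cochains to index tuples\<close>

definition alt2 :: "(nat set \<Rightarrow> 'g::ab_group_add) \<Rightarrow> nat \<Rightarrow> nat \<Rightarrow> 'g" where
  "alt2 \<phi> r s = (if r < s then \<phi> {r, s} else if s < r then - \<phi> {r, s} else 0)"

text \<open>The second condition lists the cyclic rotations of the increasing order, that is, the
  even permutations. Arbitrary coefficients let one calculus serve \<open>bit\<close>,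
  \<open>int\<close> and \<open>real\<close>; over \<open>bit\<close> the signs disappear.\<close>

definition alt3 :: "(nat set \<Rightarrow> 'g::ab_group_add) \<Rightarrow> nat \<Rightarrow> nat \<Rightarrow> nat \<Rightarrow> 'g" where
  "alt3 \<phi> r s t =
     (if r = s \<or> s = t \<or> r = t then 0
      else if r < s \<and> s < t \<or> s < t \<and> t < r \<or> t < r \<and> r < s then \<phi> {r, s, t} else - \<phi> {r, s, t})"

lemma alt2_diag: "alt2 \<phi> r r = 0"
  by (simp add: alt2_def)

lemma alt2_swap: "alt2 \<phi> s r = - alt2 \<phi> r s"
  by (auto simp: alt2_def insert_commute)

lemma alt3_diag: "alt3 \<phi> r r t = 0" "alt3 \<phi> r t t = 0" "alt3 \<phi> r t r = 0"
  by (simp_all add: alt3_def)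

lemma alt3_swap12: "alt3 \<phi> s r t = - alt3 \<phi> r s t"
  by (auto simp: alt3_def insert_commute)

lemma alt3_swap23: "alt3 \<phi> r t s = - alt3 \<phi> r s t"
  by (auto simp: alt3_def insert_commute)

lemma alt_ext_2: "alt_ext \<phi> [r, s] = alt2 \<phi> r s"
proof -
  have "i < j \<and> j < length [r, s] \<longleftrightarrow> i = 0 \<and> j = 1" for i j by auto
  then have "{(i, j). i < j \<and> j < length [r, s] \<and> [r, s] ! i > [r, s] ! j} = (if s < r then {(0, 1)} else {})"
    unfolding conj_assoc[symmetric] by auto
  then show ?thesis by (auto simp: alt_ext_def alt2_def)
qed

lemma alt_ext_3: "alt_ext \<phi> [r, s, t] = alt3 \<phi> r s t"
proof -
  let ?I = "{(i, j). i < j \<and> j < length [r, s, t] \<and> [r, s, t] ! i > [r, s, t] ! j}"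
  have eq: "i < j \<and> j < length [r, s, t] \<longleftrightarrow> i = 0 \<and> j = 1 \<or> i = 0 \<and> j = 2 \<or> i = 1 \<and> j = 2" for i j
    by auto
  have I: "?I = (if s < r then {(0, 1)} else {}) \<union> (if t < r then {(0, 2)} else {}) \<union> (if t < s then {(1, 2)} else {})"
    unfolding conj_assoc[symmetric] eq by auto
  show ?thesis
  proof (cases "distinct [r, s, t]")
    case True
    then have "card ?I = of_bool (s < r) + of_bool (t < r) + of_bool (t < s)"
      unfolding I by simp
    then show ?thesis using True by (auto simp: alt_ext_def alt3_def)
  qed (auto simp: alt_ext_def alt3_def)
qed

lemma sym_ext_eq: "sym_ext \<tau> r s = alt2 \<tau> r s"
  by (auto simp: sym_ext_def alt2_def)

lemma alt2_diff: "alt2 (\<lambda>\<sigma>. \<phi> \<sigma> - \<psi> \<sigma>) r s = alt2 \<phi> r s - alt2 \<psi> r s"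
  by (simp add: alt2_def)

lemma alt3_diff: "alt3 (\<lambda>\<sigma>. \<phi> \<sigma> - \<psi> \<sigma>) r s t = alt3 \<phi> r s t - alt3 \<psi> r s t"
  by (simp add: alt3_def)

lemma alt3_int_to_real: "alt3 (int_to_real_cochain \<phi>) r s t = of_int (alt3 \<phi> r s t)"
  by (simp add: alt3_def int_to_real_cochain_def)

lemma alt2_coboundary:
  assumes "{r, s} \<in> K"
  shows "alt2 (coboundary K 0 \<phi>) r s = \<phi> {s} - \<phi> {r}"
  using assms coboundary_edge[of r s K \<phi>] coboundary_edge[of s r K \<phi>]
  by (cases r s rule: linorder_cases) (simp_all add: alt2_def insert_commute)

text \<open>Both sides alternate in the three indices and membership in \<open>K\<close> depends
  only on their set. So weakly increasing triples suffice, and adjacent transpositions reach all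
  others.\<close>

lemma alt3_coboundary:
  assumes "{r, s, t} \<in> K"
  shows "alt3 (coboundary K 1 \<phi>) r s t = alt2 \<phi> s t - alt2 \<phi> r t + alt2 \<phi> r s"
proof -
  let ?\<delta> = "coboundary K 1 \<phi>"
  define Q where "Q r s t \<longleftrightarrow>
    ({r, s, t} \<in> K \<longrightarrow> alt3 ?\<delta> r s t = alt2 \<phi> s t - alt2 \<phi> r t + alt2 \<phi> r s)" for r s t
  have sorted: "Q r s t" if "r \<le> s" "s \<le> t" for r s t
  proof (cases "r = s \<or> s = t")
    case True
    then show ?thesis by (auto simp: Q_def alt3_diag alt2_diag)
  next
    case False
    then show ?thesis using that coboundary_triangle[of r s t K \<phi>]
      by (simp add: Q_def alt3_def alt2_def)
  qed
  have s12: "Q s r t" if "Q r s t" for r s t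
    using that unfolding Q_def alt3_swap12[of ?\<delta> s r t] alt2_swap[of \<phi> s r]
    by (simp add: insert_commute)
  have s23: "Q r t s" if "Q r s t" for r s t
    using that unfolding Q_def alt3_swap23[of ?\<delta> r t s] alt2_swap[of \<phi> t s]
    by (simp add: insert_commute)
  have 2: "Q r s t" if "r \<le> s" for r s t
  proof -
    consider "s \<le> t" | "r \<le> t" "t \<le> s" | "t \<le> r" by linarith
    then show ?thesis
      by cases (use that in \<open>blast intro: sorted s12 s23\<close>)+
  qed
  have "Q r s t" using 2[of r s t] 2[of s r t] s12 by (meson linear)
  then show ?thesis using assms by (simp add: Q_def)
qed

lemma alt2_cocycle:
  assumes "\<phi> \<in> cocycles K 1" "{r, s, t} \<in> K"
  shows "alt2 \<phi> s t - alt2 \<phi> r t + alt2 \<phi> r s = 0"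
proof -
  have "coboundary K 1 \<phi> = (\<lambda>_. 0)" using assms(1) by (simp add: cocycles_def)
  then have "alt3 (coboundary K 1 \<phi>) r s t = 0" by (simp add: alt3_def)
  then show ?thesis using alt3_coboundary[OF assms(2), of \<phi>] by simp
qed

text \<open>An adjacent transposition only changes the sign of the left-hand side, so it is enough
  to treat sorted quadruples; those with a repeated index cancel by themselves.\<close>

lemma alt3_cocycle:
  assumes \<phi>: "\<phi> \<in> cocycles K 2" and K: "{r, s, t, u} \<in> K"
  shows "alt3 \<phi> s t u - alt3 \<phi> r t u + alt3 \<phi> r s u - alt3 \<phi> r s t = 0"
proof -
  define Q where "Q r s t u \<longleftrightarrow> ({r, s, t, u} \<in> K \<longrightarrow>
    alt3 \<phi> s t u - alt3 \<phi> r t u + alt3 \<phi> r s u - alt3 \<phi> r s t = 0)" for r s t u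
  have sorted: "Q r s t u" if "r \<le> s" "s \<le> t" "t \<le> u" for r s t u
  proof (cases "r = s \<or> s = t \<or> t = u")
    case True
    then show ?thesis by (auto simp: Q_def alt3_diag)
  next
    case False
    then show ?thesis
      using that coboundary_tetrahedron[of r s t u K \<phi>] \<phi> by (auto simp: Q_def cocycles_def alt3_def)
  qed
  have s12: "Q s r t u" if "Q r s t u" for r s t u
    using that unfolding Q_def alt3_swap12[of \<phi> s r u] alt3_swap12[of \<phi> s r t]
    by (simp add: insert_commute algebra_simps)
  have s23: "Q r t s u" if "Q r s t u" for r s t u
    using that unfolding Q_def alt3_swap12[of \<phi> t s u] alt3_swap23[of \<phi> r t s]
    by (simp add: insert_commute algebra_simps)
  have s34: "Q r s u t" if "Q r s t u" for r s t u
    using that unfolding Q_def alt3_swap23[of \<phi> s u t] alt3_swap23[of \<phi> r u t]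
    by (simp add: insert_commute algebra_simps)
  have 3: "Q r s t u" if "r \<le> s" "s \<le> t" for r s t u
  proof -
    consider "t \<le> u" | "s \<le> u" "u \<le> t" | "r \<le> u" "u \<le> s" | "u \<le> r" by linarith
    then show ?thesis
      by cases (use that in \<open>blast intro: sorted s12 s23 s34 order_trans\<close>)+
  qed
  have 2: "Q r s t u" if "r \<le> s" for r s t u
  proof -
    consider "s \<le> t" | "r \<le> t" "t \<le> s" | "t \<le> r" by linarith
    then show ?thesis
      by cases (use that in \<open>blast intro: 3 s12 s23\<close>)+
  qed
  have "Q r s t u" using 2[of r s t u] 2[of s r t u] s12 by (meson linear)
  then show ?thesis using K by (simp add: Q_def)
qed

section \<open>Linearity of the coboundary, and equality of cohomology classes\<close>

lemma coboundary_diff: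
  "coboundary K k (\<lambda>\<sigma>. \<phi> \<sigma> - \<psi> \<sigma>) = (\<lambda>\<sigma>. coboundary K k \<phi> \<sigma> - coboundary K k \<psi> \<sigma>)"
proof
  fix \<sigma>
  show "coboundary K k (\<lambda>\<sigma>. \<phi> \<sigma> - \<psi> \<sigma>) \<sigma> = coboundary K k \<phi> \<sigma> - coboundary K k \<psi> \<sigma>"
    unfolding coboundary_def Let_def sum_subtractf[symmetric]
    by (auto intro!: sum.cong simp: sum_subtractf[symmetric])
qed

lemma coboundary_add:
  "coboundary K k (\<lambda>\<sigma>. \<phi> \<sigma> + \<psi> \<sigma>) = (\<lambda>\<sigma>. coboundary K k \<phi> \<sigma> + coboundary K k \<psi> \<sigma>)"
proof -
  have "coboundary K k (\<lambda>\<sigma>. \<phi> \<sigma> + \<psi> \<sigma> - \<psi> \<sigma>) =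
      (\<lambda>\<sigma>. coboundary K k (\<lambda>\<sigma>. \<phi> \<sigma> + \<psi> \<sigma>) \<sigma> - coboundary K k \<psi> \<sigma>)"
    by (rule coboundary_diff)
  then show ?thesis by (auto simp: fun_eq_iff algebra_simps)
qed

lemma coboundary_cochains: "coboundary K k \<phi> \<in> cochains K (Suc k)"
  by (simp add: cochains_def coboundary_def)

lemma cochains_diff: "\<phi> \<in> cochains K k \<Longrightarrow> \<psi> \<in> cochains K k \<Longrightarrow> (\<lambda>\<sigma>. \<phi> \<sigma> - \<psi> \<sigma>) \<in> cochains K k"
  by (auto simp: cochains_def)

lemma zero_cochain: "(\<lambda>_. 0) \<in> cochains K k"
  by (simp add: cochains_def)

lemma coboundary_zero: "coboundary K k (\<lambda>_. 0) = (\<lambda>_. 0)"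
  using coboundary_diff[of K k "\<lambda>_. 0" "\<lambda>_. 0"] by simp

lemma coboundaries_Suc_iff:
  "\<phi> \<in> coboundaries K (Suc k) \<longleftrightarrow> (\<exists>\<mu>\<in>cochains K k. \<phi> = coboundary K k \<mu>)"
  by (auto simp: coboundaries_def)

lemma coboundaries_diff:
  assumes "\<phi> \<in> coboundaries K (Suc k)" "\<psi> \<in> coboundaries K (Suc k)"
  shows "(\<lambda>\<sigma>. \<phi> \<sigma> - \<psi> \<sigma>) \<in> coboundaries K (Suc k)"
proof -
  obtain \<mu> \<nu> where "\<mu> \<in> cochains K k" "\<nu> \<in> cochains K k"
    and "\<phi> = coboundary K k \<mu>" "\<psi> = coboundary K k \<nu>"
    using assms unfolding coboundaries_Suc_iff by blast
  then show ?thesis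
    unfolding coboundaries_Suc_iff
    by (intro bexI[of _ "\<lambda>\<sigma>. \<mu> \<sigma> - \<nu> \<sigma>"]) (simp_all add: coboundary_diff cochains_diff)
qed

lemma cohomology_class_self: "\<phi> \<in> cocycles K (Suc k) \<Longrightarrow> \<phi> \<in> cohomology_class K (Suc k) \<phi>"
  unfolding cohomology_class_def coboundaries_Suc_iff
  by (auto intro!: bexI[of _ "\<lambda>_. 0"] simp: coboundary_zero zero_cochain)

lemma cohomology_class_eq_iff:
  assumes "\<phi> \<in> cocycles K (Suc k)" "\<psi> \<in> cocycles K (Suc k)"
  shows "cohomology_class K (Suc k) \<phi> = cohomology_class K (Suc k) \<psi> \<longleftrightarrow>
    (\<lambda>\<sigma>. \<phi> \<sigma> - \<psi> \<sigma>) \<in> coboundaries K (Suc k)"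
proof
  assume "cohomology_class K (Suc k) \<phi> = cohomology_class K (Suc k) \<psi>"
  then show "(\<lambda>\<sigma>. \<phi> \<sigma> - \<psi> \<sigma>) \<in> coboundaries K (Suc k)"
    using cohomology_class_self[OF assms(1)] by (simp add: cohomology_class_def)
next
  assume d: "(\<lambda>\<sigma>. \<phi> \<sigma> - \<psi> \<sigma>) \<in> coboundaries K (Suc k)"
  have d': "(\<lambda>\<sigma>. \<psi> \<sigma> - \<phi> \<sigma>) \<in> coboundaries K (Suc k)"
    using coboundaries_diff[OF coboundaries_diff[OF d d] d] by simp
  have "(\<lambda>\<sigma>. \<rho> \<sigma> - \<phi> \<sigma>) \<in> coboundaries K (Suc k) \<longleftrightarrow> (\<lambda>\<sigma>. \<rho> \<sigma> - \<psi> \<sigma>) \<in> coboundaries K (Suc k)" for \<rho>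
    using coboundaries_diff[OF _ d, of "\<lambda>\<sigma>. \<rho> \<sigma> - \<psi> \<sigma>"] coboundaries_diff[OF _ d', of "\<lambda>\<sigma>. \<rho> \<sigma> - \<phi> \<sigma>"] by auto
  then show "cohomology_class K (Suc k) \<phi> = cohomology_class K (Suc k) \<psi>"
    by (simp add: cohomology_class_def)
qed

lemma edge_simplexE:
  assumes "\<sigma> \<in> simplices K 1"
  obtains r s where "r < s" "\<sigma> = {r, s}" "{r, s} \<in> K"
proof -
  have "card \<sigma> = 2" "\<sigma> \<in> K" using assms by (auto simp: simplices_def)
  then obtain r s where "\<sigma> = {r, s}" "r \<noteq> s" by (meson card_2_iff)
  then show thesis using that[of r s] that[of s r] \<open>\<sigma> \<in> K\<close> by (cases r s rule: linorder_cases) (auto simp: insert_commute)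
qed

lemma triangle_simplexE:
  assumes "\<sigma> \<in> simplices K 2"
  obtains r s t where "r < s" "s < t" "\<sigma> = {r, s, t}" "{r, s, t} \<in> K"
proof -
  let ?xs = "sorted_list_of_set \<sigma>"
  have c: "card \<sigma> = 3" "\<sigma> \<in> K" using assms by (auto simp: simplices_def)
  then have fin: "finite \<sigma>" using card.infinite by force
  have ex: "\<exists>r s t. xs = [r, s, t]" if "length xs = 3" for xs :: "nat list"
    using that by (auto simp: length_Suc_conv numeral_3_eq_3)
  have "length ?xs = 3" using c fin by simp
  then obtain r s t where xs: "?xs = [r, s, t]" using ex by blast
  have "\<sigma> = {r, s, t}" using set_sorted_list_of_set[OF fin] xs by simp
  moreover have "r < s" "s < t" using strict_sorted_list_of_set[of \<sigma>] xs by auto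
  ultimately show thesis using that c by blast
qed

text \<open>A cochain must vanish off \<open>K\<close>, so \<open>\<beta>\<close> is cut off to the
  vertices of \<open>K\<close>; closure under faces guarantees that both ends of each edge
  survive.\<close>

lemma coboundary_0_if_alt2:
  assumes "\<phi> \<in> cochains K 1" "\<And>r t. {r, t} \<in> K \<Longrightarrow> alt2 \<phi> r t = \<beta> t - \<beta> r"
    and face: "\<And>\<sigma> \<rho>. \<sigma> \<in> K \<Longrightarrow> \<rho> \<subseteq> \<sigma> \<Longrightarrow> \<rho> \<noteq> {} \<Longrightarrow> \<rho> \<in> K"
  shows "\<phi> \<in> coboundaries K 1"
proof -
  define \<mu> where "\<mu> \<sigma> = (if \<sigma> \<in> simplices K 0 then \<beta> (Min \<sigma>) else 0)" for \<sigma>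
  have "\<phi> \<sigma> = coboundary K 0 \<mu> \<sigma>" for \<sigma>
  proof (cases "\<sigma> \<in> simplices K 1")
    case True
    then obtain r s where rs: "r < s" "\<sigma> = {r, s}" "{r, s} \<in> K" by (rule edge_simplexE)
    have "\<mu> {r} = \<beta> r" "\<mu> {s} = \<beta> s"
      using face[OF rs(3), of "{r}"] face[OF rs(3), of "{s}"] by (auto simp: \<mu>_def simplices_def)
    then show ?thesis using assms(2)[OF rs(3)] rs coboundary_edge[OF rs(1,3), of \<mu>] by (simp add: alt2_def)
  qed (use assms(1) in \<open>simp add: cochains_def coboundary_def\<close>)
  then have "\<phi> = coboundary K 0 \<mu>" by blast
  moreover have "\<mu> \<in> cochains K 0" by (simp add: cochains_def \<mu>_def)
  ultimately show ?thesis unfolding One_nat_def coboundaries_Suc_iff by blast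
qed

lemma coboundary_1_if_alt3:
  assumes "\<phi> \<in> cochains K 2"
    and alt: "\<And>r s t. {r, s, t} \<in> K \<Longrightarrow> alt3 \<phi> r s t = m s t - m r t + m r s"
    and face: "\<And>\<sigma> \<rho>. \<sigma> \<in> K \<Longrightarrow> \<rho> \<subseteq> \<sigma> \<Longrightarrow> \<rho> \<noteq> {} \<Longrightarrow> \<rho> \<in> K"
  shows "\<phi> \<in> coboundaries K 2"
proof -
  define \<mu> where "\<mu> \<sigma> = (if \<sigma> \<in> simplices K 1 then m (Min \<sigma>) (Max \<sigma>) else 0)" for \<sigma>
  have \<mu>: "\<mu> {r, s} = m r s" if "r < s" "{r, s} \<in> K" for r s
    using that by (simp add: \<mu>_def simplices_def)
  have "\<phi> \<sigma> = coboundary K 1 \<mu> \<sigma>" for \<sigma>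
  proof (cases "\<sigma> \<in> simplices K 2")
    case True
    then obtain r s t where rst: "r < s" "s < t" "\<sigma> = {r, s, t}" "{r, s, t} \<in> K" by (rule triangle_simplexE)
    have "{r, s} \<in> K" "{s, t} \<in> K" "{r, t} \<in> K" by (rule face[OF rst(4)]; auto)+
    then show ?thesis
      using alt[OF rst(4)] rst coboundary_triangle[OF rst(1,2,4), of \<mu>] \<mu> by (simp add: alt3_def)
  qed (use assms(1) in \<open>simp add: cochains_def coboundary_def numeral_2_eq_2\<close>)
  then have "\<phi> = coboundary K 1 \<mu>" by blast
  moreover have "\<mu> \<in> cochains K 1" by (simp add: cochains_def \<mu>_def)
  ultimately show ?thesis unfolding numeral_2_eq_2 coboundaries_Suc_iff One_nat_def by blast
qed

section \<open>Harmonic representatives\<close>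

lemma tetrahedron_simplexE:
  assumes "\<sigma> \<in> simplices K 3"
  obtains r s t u where "r < s" "s < t" "t < u" "\<sigma> = {r, s, t, u}" "{r, s, t, u} \<in> K"
proof -
  let ?xs = "sorted_list_of_set \<sigma>"
  have c: "card \<sigma> = 4" "\<sigma> \<in> K" using assms by (auto simp: simplices_def)
  then have fin: "finite \<sigma>" using card.infinite by force
  have ex: "\<exists>r s t u. xs = [r, s, t, u]" if "length xs = 4" for xs :: "nat list"
    using that by (auto simp: length_Suc_conv numeral_eq_Suc)
  have "length ?xs = 4" using c fin by simp
  then obtain r s t u where xs: "?xs = [r, s, t, u]" using ex by blast
  have "\<sigma> = {r, s, t, u}" using set_sorted_list_of_set[OF fin] xs by simp
  moreover have "r < s" "s < t" "t < u" using strict_sorted_list_of_set[of \<sigma>] xs by auto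
  ultimately show thesis using that c by blast
qed

lemma coboundary_coboundary:
  assumes face: "\<And>\<sigma> \<rho>. \<sigma> \<in> K \<Longrightarrow> \<rho> \<subseteq> \<sigma> \<Longrightarrow> \<rho> \<noteq> {} \<Longrightarrow> \<rho> \<in> K"
  shows "coboundary K 2 (coboundary K 1 \<phi>) = (\<lambda>_. 0)"
proof
  fix \<sigma>
  show "coboundary K 2 (coboundary K 1 \<phi>) \<sigma> = 0"
  proof (cases "\<sigma> \<in> simplices K 3")
    case True
    then obtain r s t u where o: "r < s" "s < t" "t < u" and \<sigma>: "\<sigma> = {r, s, t, u}" and K: "{r, s, t, u} \<in> K"
      by (rule tetrahedron_simplexE)
    have "{r, s, t} \<in> K" "{s, t, u} \<in> K" "{r, t, u} \<in> K" "{r, s, u} \<in> K"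
      by (rule face[OF K]; auto)+
    then show ?thesis
      unfolding \<sigma> coboundary_tetrahedron[OF o K] using o coboundary_triangle[where K = K and \<phi> = \<phi>]
      by (auto dest: less_trans)
  next
    case False
    then show ?thesis by (simp add: coboundary_def)
  qed
qed

lemma coboundary_int_to_real:
  "coboundary K k (int_to_real_cochain \<phi>) = int_to_real_cochain (coboundary K k \<phi>)"
  by (auto simp: coboundary_def int_to_real_cochain_def Let_def fun_eq_iff intro!: sum.cong)

lemma int_to_real_cocycles:
  "\<phi> \<in> cocycles K k \<Longrightarrow> int_to_real_cochain \<phi> \<in> cocycles K k"
  unfolding cocycles_def by (auto simp: coboundary_int_to_real) (auto simp: cochains_def int_to_real_cochain_def)

lemma int_to_real_coboundaries:
  assumes "\<phi> \<in> coboundaries K (Suc k)"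
  shows "int_to_real_cochain \<phi> \<in> coboundaries K (Suc k)"
proof -
  obtain \<mu> where "\<mu> \<in> cochains K k" "\<phi> = coboundary K k \<mu>"
    using assms by (auto simp: coboundaries_Suc_iff)
  then have "int_to_real_cochain \<mu> \<in> cochains K k"
    and "int_to_real_cochain \<phi> = coboundary K k (int_to_real_cochain \<mu>)"
    by (simp_all add: coboundary_int_to_real) (simp add: cochains_def int_to_real_cochain_def)
  then show ?thesis unfolding coboundaries_Suc_iff by blast
qed

lemma int_to_real_cohomology_class:
  assumes "\<eta> \<in> cocycles K (Suc k)"
  shows "int_to_real_cohomology K (Suc k) (cohomology_class K (Suc k) \<eta>) =
    cohomology_class K (Suc k) (int_to_real_cochain \<eta>)"
proof -
  have "cohomology_class K (Suc k) (int_to_real_cochain \<eta>') = cohomology_class K (Suc k) (int_to_real_cochain \<eta>)"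
    if "\<eta>' \<in> cohomology_class K (Suc k) \<eta>" for \<eta>'
  proof -
    have "\<eta>' \<in> cocycles K (Suc k)" "(\<lambda>\<sigma>. \<eta>' \<sigma> - \<eta> \<sigma>) \<in> coboundaries K (Suc k)"
      using that by (auto simp: cohomology_class_def)
    moreover from int_to_real_coboundaries[OF this(2)]
    have "(\<lambda>\<sigma>. int_to_real_cochain \<eta>' \<sigma> - int_to_real_cochain \<eta> \<sigma>) \<in> coboundaries K (Suc k)"
      by (simp add: int_to_real_cochain_def)
    ultimately show ?thesis
      using cohomology_class_eq_iff int_to_real_cocycles assms by blast
  qed
  moreover have "\<eta> \<in> cohomology_class K (Suc k) \<eta>" by (rule cohomology_class_self[OF assms])
  ultimately show ?thesis unfolding int_to_real_cohomology_def by blast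
qed

context
  fixes K :: "nat set set" and k :: nat
  assumes fin: "finite K"
begin

lemma finite_simplices: "finite (simplices K m)"
  using fin by (simp add: simplices_def)

lemma cochain_inner_diff_right:
  "cochain_inner K m \<gamma> (\<lambda>\<sigma>. \<phi> \<sigma> - c * \<psi> \<sigma>) = cochain_inner K m \<gamma> \<phi> - c * cochain_inner K m \<gamma> \<psi>"
  by (simp add: cochain_inner_def right_diff_distrib sum_subtractf sum_distrib_left mult.left_commute)

lemma cochain_inner_self_eq_0:
  assumes "cochain_inner K m \<phi> \<phi> = 0" "\<sigma> \<in> simplices K m"
  shows "\<phi> \<sigma> = 0"
proof -
  have "\<forall>\<sigma>\<in>simplices K m. \<phi> \<sigma> * \<phi> \<sigma> = 0"
    using assms(1) unfolding cochain_inner_def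
    by (subst (asm) sum_nonneg_eq_0_iff) (auto simp: finite_simplices)
  then show ?thesis using assms(2) by simp
qed

lemma cochain_self_inner_eq_0:
  assumes "\<phi> \<in> cochains K m" "cochain_inner K m \<phi> \<phi> = 0"
  shows "\<phi> = (\<lambda>_. 0)"
  using cochain_inner_self_eq_0[OF assms(2)] assms(1) by (auto simp: cochains_def fun_eq_iff)

definition unit_cochain :: "nat set \<Rightarrow> nat set \<Rightarrow> real" where
  "unit_cochain \<tau> \<sigma> = (if \<sigma> = \<tau> then 1 else 0)"

lemma unit_cochain: "\<tau> \<in> simplices K k \<Longrightarrow> unit_cochain \<tau> \<in> cochains K k"
  by (auto simp: unit_cochain_def cochains_def)

text \<open>The adjoint is defined by a description. Pairing with unit cochains makes it an explicit
  linear expression, and its vanishing at \<open>\<tau>\<close> becomes orthogonality to the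
  coboundary of a unit cochain.\<close>

lemma coboundary_adjoint_eval:
  assumes "\<tau> \<in> simplices K k"
  shows "coboundary_adjoint K k \<gamma> \<tau> = cochain_inner K (Suc k) (coboundary K k (unit_cochain \<tau>)) \<gamma>"
proof -
  have "cochain_inner K k (unit_cochain \<tau>) \<phi> = \<phi> \<tau>" for \<phi>
  proof -
    have "cochain_inner K k (unit_cochain \<tau>) \<phi> = (\<Sum>\<sigma>\<in>simplices K k. if \<sigma> = \<tau> then \<phi> \<tau> else 0)"
      unfolding cochain_inner_def unit_cochain_def by (rule sum.cong) auto
    then show ?thesis using assms finite_simplices by simp
  qed
  then show ?thesis
    using coboundary_adjoint(2)[OF fin unit_cochain[OF assms]] by simp
qed

lemma coboundary_adjoint_diff:
  assumes "\<tau> \<in> simplices K k"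
  shows "coboundary_adjoint K k (\<lambda>\<sigma>. \<phi> \<sigma> - c * \<psi> \<sigma>) \<tau> =
    coboundary_adjoint K k \<phi> \<tau> - c * coboundary_adjoint K k \<psi> \<tau>"
  by (simp add: coboundary_adjoint_eval[OF assms] cochain_inner_diff_right)

text \<open>Gram--Schmidt, one simplex at a time.\<close>

lemma orthogonal_correction_on:
  assumes "S \<subseteq> simplices K k"
  shows "\<exists>\<beta>. (\<forall>\<tau>. \<tau> \<notin> S \<longrightarrow> \<beta> \<tau> = 0) \<and>
    (\<forall>\<tau>\<in>S. coboundary_adjoint K k (\<lambda>\<sigma>. \<theta> \<sigma> - coboundary K k \<beta> \<sigma>) \<tau> = 0)"
proof -
  have "finite S" using assms finite_simplices finite_subset by blast
  then show ?thesis using assms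
  \<comment> \<open>\<open>\<theta>\<close> is generalised because the hypothesis is used twice: for
    the given cochain and for the coboundary of the new unit cochain.\<close>
  proof (induction S arbitrary: \<theta> rule: finite_induct)
    case empty
    show ?case by (intro exI[of _ "\<lambda>_. 0"]) auto
  next
    case (insert \<rho> S)
    let ?A = "coboundary_adjoint K k"
    have \<rho>: "\<rho> \<in> simplices K k" and S: "S \<subseteq> simplices K k" using insert.prems by auto
    obtain \<beta>1 where \<beta>1: "\<And>\<tau>. \<tau> \<notin> S \<Longrightarrow> \<beta>1 \<tau> = 0"
      and o1: "\<And>\<tau>. \<tau> \<in> S \<Longrightarrow>
        ?A (\<lambda>\<sigma>. coboundary K k (unit_cochain \<rho>) \<sigma> - coboundary K k \<beta>1 \<sigma>) \<tau> = 0"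
      using insert.IH[OF S, of "coboundary K k (unit_cochain \<rho>)"] by blast
    obtain \<beta>0 where \<beta>0: "\<And>\<tau>. \<tau> \<notin> S \<Longrightarrow> \<beta>0 \<tau> = 0"
      and o0: "\<And>\<tau>. \<tau> \<in> S \<Longrightarrow> ?A (\<lambda>\<sigma>. \<theta> \<sigma> - coboundary K k \<beta>0 \<sigma>) \<tau> = 0"
      using insert.IH[OF S, of \<theta>] by blast
    \<comment> \<open>Below, \<open>u\<close> is the new coboundary made orthogonal to those already
      treated, and \<open>v\<close> is the input corrected against them.\<close>
    define w where "w \<sigma> = unit_cochain \<rho> \<sigma> - \<beta>1 \<sigma>" for \<sigma>
    define u where "u = coboundary K k w"
    define v where "v \<sigma> = \<theta> \<sigma> - coboundary K k \<beta>0 \<sigma>" for \<sigma>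
    have w: "w \<in> cochains K k"
      using \<rho> S \<beta>1 by (auto simp: w_def cochains_def unit_cochain_def)
    have u: "u = (\<lambda>\<sigma>. coboundary K k (unit_cochain \<rho>) \<sigma> - coboundary K k \<beta>1 \<sigma>)"
      by (simp add: u_def w_def[abs_def] coboundary_diff)
    have Au: "?A u \<tau> = 0" and Av: "?A v \<tau> = 0" if "\<tau> \<in> S" for \<tau>
      using o1[OF that] o0[OF that] by (simp_all add: u v_def[abs_def])
    \<comment> \<open>The part of \<open>w\<close> supported on \<open>S\<close> pairs to zero with
      \<open>?A z\<close>, which leaves the coefficient 1 at \<open>\<rho>\<close>.\<close>
    have inner_u: "cochain_inner K (Suc k) u z = ?A z \<rho>" if "\<And>\<tau>. \<tau> \<in> S \<Longrightarrow> ?A z \<tau> = 0" for z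
    proof -
      have "cochain_inner K (Suc k) u z = cochain_inner K k w (?A z)"
        unfolding u_def by (rule coboundary_adjoint(2)[OF fin w])
      also have "\<dots> = (\<Sum>\<sigma>\<in>simplices K k. if \<sigma> = \<rho> then ?A z \<rho> else 0)"
        unfolding cochain_inner_def
        by (rule sum.cong) (use insert.hyps that \<beta>1 in \<open>auto simp: w_def unit_cochain_def\<close>)
      also have "\<dots> = ?A z \<rho>" using \<rho> finite_simplices by simp
      finally show ?thesis .
    qed
    show ?case
    \<comment> \<open>By \<open>inner_u\<close> this number is the squared norm of \<open>u\<close>.
      If it vanishes, \<open>u\<close> is zero and \<open>v\<close> is already orthogonal to the new
      coboundary.\<close>
    proof (cases "?A u \<rho> = 0")
      case True
      then have "cochain_inner K (Suc k) u u = 0" using inner_u[OF Au] by simp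
      then have "u \<sigma> = 0" if "\<sigma> \<in> simplices K (Suc k)" for \<sigma>
        using cochain_inner_self_eq_0 that by blast
      then have "cochain_inner K (Suc k) u v = 0" by (simp add: cochain_inner_def)
      then have "?A v \<rho> = 0" using inner_u[OF Av] by simp
      then show ?thesis using \<beta>0 Av by (intro exI[of _ \<beta>0]) (auto simp: v_def[abs_def])
    next
      case False
      \<comment> \<open>The projection coefficient: the inner product of \<open>u\<close> and
        \<open>v\<close> over the squared norm of \<open>u\<close>.\<close>
      define c where "c = ?A v \<rho> / ?A u \<rho>"
      define \<beta> where "\<beta> \<sigma> = \<beta>0 \<sigma> + c * w \<sigma>" for \<sigma>
      have cw: "coboundary K k (\<lambda>\<sigma>. c * w \<sigma>) = (\<lambda>\<sigma>. c * u \<sigma>)"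
        unfolding u_def coboundary_def Let_def
        by (auto simp: sum_distrib_left fun_eq_iff simp del: sum.atLeast0_atMost_Suc sum.cl_ivl_Suc intro!: sum.cong)
      have eq: "(\<lambda>\<sigma>. \<theta> \<sigma> - coboundary K k \<beta> \<sigma>) = (\<lambda>\<sigma>. v \<sigma> - c * u \<sigma>)"
        by (simp add: \<beta>_def[abs_def] coboundary_add cw v_def fun_eq_iff algebra_simps)
      show ?thesis
      proof (intro exI[of _ \<beta>] conjI allI impI ballI)
        show "\<beta> \<tau> = 0" if "\<tau> \<notin> insert \<rho> S" for \<tau>
          using that \<beta>0 \<beta>1 by (simp add: \<beta>_def w_def unit_cochain_def)
        show "?A (\<lambda>\<sigma>. \<theta> \<sigma> - coboundary K k \<beta> \<sigma>) \<tau> = 0" if "\<tau> \<in> insert \<rho> S" for \<tau>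
        proof -
          have "\<tau> \<in> simplices K k" using that insert.prems by blast
          then show ?thesis
            unfolding eq coboundary_adjoint_diff[OF \<open>\<tau> \<in> simplices K k\<close>]
            using that Au Av False by (auto simp: c_def)
        qed
      qed
    qed
  qed
qed

lemma orthogonal_correction:
  obtains \<beta> where "\<beta> \<in> cochains K k"
    "coboundary_adjoint K k (\<lambda>\<sigma>. \<theta> \<sigma> - coboundary K k \<beta> \<sigma>) = (\<lambda>_. 0)"
proof -
  obtain \<beta> where \<beta>: "\<And>\<tau>. \<tau> \<notin> simplices K k \<Longrightarrow> \<beta> \<tau> = 0"
    "\<And>\<tau>. \<tau> \<in> simplices K k \<Longrightarrow> coboundary_adjoint K k (\<lambda>\<sigma>. \<theta> \<sigma> - coboundary K k \<beta> \<sigma>) \<tau> = 0"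
    using orthogonal_correction_on[of "simplices K k" \<theta>] by blast
  show thesis
  proof
    show "\<beta> \<in> cochains K k" using \<beta>(1) by (simp add: cochains_def)
    show "coboundary_adjoint K k (\<lambda>\<sigma>. \<theta> \<sigma> - coboundary K k \<beta> \<sigma>) = (\<lambda>_. 0)"
      using \<beta>(2) coboundary_adjoint(1)[OF fin, of k] by (auto simp: cochains_def fun_eq_iff)
  qed
qed

lemma coboundary_adjoint_zero: "coboundary_adjoint K k (\<lambda>_. 0) = (\<lambda>_. 0)"
proof (rule cochain_self_inner_eq_0)
  show "coboundary_adjoint K k (\<lambda>_. 0) \<in> cochains K k" by (rule coboundary_adjoint(1)[OF fin])
  from coboundary_adjoint(2)[OF fin this, of "\<lambda>_. 0"]
  show "cochain_inner K k (coboundary_adjoint K k (\<lambda>_. 0)) (coboundary_adjoint K k (\<lambda>_. 0)) = 0"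
    by (simp add: cochain_inner_def)
qed

end

text \<open>On a cocycle only the term
  \<open>coboundary K 1 (coboundary_adjoint K 1 \<theta>)\<close> is left. Its pairing with
  \<open>\<theta>\<close> is the squared norm of the adjoint, which must therefore vanish.\<close>

lemma harmonic_cocycle_iff:
  assumes fin: "finite K" and \<theta>: "\<theta> \<in> cocycles K 2"
  shows "harmonic K 2 \<theta> \<longleftrightarrow> coboundary_adjoint K 1 \<theta> = (\<lambda>_. 0)"
proof -
  have c: "\<theta> \<in> cochains K 2" "coboundary K 2 \<theta> = (\<lambda>_. 0)" using \<theta> by (auto simp: cocycles_def)
  have "harmonic K 2 \<theta> \<longleftrightarrow> coboundary K 1 (coboundary_adjoint K 1 \<theta>) = (\<lambda>_. 0)"
    unfolding harmonic_def c(2) using c(1)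
    by (simp add: coboundary_adjoint_zero[OF fin] fun_eq_iff numeral_2_eq_2)
  also have "\<dots> \<longleftrightarrow> coboundary_adjoint K 1 \<theta> = (\<lambda>_. 0)"
  proof
    assume z: "coboundary K 1 (coboundary_adjoint K 1 \<theta>) = (\<lambda>_. 0)"
    have "cochain_inner K 1 (coboundary_adjoint K 1 \<theta>) (coboundary_adjoint K 1 \<theta>) = 0"
      using coboundary_adjoint(2)[OF fin coboundary_adjoint(1)[OF fin], of 1 \<theta> \<theta>] z
      by (simp add: cochain_inner_def)
    then show "coboundary_adjoint K 1 \<theta> = (\<lambda>_. 0)"
      by (rule cochain_self_inner_eq_0[OF fin coboundary_adjoint(1)[OF fin]])
  qed (simp add: coboundary_zero)
  finally show ?thesis .
qed

lemma is_harmonic_rep_iff: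
  assumes fin: "finite K" and \<eta>: "\<eta> \<in> cocycles K 2"
  shows "is_harmonic_rep K \<eta> \<theta> \<longleftrightarrow> \<theta> \<in> cocycles K 2 \<and> coboundary_adjoint K 1 \<theta> = (\<lambda>_. 0) \<and>
    (\<lambda>\<sigma>. int_to_real_cochain \<eta> \<sigma> - \<theta> \<sigma>) \<in> coboundaries K 2"
proof (cases "\<theta> \<in> cocycles K 2")
  case True
  have "cohomology_class K 2 \<theta> = int_to_real_cohomology K 2 (cohomology_class K 2 \<eta>) \<longleftrightarrow>
      cohomology_class K 2 (int_to_real_cochain \<eta>) = cohomology_class K 2 \<theta>"
    using int_to_real_cohomology_class[of \<eta> K 1] \<eta> by (auto simp: numeral_2_eq_2)
  also have "\<dots> \<longleftrightarrow> (\<lambda>\<sigma>. int_to_real_cochain \<eta> \<sigma> - \<theta> \<sigma>) \<in> coboundaries K 2"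
    using cohomology_class_eq_iff[of "int_to_real_cochain \<eta>" K 1 \<theta>] int_to_real_cocycles[OF \<eta>] True
    by (simp add: numeral_2_eq_2)
  finally show ?thesis using harmonic_cocycle_iff[OF fin True] True by (simp add: is_harmonic_rep_def)
qed (simp add: is_harmonic_rep_def)

text \<open>The difference is a coboundary and is annihilated by the adjoint, hence orthogonal to
  itself. Two integral cocycles are allowed so that the maps of cohomologous cocycles can be
  compared over the same \<open>\<theta>\<close>.\<close>

lemma harmonic_rep_unique:
  assumes fin: "finite K" and \<eta>: "\<eta> \<in> cocycles K 2" "\<eta>' \<in> cocycles K 2"
    and cohomologous: "(\<lambda>\<sigma>. \<eta> \<sigma> - \<eta>' \<sigma>) \<in> coboundaries K 2"
    and \<theta>: "is_harmonic_rep K \<eta> \<theta>" and \<theta>': "is_harmonic_rep K \<eta>' \<theta>'"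
  shows "\<theta> = \<theta>'"
proof -
  let ?j = "int_to_real_cochain"
  have j: "(\<lambda>\<sigma>. ?j \<eta> \<sigma> - ?j \<eta>' \<sigma>) \<in> coboundaries K (Suc 1)"
    using int_to_real_coboundaries[of "\<lambda>\<sigma>. \<eta> \<sigma> - \<eta>' \<sigma>" K 1] cohomologous
    by (simp add: int_to_real_cochain_def numeral_2_eq_2)
  have "(\<lambda>\<sigma>. ?j \<eta> \<sigma> - \<theta> \<sigma>) \<in> coboundaries K (Suc 1)"
    and "(\<lambda>\<sigma>. ?j \<eta>' \<sigma> - \<theta>' \<sigma>) \<in> coboundaries K (Suc 1)"
    using \<theta> \<theta>' is_harmonic_rep_iff[OF fin] \<eta> by (auto simp: numeral_2_eq_2)
  note coboundaries_diff[OF j coboundaries_diff[OF this]]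
  then have "(\<lambda>\<sigma>. \<theta> \<sigma> - \<theta>' \<sigma>) \<in> coboundaries K (Suc 1)" by simp
  then obtain \<beta> where \<beta>: "\<beta> \<in> cochains K 1" "(\<lambda>\<sigma>. \<theta> \<sigma> - \<theta>' \<sigma>) = coboundary K 1 \<beta>"
    unfolding coboundaries_Suc_iff by blast
  have "cochain_inner K (Suc 1) (coboundary K 1 \<beta>) z = 0" if "coboundary_adjoint K 1 z = (\<lambda>_. 0)" for z
    using coboundary_adjoint(2)[OF fin \<beta>(1), of z] that by (simp add: cochain_inner_def)
  then have "cochain_inner K (Suc 1) (coboundary K 1 \<beta>) (\<lambda>\<sigma>. \<theta> \<sigma> - 1 * \<theta>' \<sigma>) = 0"
    using \<theta> \<theta>' is_harmonic_rep_iff[OF fin] \<eta> unfolding cochain_inner_diff_right[OF fin] by auto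
  then have "cochain_inner K (Suc 1) (coboundary K 1 \<beta>) (coboundary K 1 \<beta>) = 0"
    using \<beta>(2) by simp
  from cochain_self_inner_eq_0[OF fin coboundary_cochains this]
  show ?thesis using \<beta>(2) by (auto simp: fun_eq_iff)
qed

text \<open>Subtracting the orthogonal projection onto the coboundaries stays in the real class of
  \<open>\<eta>\<close> and reaches the kernel of the adjoint.\<close>

lemma harmonic_rep_exists:
  assumes fin: "finite K" and face: "\<And>\<sigma> \<rho>. \<sigma> \<in> K \<Longrightarrow> \<rho> \<subseteq> \<sigma> \<Longrightarrow> \<rho> \<noteq> {} \<Longrightarrow> \<rho> \<in> K"
    and \<eta>: "\<eta> \<in> cocycles K 2"
  obtains \<theta> where "is_harmonic_rep K \<eta> \<theta>"
proof -
  let ?j = "int_to_real_cochain"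
  obtain \<beta> where \<beta>: "\<beta> \<in> cochains K 1"
    "coboundary_adjoint K 1 (\<lambda>\<sigma>. ?j \<eta> \<sigma> - coboundary K 1 \<beta> \<sigma>) = (\<lambda>_. 0)"
    by (rule orthogonal_correction[OF fin])
  define \<theta> where "\<theta> = (\<lambda>\<sigma>. ?j \<eta> \<sigma> - coboundary K 1 \<beta> \<sigma>)"
  have "\<theta> \<in> cocycles K 2"
    using int_to_real_cocycles[OF \<eta>] coboundary_coboundary[OF face, where \<phi> = \<beta>] coboundary_cochains[of K 1 \<beta>]
    by (auto simp: \<theta>_def cocycles_def coboundary_diff cochains_diff numeral_2_eq_2)
  moreover have "(\<lambda>\<sigma>. ?j \<eta> \<sigma> - \<theta> \<sigma>) \<in> coboundaries K 2"
    using \<beta>(1) by (auto simp: \<theta>_def numeral_2_eq_2 coboundaries_Suc_iff)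
  ultimately have "is_harmonic_rep K \<eta> \<theta>"
    unfolding is_harmonic_rep_iff[OF fin \<eta>] using \<beta>(2) by (simp add: \<theta>_def)
  then show thesis by (rule that)
qed

lemma is_correction_exists:
  assumes fin: "finite K" and \<eta>: "\<eta> \<in> cocycles K 2" and \<theta>: "is_harmonic_rep K \<eta> \<theta>"
  obtains \<nu> where "is_correction K \<eta> \<theta> \<nu>"
proof -
  have "(\<lambda>\<sigma>. int_to_real_cochain \<eta> \<sigma> - \<theta> \<sigma>) \<in> coboundaries K (Suc 1)"
    using \<theta> is_harmonic_rep_iff[OF fin \<eta>] by (simp add: numeral_2_eq_2)
  then obtain \<nu> where "\<nu> \<in> cochains K 1" "(\<lambda>\<sigma>. int_to_real_cochain \<eta> \<sigma> - \<theta> \<sigma>) = coboundary K 1 \<nu>"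
    unfolding coboundaries_Suc_iff by blast
  then have "is_correction K \<eta> \<theta> \<nu>"
    unfolding is_correction_def by (metis (no_types, lifting) ext add_diff_cancel_left' diff_add_cancel)
  then show thesis by (rule that)
qed

section \<open>The sparse filtration\<close>

locale sparse_filtration =
  fixes X :: "'a::metric_space set" and x :: "nat \<Rightarrow> 'a" and n :: nat and e a :: real
  assumes greedy: "greedy_permutation X n x" and e_pos: "0 < e" and a_nonneg: "0 \<le> a"
begin

abbreviation "K \<equiv> sparse_cech x n e a"
abbreviation "B \<equiv> sparse_ball x e a"

text \<open>The insertion radius as a real number for positive \<open>s\<close>. At 0 it is a
  distance to the empty set, with default value 0 instead of infinity, which is why
  \<open>dead\<close> demands \<open>0 < s\<close>.\<close>

definition sep :: "nat \<Rightarrow> real" where "sep s = infdist (x s) (x ` {0..<s})"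

definition dead :: "real \<Rightarrow> nat \<Rightarrow> bool" where
  "dead c s \<longleftrightarrow> 0 < s \<and> sep s * ((1 + e)\<^sup>2 / e) < c"

lemma sparse_radius_0: "sparse_radius x e c 0 = c"
  using e_pos by (simp add: sparse_radius_def insertion_radius_def)

text \<open>The cases merge into a minimum because the scale at which growth stops does not exceed
  the scale of death.\<close>

lemma sparse_radius_pos_index:
  assumes "0 < s"
  shows "sparse_radius x e c s =
    (if dead c s then 0 else min c (sep s * ((1 + e) / e)))"
proof -
  have "sep s * ((1 + e) / e) \<le> sep s * ((1 + e)\<^sup>2 / e)"
    using e_pos infdist_nonneg[of "x s"]
    by (intro mult_left_mono divide_right_mono) (auto simp: sep_def power2_eq_square)
  then show ?thesis
    using assms by (auto simp: sparse_radius_def insertion_radius_def dead_def sep_def[symmetric] min_def)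
qed

lemma sparse_radius_mono:
  assumes "l \<le> c" "\<not> dead c s"
  shows "sparse_radius x e l s \<le> sparse_radius x e c s"
proof (cases "s = 0")
  case False
  then have "\<not> dead l s" using assms by (auto simp: dead_def)
  then show ?thesis using assms False by (simp add: sparse_radius_pos_index min_le_iff_disj)
qed (use assms in \<open>simp add: sparse_radius_0\<close>)

lemma sparse_ball_mono:
  assumes "l \<le> c" "\<not> dead c s"
  shows "sparse_ball x e l s \<subseteq> sparse_ball x e c s"
  using sparse_radius_mono[OF assms] by (auto simp: sparse_ball_def)

lemma sparse_ball_dead: "dead c s \<Longrightarrow> sparse_ball x e c s = {}"
  by (auto simp: sparse_ball_def sparse_radius_pos_index dead_def not_less)

lemma mem_X: "t \<le> n \<Longrightarrow> x t \<in> X"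
  using greedy by (auto simp: greedy_permutation_def bij_betw_def)

text \<open>The maximum in the greedy choice runs over all of \<open>X\<close>, so the first
  \<open>s\<close> points form a net of radius \<open>sep s\<close>.\<close>

lemma infdist_le_sep:
  assumes "0 < s" "s \<le> n" "t \<le> n"
  shows "infdist (x t) (x ` {0..<s}) \<le> sep s"
proof -
  obtain r where r: "s = Suc r" using assms(1) by (cases s) auto
  then show ?thesis
    using greedy mem_X[OF assms(3)] assms(2)
    by (auto simp: greedy_permutation_def sep_def atLeastLessThanSuc_atLeastAtMost)
qed

lemma sep_antimono:
  assumes "0 < s" "s \<le> t" "t \<le> n"
  shows "sep t \<le> sep s"
proof -
  have "sep t \<le> infdist (x t) (x ` {0..<s})"
    unfolding sep_def by (rule infdist_mono) (use assms in auto)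
  then show ?thesis using infdist_le_sep[of s t] assms by simp
qed

lemma dead_mono:
  assumes "dead c s" "s \<le> t" "t \<le> n"
  shows "dead c t"
proof -
  have "sep t * ((1 + e)\<^sup>2 / e) \<le> sep s * ((1 + e)\<^sup>2 / e)"
    using assms e_pos by (intro mult_right_mono sep_antimono) (auto simp: dead_def)
  then show ?thesis using assms by (auto simp: dead_def)
qed

lemma nearby_predecessor:
  assumes "0 < s" "s \<le> n" "t \<le> n"
  obtains p where "p < s" "dist (x t) (x p) \<le> sep s"
proof -
  let ?D = "(\<lambda>y. dist (x t) y) ` x ` {0..<s}"
  have ne: "?D \<noteq> {}" and fin: "finite ?D" using assms(1) by auto
  have "infdist (x t) (x ` {0..<s}) = Min ?D"
    using assms(1) cInf_eq_Min[OF fin ne] by (simp add: infdist_notempty)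
  then have "infdist (x t) (x ` {0..<s}) \<in> ?D" using Min_in[OF fin ne] by simp
  then obtain p where "p < s" "infdist (x t) (x ` {0..<s}) = dist (x t) (x p)" by auto
  then show thesis using that infdist_le_sep[OF assms] by metis
qed

section \<open>Absorption of dying balls and the simplices of the complex\<close>

text \<open>The absorbing point must be close to \<open>x s\<close> and still growing at scale
  \<open>c\<close>. Let \<open>m\<close> be the first positive index of separation at most
  \<open>(1 + e) * sep s\<close>, and let \<open>p\<close> be a predecessor of \<open>m\<close>
  within \<open>sep m\<close> of \<open>x s\<close>. Minimality of \<open>m\<close> gives
  \<open>p\<close>, unless it is 0, a separation above \<open>(1 + e) * sep s\<close>, and then its
  radius at scale \<open>c\<close> is \<open>c\<close>.\<close>

lemma ball_absorbed_at_death: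
  assumes s: "0 < s" "s \<le> n" and c: "c = sep s * ((1 + e)\<^sup>2 / e)"
  obtains p where "p < s" "sparse_ball x e c s \<subseteq> sparse_ball x e c p"
proof -
  have sep0: "0 \<le> sep t" for t by (simp add: sep_def infdist_nonneg)
  define m where "m = (LEAST m. 0 < m \<and> sep m \<le> (1 + e) * sep s)"
  have ex: "0 < s \<and> sep s \<le> (1 + e) * sep s"
    using s sep0[of s] e_pos by (simp add: distrib_right)
  have m: "0 < m" "sep m \<le> (1 + e) * sep s" "m \<le> s"
    using LeastI[of "\<lambda>m. 0 < m \<and> sep m \<le> (1 + e) * sep s", OF ex]
      Least_le[of "\<lambda>m. 0 < m \<and> sep m \<le> (1 + e) * sep s", OF ex] by (auto simp: m_def)
  obtain p where p: "p < m" "dist (x s) (x p) \<le> sep m"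
    using nearby_predecessor[of m s] m s by auto
  have large: "(1 + e) * sep s < sep p" if "0 < p"
    using not_less_Least[OF p(1)[unfolded m_def]] that by auto
  have "\<not> dead c s" by (simp add: dead_def c)
  then have rs: "sparse_radius x e c s \<le> sep s * ((1 + e) / e)"
    using s by (simp add: sparse_radius_pos_index)
  have rp: "sparse_radius x e c p = c"
  proof (cases "p = 0")
    case False
    then have l: "(1 + e) * sep s < sep p" using large by simp
    have "c = ((1 + e) * sep s) * ((1 + e) / e)" by (simp add: c power2_eq_square)
    also have "\<dots> \<le> sep p * ((1 + e) / e)"
      using l e_pos by (intro mult_right_mono) auto
    finally have "c \<le> sep p * ((1 + e) / e)" .
    moreover have "sep s * ((1 + e)\<^sup>2 / e) \<le> sep p * ((1 + e)\<^sup>2 / e)"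
      using l ex e_pos by (intro mult_right_mono) auto
    then have "\<not> dead c p" by (simp add: dead_def c)
    ultimately show ?thesis using False by (simp add: sparse_radius_pos_index)
  qed (simp add: sparse_radius_0)
  \<comment> \<open>The death scale splits into the largest radius of the dying ball and the bound
    on the distance from \<open>x s\<close> to \<open>x p\<close>, which is what the triangle
    inequality asks for.\<close>
  have "c = sep s * ((1 + e) / e) + (1 + e) * sep s"
    using e_pos by (simp add: c power2_eq_square field_simps)
  then have cc: "sparse_radius x e c s + dist (x s) (x p) \<le> c"
    using rs p(2) m(2) by linarith
  show thesis
  proof
    show "p < s" using p m by simp
    show "sparse_ball x e c s \<subseteq> sparse_ball x e c p"
    proof
      fix b assume "b \<in> sparse_ball x e c s"
      then show "b \<in> sparse_ball x e c p"
        using cc rp dist_triangle[of b "x p" "x s"] by (simp add: sparse_ball_def)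
    qed
  qed
qed

text \<open>A common point of tubes is a pair, so the balls of a simplex meet at one scale
  \<open>c\<close>, possibly below \<open>a\<close>. This is how vertices without a ball at scale
  \<open>a\<close> remain in the complex.\<close>

lemma mem_sparse_cech:
  "\<sigma> \<in> K \<longleftrightarrow> \<sigma> \<noteq> {} \<and> \<sigma> \<subseteq> {0..n} \<and> (\<exists>c\<in>{0..a}. \<exists>b. \<forall>s\<in>\<sigma>. b \<in> sparse_ball x e c s)"
proof -
  have "(b, c) \<in> (\<Inter>s\<in>\<sigma>. sparse_tube x e a s) \<longleftrightarrow>
      c \<in> {0..a} \<and> (\<forall>s\<in>\<sigma>. b \<in> sparse_ball x e c s)" if "\<sigma> \<noteq> {}" for b c
    using that by (auto simp: sparse_tube_def)
  then have "(\<Inter>s\<in>\<sigma>. sparse_tube x e a s) \<noteq> {} \<longleftrightarrow>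
      (\<exists>c\<in>{0..a}. \<exists>b. \<forall>s\<in>\<sigma>. b \<in> sparse_ball x e c s)" if "\<sigma> \<noteq> {}"
    using that by (simp only: ex_in_conv[symmetric] split_paired_Ex) blast
  then show ?thesis
    using finite_subset[of \<sigma> "{0..n}"] unfolding sparse_cech_def nerve_def by blast
qed

lemma sparse_cech_face: "\<sigma> \<in> K \<Longrightarrow> \<rho> \<subseteq> \<sigma> \<Longrightarrow> \<rho> \<noteq> {} \<Longrightarrow> \<rho> \<in> K"
  unfolding mem_sparse_cech by (meson subset_iff)

lemma finite_sparse_cech: "finite K"
  by (rule finite_subset[of _ "Pow {0..n}"]) (simp_all add: subset_iff mem_sparse_cech)

lemma mem_sparse_cechI:
  assumes "\<sigma> \<noteq> {}" "\<sigma> \<subseteq> {0..n}" "\<And>s. s \<in> \<sigma> \<Longrightarrow> b \<in> B s"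
  shows "\<sigma> \<in> K"
  using assms a_nonneg unfolding mem_sparse_cech by (metis atLeastAtMost_iff order_refl)

text \<open>Balls of vertices living at \<open>a\<close> only grow up to scale \<open>a\<close>, so
  a witness at an earlier scale remains one.\<close>

lemma alive_simplex:
  assumes "\<sigma> \<in> K" "\<And>s. s \<in> \<sigma> \<Longrightarrow> \<not> dead a s"
  obtains b where "\<And>s. s \<in> \<sigma> \<Longrightarrow> b \<in> B s"
  using assms sparse_ball_mono unfolding mem_sparse_cech by (metis atLeastAtMost_iff subsetD)

text \<open>Hence the complex collapses, one dead vertex at a time, onto its full subcomplex spanned by the
  living vertices.\<close>

lemma dead_vertex_link_cone:
  assumes "dead a s" "s \<le> n"
  obtains p where "p < s" "\<And>\<sigma>. \<sigma> \<in> K \<Longrightarrow> s \<in> \<sigma> \<Longrightarrow> \<sigma> \<subseteq> {0..s} \<Longrightarrow> insert p \<sigma> \<in> K"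
proof -
  \<comment> \<open>The last scale at which \<open>s\<close> is alive, since the inequality in
    \<open>dead\<close> is strict.\<close>
  define c where "c = sep s * ((1 + e)\<^sup>2 / e)"
  have s: "0 < s" using assms by (simp add: dead_def)
  obtain p where p: "p < s" "sparse_ball x e c s \<subseteq> sparse_ball x e c p"
    by (rule ball_absorbed_at_death[OF s assms(2) c_def])
  show thesis
  proof (rule that[OF p(1)])
    fix \<sigma> assume \<sigma>: "\<sigma> \<in> K" "s \<in> \<sigma>" "\<sigma> \<subseteq> {0..s}"
    then obtain l b where l: "l \<in> {0..a}" and b: "\<And>t. t \<in> \<sigma> \<Longrightarrow> b \<in> sparse_ball x e l t"
      unfolding mem_sparse_cech by blast
    have "\<not> dead l s" using b[OF \<sigma>(2)] sparse_ball_dead by blast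
    then have lc: "l \<le> c" using s by (simp add: dead_def c_def)
    \<comment> \<open>Vertices before \<open>s\<close> die no earlier than \<open>s\<close>. So the
      witness \<open>b\<close> can be moved up from scale \<open>l\<close> to scale
      \<open>c\<close>, where the ball of \<open>p\<close> contains that of
      \<open>s\<close>.\<close>
    have "\<not> dead c t" if "t \<in> \<sigma>" for t
      using dead_mono[of c t s] \<sigma>(3) that assms(2) by (auto simp: dead_def c_def)
    then have bc: "b \<in> sparse_ball x e c t" if "t \<in> \<sigma>" for t
      using b[OF that] sparse_ball_mono[OF lc] that by blast
    then have "\<forall>t\<in>insert p \<sigma>. b \<in> sparse_ball x e c t" using p(2) \<sigma>(2) by blast
    moreover have "c \<in> {0..a}" using l lc assms(1) by (auto simp: dead_def c_def)
    ultimately show "insert p \<sigma> \<in> K"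
      using \<sigma>(1) p(1) assms(2) unfolding mem_sparse_cech by auto
  qed
qed

lemma alive_prefix: "\<not> dead a s \<Longrightarrow> s \<le> n \<Longrightarrow> t \<le> s \<Longrightarrow> \<not> dead a t"
  using dead_mono by blast

section \<open>Extension of coboundaries over the dead vertices\<close>

text \<open>Induction over initial segments of the vertices. The living ones form such a segment, so
  there the given \<open>\<beta>\<close> serves. A dead vertex gets the value forced by its edge to
  the cone apex \<open>p\<close>, and the triangles through \<open>p\<close> make this value fit its
  other edges.\<close>

lemma extend_0_cochain:
  fixes \<tau> :: "nat \<Rightarrow> nat \<Rightarrow> 'g::ab_group_add"
  assumes diag: "\<And>r. \<tau> r r = 0" and alt: "\<And>r t. \<tau> t r = - \<tau> r t"
    and cocycle: "\<And>r s t. {r, s, t} \<in> K \<Longrightarrow> \<tau> s t - \<tau> r t + \<tau> r s = 0"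
    and alive: "\<And>r t. {r, t} \<in> K \<Longrightarrow> \<not> dead a r \<Longrightarrow> \<not> dead a t \<Longrightarrow> \<tau> r t = \<beta> t - \<beta> r"
  obtains \<beta>' where "\<And>r t. {r, t} \<in> K \<Longrightarrow> \<tau> r t = \<beta>' t - \<beta>' r"
proof -
  have "\<exists>\<beta>. \<forall>r t. {r, t} \<in> K \<longrightarrow> r \<le> s \<longrightarrow> t \<le> s \<longrightarrow> \<tau> r t = \<beta> t - \<beta> r" if "s \<le> n" for s
    using that
  proof (induction s)
    case 0
    show ?case using diag by (intro exI[of _ \<beta>]) auto
  next
    case (Suc s)
    show ?case
    proof (cases "dead a (Suc s)")
      case False
      then show ?thesis using alive alive_prefix[OF False Suc.prems] by blast
    next
      case True
      obtain p where p: "p < Suc s"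
        and cone: "\<And>\<sigma>. \<sigma> \<in> K \<Longrightarrow> Suc s \<in> \<sigma> \<Longrightarrow> \<sigma> \<subseteq> {0..Suc s} \<Longrightarrow> insert p \<sigma> \<in> K"
        by (rule dead_vertex_link_cone[OF True Suc.prems]) blast
      obtain \<gamma> where \<gamma>: "\<And>r t. {r, t} \<in> K \<Longrightarrow> r \<le> s \<Longrightarrow> t \<le> s \<Longrightarrow> \<tau> r t = \<gamma> t - \<gamma> r"
        using Suc by auto
      define \<gamma>' where "\<gamma>' = \<gamma>(Suc s := \<gamma> p - \<tau> (Suc s) p)"
      have new: "\<tau> (Suc s) t = \<gamma>' t - \<gamma>' (Suc s)" if t: "{Suc s, t} \<in> K" "t \<le> s" for t
      proof -
        have pst: "insert p {Suc s, t} \<in> K" using cone[OF t(1)] t(2) by auto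
        then have "\<tau> t p - \<tau> (Suc s) p + \<tau> (Suc s) t = 0"
          by (intro cocycle) (simp add: insert_commute)
        moreover have "\<tau> t p = \<gamma> p - \<gamma> t"
          using p t(2) by (intro \<gamma> sparse_cech_face[OF pst]) auto
        ultimately show ?thesis using t(2) by (simp add: \<gamma>'_def algebra_simps)
      qed
      show ?thesis
      proof (intro exI[of _ \<gamma>'] allI impI)
        fix r t assume rt: "{r, t} \<in> K" "r \<le> Suc s" "t \<le> Suc s"
        consider "r \<le> s" "t \<le> s" | "r = Suc s" "t = Suc s" | "r = Suc s" "t \<le> s" | "r \<le> s" "t = Suc s"
          using rt by linarith
        then show "\<tau> r t = \<gamma>' t - \<gamma>' r"
        proof cases
          case 1 then show ?thesis using \<gamma>[OF rt(1)] by (simp add: \<gamma>'_def)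
        next
          case 2 then show ?thesis by (simp add: diag)
        next
          case 3 then show ?thesis using new rt(1) by simp
        next
          case 4
          then have "\<tau> (Suc s) r = \<gamma>' r - \<gamma>' (Suc s)" using new[of r] rt(1) by (simp add: insert_commute)
          then show ?thesis using 4 alt[where r = "Suc s" and t = r] by (metis minus_diff_eq)
        qed
      qed
    qed
  qed
  then obtain \<beta>' where \<beta>': "\<And>r t. {r, t} \<in> K \<Longrightarrow> r \<le> n \<Longrightarrow> t \<le> n \<Longrightarrow> \<tau> r t = \<beta>' t - \<beta>' r" by blast
  show thesis by (rule that[of \<beta>']) (rule \<beta>', auto simp: mem_sparse_cech)
qed

text \<open>The same induction one degree higher, with tetrahedra through the cone apex in place of
  triangles. Carrying along that \<open>m\<close> alternates reduces the triangles at the new vertex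
  to those that list it first.\<close>

lemma extend_1_cochain:
  fixes \<eta> :: "nat \<Rightarrow> nat \<Rightarrow> nat \<Rightarrow> 'g::ab_group_add"
  assumes diag: "\<And>r t. \<eta> r r t = 0"
    and alt1: "\<And>r s t. \<eta> s r t = - \<eta> r s t" and alt2: "\<And>r s t. \<eta> r t s = - \<eta> r s t"
    and cocycle: "\<And>r s t u. {r, s, t, u} \<in> K \<Longrightarrow> \<eta> s t u - \<eta> r t u + \<eta> r s u - \<eta> r s t = 0"
    and malt: "\<And>r. m r r = 0" "\<And>r t. m t r = - m r t"
    and alive: "\<And>r s t. {r, s, t} \<in> K \<Longrightarrow> \<not> dead a r \<Longrightarrow> \<not> dead a s \<Longrightarrow> \<not> dead a t \<Longrightarrow>
      \<eta> r s t = m s t - m r t + m r s"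
  obtains m' where "\<And>r s t. {r, s, t} \<in> K \<Longrightarrow> \<eta> r s t = m' s t - m' r t + m' r s"
    "\<And>r. m' r r = 0" "\<And>r t. m' t r = - m' r t"
proof -
  have diag2: "\<eta> r s r = 0" for r s
    unfolding alt2[of r s r] diag by simp
  have diag': "\<eta> r s s = 0" for r s
    unfolding alt1[of r s s] diag2 by simp
  have "\<exists>m. (\<forall>r. m r r = 0) \<and> (\<forall>r t. m t r = - m r t) \<and>
      (\<forall>r t u. {r, t, u} \<in> K \<longrightarrow> r \<le> s \<longrightarrow> t \<le> s \<longrightarrow> u \<le> s \<longrightarrow> \<eta> r t u = m t u - m r u + m r t)"
    if "s \<le> n" for s
    using that
  proof (induction s)
    case 0
    show ?case
    proof (intro exI[of _ m] conjI allI impI)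
      show "\<eta> r t u = m t u - m r u + m r t" if "r \<le> 0" "t \<le> 0" "u \<le> 0" for r t u
        using that diag[of 0 0] malt(1)[of 0] by simp
    qed (rule malt)+
  next
    case (Suc s)
    show ?case
    proof (cases "dead a (Suc s)")
      case False
      note pre = alive_prefix[OF False Suc.prems]
      show ?thesis
      proof (intro exI[of _ m] conjI allI impI)
        show "\<eta> r t u = m t u - m r u + m r t"
          if "{r, t, u} \<in> K" "r \<le> Suc s" "t \<le> Suc s" "u \<le> Suc s" for r t u
          using that(1) by (rule alive) (rule pre, rule that)+
      qed (rule malt)+
    next
      case True
      let ?s = "Suc s"
      obtain p where p: "p < ?s"
        and cone: "\<And>\<sigma>. \<sigma> \<in> K \<Longrightarrow> ?s \<in> \<sigma> \<Longrightarrow> \<sigma> \<subseteq> {0..?s} \<Longrightarrow> insert p \<sigma> \<in> K"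
        by (rule dead_vertex_link_cone[OF True Suc.prems]) blast
      obtain k where k0: "\<And>r. k r r = 0" and kalt: "\<And>r t. k t r = - k r t"
        and k: "\<And>r t u. {r, t, u} \<in> K \<Longrightarrow> r \<le> s \<Longrightarrow> t \<le> s \<Longrightarrow> u \<le> s \<Longrightarrow> \<eta> r t u = k t u - k r u + k r t"
        using Suc.IH[OF Suc_leD[OF Suc.prems]] by blast
      \<comment> \<open>The edge from the new vertex to the apex gets 0, as \<open>t = p\<close>
        shows; the triangle with the apex then forces the value on every other edge.\<close>
      define k' where "k' r t =
        (if r = ?s then (if t = ?s then 0 else \<eta> ?s t p - k t p)
         else if t = ?s then k r p - \<eta> ?s r p else k r t)" for r t
      have k'0: "k' r r = 0" and k'alt: "k' t r = - k' r t" for r t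
        using kalt[of r t] by (auto simp: k'_def k0)
      have new: "\<eta> ?s t u = k' t u - k' ?s u + k' ?s t" if tu: "{?s, t, u} \<in> K" "t \<le> s" "u \<le> s" for t u
      proof -
        have face: "insert p {?s, t, u} \<in> K" using cone[OF tu(1)] tu(2,3) by auto
        then have "\<eta> t u p - \<eta> ?s u p + \<eta> ?s t p - \<eta> ?s t u = 0"
          by (intro cocycle) (simp add: insert_commute)
        moreover have "\<eta> t u p = k u p - k t p + k t u"
          using p tu(2,3) by (intro k sparse_cech_face[OF face]) auto
        ultimately show ?thesis using tu(2,3) by (simp add: k'_def algebra_simps)
      qed
      show ?thesis
      proof (intro exI[of _ k'] conjI allI impI)
        fix r t u assume rtu: "{r, t, u} \<in> K" and le: "r \<le> ?s" "t \<le> ?s" "u \<le> ?s"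
        show "\<eta> r t u = k' t u - k' r u + k' r t"
        proof (cases "r = t \<or> t = u \<or> r = u")
          case True
          then consider "r = t" | "t = u" | "r = u" by blast
          then show ?thesis
          proof cases
            case 1 then show ?thesis by (simp add: k'0 diag)
          next
            case 2 then show ?thesis by (simp add: k'0 diag')
          next
            case 3 then show ?thesis using k'alt[of r t] by (simp add: k'0 diag2)
          qed
        next
          case False
          consider "r \<le> s" "t \<le> s" "u \<le> s" | "r = ?s" "t \<le> s" "u \<le> s"
            | "t = ?s" "r \<le> s" "u \<le> s" | "u = ?s" "r \<le> s" "t \<le> s"
            using le False by linarith
          then show ?thesis
          proof cases
            case 1 then show ?thesis using k[OF rtu] by (simp add: k'_def)
          next
            case 2 then show ?thesis using new rtu by simp
          next
            case 3
            then have "\<eta> ?s r u = k' r u - k' ?s u + k' ?s r" using new[of r u] rtu by (simp add: insert_commute)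
            moreover have "\<eta> r t u = - \<eta> ?s r u" "k' r t = - k' ?s r"
              unfolding 3(1) by (rule alt1 k'alt)+
            ultimately show ?thesis using 3(1) by simp
          next
            case 4
            then have "\<eta> ?s r t = k' r t - k' ?s t + k' ?s r" using new[of r t] rtu by (simp add: insert_commute)
            moreover have "\<eta> r t u = - \<eta> r ?s t" "\<eta> r ?s t = - \<eta> ?s r t" "k' r u = - k' ?s r" "k' t u = - k' ?s t"
              unfolding 4(1) by (rule alt1 alt2 k'alt)+
            ultimately show ?thesis by simp
          qed
        qed
      qed (fact k'0 k'alt)+
    qed
  qed
  from this[OF order_refl] obtain m' where m': "\<And>r. m' r r = 0" "\<And>r t. m' t r = - m' r t"
    "\<And>r s t. {r, s, t} \<in> K \<Longrightarrow> r \<le> n \<Longrightarrow> s \<le> n \<Longrightarrow> t \<le> n \<Longrightarrow> \<eta> r s t = m' s t - m' r t + m' r s"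
    by blast
  show thesis
  proof (rule that[OF _ m'(1,2)])
    fix r s t assume rst: "{r, s, t} \<in> K"
    then have "r \<le> n" "s \<le> n" "t \<le> n" by (simp_all add: mem_sparse_cech)
    then show "\<eta> r s t = m' s t - m' r t + m' r s" by (rule m'(3)[OF rst])
  qed
qed

text \<open>Outside \<open>sparse_index\<close> the balls are empty, so the cover can be indexed by
  all of \<open>{0..n}\<close>, as the coordinates and the sums are.\<close>

lemma ball_index: "s \<le> n \<Longrightarrow> b \<in> B s \<Longrightarrow> s \<in> sparse_index x n e a"
proof -
  assume s: "s \<le> n" "b \<in> B s"
  then have "\<not> dead a s" using sparse_ball_dead by blast
  then have "s = 0 \<or> e * a / (1 + e)\<^sup>2 \<le> sep s"
    using e_pos by (auto simp: dead_def field_simps)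
  then show "s \<in> sparse_index x n e a"
    using s(1) by (auto simp: sparse_index_def insertion_radius_def sep_def)
qed

lemma Union_sparse_balls: "\<Union>(sparse_balls x n e a) = (\<Union>s\<in>{0..n}. B s)"
proof
  show "\<Union>(sparse_balls x n e a) \<subseteq> (\<Union>s\<in>{0..n}. B s)"
    by (auto simp: sparse_balls_def sparse_index_def)
  show "(\<Union>s\<in>{0..n}. B s) \<subseteq> \<Union>(sparse_balls x n e a)"
    unfolding sparse_balls_def using ball_index by fastforce
qed

lemma sparse_ball_cases: "s \<le> n \<Longrightarrow> B s = {} \<or> B s \<in> sparse_balls x n e a"
  using ball_index by (auto simp: sparse_balls_def)

end

section \<open>The classifying maps\<close>

definition bit_sign :: "bit \<Rightarrow> real" where "bit_sign x = (-1) ^ of_bit x"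

lemma bit_sign_add: "bit_sign (x + y) = bit_sign x * bit_sign y"
  by (cases x; cases y) (simp_all add: bit_sign_def)

lemma bit_sign_nonzero: "bit_sign x \<noteq> 0"
  by (simp add: bit_sign_def)

lemma bit_sign_eq_iff: "bit_sign x = bit_sign y \<longleftrightarrow> x = y"
  by (cases x; cases y) (simp_all add: bit_sign_def)

lemma sgn_bit_sign: "sgn (bit_sign x) = bit_sign x"
  by (cases x) (simp_all add: bit_sign_def)

definition circle_exp :: "real \<Rightarrow> complex" where
  "circle_exp y = exp (2 * of_real pi * \<i> * of_real y)"

lemma circle_exp_add: "circle_exp (y + z) = circle_exp y * circle_exp z"
  by (simp add: circle_exp_def exp_add[symmetric] algebra_simps)

lemma circle_exp_of_int: "circle_exp (of_int k) = 1"
  using exp_integer_2pi[of "of_int k"] by (simp add: circle_exp_def mult_ac)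

lemma circle_exp_nonzero: "circle_exp y \<noteq> 0"
  by (simp add: circle_exp_def)

lemma cocycles_diff:
  "\<phi> \<in> cocycles K k \<Longrightarrow> \<psi> \<in> cocycles K k \<Longrightarrow> (\<lambda>\<sigma>. \<phi> \<sigma> - \<psi> \<sigma>) \<in> cocycles K k"
  by (simp add: cocycles_def coboundary_diff cochains_diff)

context sparse_filtration
begin

abbreviation "U \<equiv> \<Union>(sparse_balls x n e a)"
abbreviation "wt \<equiv> sparse_weight x n e a"

lemma ball_subset_U: "j \<le> n \<Longrightarrow> B j \<subseteq> U"
  unfolding Union_sparse_balls by auto

lemma U_cases:
  assumes "b \<in> U" obtains j where "j \<le> n" "b \<in> B j"
  using assms unfolding Union_sparse_balls by auto

lemma open_sparse_ball: "open (B j)"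
proof -
  have "B j = ball (x j) (sparse_radius x e a j)" by (auto simp: sparse_ball_def dist_commute)
  then show ?thesis by simp
qed

lemma openin_sparse_ball: "j \<le> n \<Longrightarrow> openin (top_of_set U) (B j)"
  using ball_subset_U open_sparse_ball by (intro open_subset)

lemma bump_pos_iff: "0 < (max (sparse_radius x e a t - dist b (x t)) 0)\<^sup>2 \<longleftrightarrow> b \<in> B t"
  by (auto simp: sparse_ball_def max_def)

lemma bump_sum_pos:
  assumes "b \<in> U"
  shows "0 < (\<Sum>t=0..n. (max (sparse_radius x e a t - dist b (x t)) 0)\<^sup>2)"
proof -
  obtain j where "j \<le> n" "b \<in> B j" using assms by (rule U_cases)
  then show ?thesis using bump_pos_iff[of j b] by (intro sum_pos2[of _ j]) auto
qed

lemma weight_pos: "b \<in> U \<Longrightarrow> b \<in> B t \<Longrightarrow> 0 < wt t b"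
  using bump_sum_pos bump_pos_iff by (auto simp: sparse_weight_def)

lemma weight_zero: "b \<notin> B t \<Longrightarrow> wt t b = 0"
  by (auto simp: sparse_weight_def sparse_ball_def max_def)

lemma weight_sum: "b \<in> U \<Longrightarrow> (\<Sum>t=0..n. wt t b) = 1"
  using bump_sum_pos[of b] unfolding sparse_weight_def sum_divide_distrib[symmetric] by simp

lemma continuous_on_weight: "continuous_on U (wt t)"
  unfolding sparse_weight_def[abs_def]
proof (intro continuous_intros ballI)
  fix b assume "b \<in> U"
  then show "(\<Sum>t=0..n. (max (sparse_radius x e a t - dist b (x t)) 0)\<^sup>2) \<noteq> 0"
    using bump_sum_pos by fastforce
qed

text \<open>Cocycle identities hold on simplices only, hence for those \<open>t\<close> whose ball
  contains \<open>b\<close>; the other weights vanish. The constant comes out because the weights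
  add up to 1.\<close>

lemma weighted_sum_shift:
  assumes "b \<in> U" "\<And>t. t \<le> n \<Longrightarrow> b \<in> B t \<Longrightarrow> F t = G t + c"
  shows "(\<Sum>t=0..n. wt t b * F t) = (\<Sum>t=0..n. wt t b * G t) + c"
proof -
  have "(\<Sum>t=0..n. wt t b * F t) = (\<Sum>t=0..n. wt t b * G t + wt t b * c)"
  proof (rule sum.cong[OF refl])
    fix t assume "t \<in> {0..n}"
    then show "wt t b * F t = wt t b * G t + wt t b * c"
      using assms(2)[of t] weight_zero[of b t] by (cases "b \<in> B t") (auto simp: distrib_left)
  qed
  also have "\<dots> = (\<Sum>t=0..n. wt t b * G t) + c"
    using weight_sum[OF assms(1)] by (simp add: sum.distrib sum_distrib_right[symmetric])
  finally show ?thesis .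
qed

section \<open>The real classifying map\<close>

lemma real_coords_eq:
  "real_coords x n e a \<tau> j b r = (if r \<le> n then bit_sign (alt2 \<tau> r j) * sqrt (wt r b) else 0)"
  by (simp add: real_coords_def sym_ext_eq bit_sign_def)

text \<open>If \<open>b\<close> lies in \<open>B r\<close>, then \<open>{r, j, k}\<close> is a
  simplex and the cocycle identity applies; otherwise coordinate \<open>r\<close> is zero in both
  charts.\<close>

lemma real_coords_transition:
  assumes \<tau>: "\<tau> \<in> cocycles K 1" and jk: "j \<le> n" "k \<le> n" "b \<in> B j" "b \<in> B k"
  shows "real_coords x n e a \<tau> j b = (\<lambda>r. bit_sign (alt2 \<tau> j k) * real_coords x n e a \<tau> k b r)"
proof
  fix r
  show "real_coords x n e a \<tau> j b r = bit_sign (alt2 \<tau> j k) * real_coords x n e a \<tau> k b r"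
  proof (cases "r \<le> n \<and> b \<in> B r")
    case True
    then have "{r, j, k} \<in> K" using jk by (intro mem_sparse_cechI[of _ b]) auto
    from alt2_cocycle[OF \<tau> this] have "alt2 \<tau> r j = alt2 \<tau> j k + alt2 \<tau> r k"
      by (cases "alt2 \<tau> r j"; cases "alt2 \<tau> j k"; cases "alt2 \<tau> r k") simp_all
    then have "bit_sign (alt2 \<tau> r j) = bit_sign (alt2 \<tau> j k) * bit_sign (alt2 \<tau> r k)"
      by (simp only: bit_sign_add)
    then show ?thesis using True by (simp add: real_coords_eq)
  next
    case False
    then show ?thesis using weight_zero[of b r] by (auto simp: real_coords_eq)
  qed
qed

lemma real_coords_diag: "j \<le> n \<Longrightarrow> b \<in> B j \<Longrightarrow> real_coords x n e a \<tau> j b j \<noteq> 0"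
  using weight_pos[OF subsetD[OF ball_subset_U], of j b j] by (simp add: real_coords_eq bit_sign_nonzero)

lemma real_frame:
  assumes \<tau>: "\<tau> \<in> cocycles K 1"
  shows "proj_frame U {0..n} B n (real_coords x n e a \<tau>)"
  unfolding proj_frame_def
proof (intro conjI ballI allI impI)
  show "U \<subseteq> \<Union>(B ` {0..n})" by (simp add: Union_sparse_balls)
  fix j assume j: "j \<in> {0..n}"
  then show "openin (top_of_set U) (B j)" by (simp add: openin_sparse_ball)
  show "continuous_on (B j) (\<lambda>b. real_coords x n e a \<tau> j b i)" for i
    using j continuous_on_subset[OF continuous_on_weight ball_subset_U[of j]]
    by (cases "i \<le> n") (auto simp: real_coords_eq intro!: continuous_intros)
  show "\<exists>i. real_coords x n e a \<tau> j b i \<noteq> 0" if "b \<in> B j" for b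
    using real_coords_diag[of j b \<tau>] j that by auto
  show "real_coords x n e a \<tau> j b i = 0" if "i > n" for b i using that by (simp add: real_coords_eq)
next
  fix j k b assume "j \<in> {0..n}" "k \<in> {0..n}" "b \<in> B j \<inter> B k"
  then show "\<exists>c. c \<noteq> 0 \<and> real_coords x n e a \<tau> j b = (\<lambda>i. c * real_coords x n e a \<tau> k b i)"
    using real_coords_transition[OF \<tau>, of j k b] bit_sign_nonzero by auto
qed

lemma is_real_map_exists: "\<tau> \<in> cocycles K 1 \<Longrightarrow> \<exists>f. is_real_map x n e a \<tau> f"
  by (rule proj_frame_map[OF real_frame]) (auto simp: is_real_map_def)

text \<open>A 0-cochain with coboundary \<open>\<tau> - \<tau>'\<close> provides one constant sign
  per ball, and these signs are the gauge.\<close>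

lemma real_maps_homotopic:
  assumes \<tau>: "\<tau> \<in> cocycles K 1" and \<tau>': "\<tau>' \<in> cocycles K 1"
    and eq: "cohomology_class K 1 \<tau> = cohomology_class K 1 \<tau>'"
    and f: "is_real_map x n e a \<tau> f" and f': "is_real_map x n e a \<tau>' f'"
  shows "homotopic_with (\<lambda>_. True) (top_of_set U) proj_space_inf f f'"
proof -
  have "(\<lambda>\<sigma>. \<tau> \<sigma> - \<tau>' \<sigma>) \<in> coboundaries K (Suc 0)"
    using cohomology_class_eq_iff[of \<tau> K 0 \<tau>'] \<tau> \<tau>' eq by simp
  then obtain \<mu> where \<mu>: "(\<lambda>\<sigma>. \<tau> \<sigma> - \<tau>' \<sigma>) = coboundary K 0 \<mu>"
    unfolding coboundaries_Suc_iff by blast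
  show ?thesis
  proof (rule homotopic_if_gauge_equivalent[OF real_frame[OF \<tau>] real_frame[OF \<tau>'],
        where c = "\<lambda>j k b. bit_sign (alt2 \<tau> j k)" and d = "\<lambda>j k b. bit_sign (alt2 \<tau>' j k)"
          and g = "\<lambda>j b. bit_sign (\<mu> {j})"])
    fix j k b assume jk: "j \<in> {0..n}" "k \<in> {0..n}" "b \<in> B j \<inter> B k"
    then have "{j, k} \<in> K" by (intro mem_sparse_cechI[of _ b]) auto
    then have "alt2 \<tau> j k - alt2 \<tau>' j k = \<mu> {k} - \<mu> {j}"
      unfolding alt2_diff[symmetric] \<mu> by (rule alt2_coboundary)
    then have "\<mu> {j} + alt2 \<tau>' j k = alt2 \<tau> j k + \<mu> {k}"
      by (cases "\<mu> {j}"; cases "\<mu> {k}"; cases "alt2 \<tau> j k"; cases "alt2 \<tau>' j k") simp_all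
    then show "bit_sign (\<mu> {j}) * bit_sign (alt2 \<tau>' j k) = bit_sign (alt2 \<tau> j k) * bit_sign (\<mu> {k})"
      by (simp only: bit_sign_add[symmetric])
    show "real_coords x n e a \<tau> j b = (\<lambda>i. bit_sign (alt2 \<tau> j k) * real_coords x n e a \<tau> k b i)"
      "real_coords x n e a \<tau>' j b = (\<lambda>i. bit_sign (alt2 \<tau>' j k) * real_coords x n e a \<tau>' k b i)"
      using jk by (auto intro: real_coords_transition[OF \<tau>] real_coords_transition[OF \<tau>'])
  qed (use f f' bit_sign_nonzero in \<open>auto simp: is_real_map_def\<close>)
qed

lemma real_maps_homotopic_imp_eq:
  assumes \<tau>: "\<tau> \<in> cocycles K 1" and \<tau>': "\<tau>' \<in> cocycles K 1"
    and f: "is_real_map x n e a \<tau> f" and f': "is_real_map x n e a \<tau>' f'"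
    and hom: "homotopic_with (\<lambda>_. True) (top_of_set U) proj_space_inf f f'"
    and conn: "\<And>C. C \<in> sparse_balls x n e a \<Longrightarrow> connected C"
  shows "cohomology_class K 1 \<tau> = cohomology_class K 1 \<tau>'"
proof -
  obtain h :: "nat \<Rightarrow> 'a \<Rightarrow> real" where h: "\<And>j. j \<in> {0..n} \<Longrightarrow> continuous_on (B j) (h j)"
    and h0: "\<And>j b. j \<in> {0..n} \<Longrightarrow> b \<in> B j \<Longrightarrow> h j b \<noteq> 0"
    and gauge: "\<And>j k b. j \<in> {0..n} \<Longrightarrow> k \<in> {0..n} \<Longrightarrow> b \<in> B j \<inter> B k \<Longrightarrow>
      h j b * bit_sign (alt2 \<tau>' j k) = bit_sign (alt2 \<tau> j k) * h k b"
  proof (rule gauge_equivalent_if_homotopic[OF real_frame[OF \<tau>] real_frame[OF \<tau>'], where f = f and f' = f'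
        and c = "\<lambda>j k b. bit_sign (alt2 \<tau> j k)" and d = "\<lambda>j k b. bit_sign (alt2 \<tau>' j k)"])
    show "real_coords x n e a \<tau> j b = (\<lambda>i. bit_sign (alt2 \<tau> j k) * real_coords x n e a \<tau> k b i)"
      "real_coords x n e a \<tau>' j b = (\<lambda>i. bit_sign (alt2 \<tau>' j k) * real_coords x n e a \<tau>' k b i)"
      if "j \<in> {0..n}" "k \<in> {0..n}" "b \<in> B j \<inter> B k" for j k b
      using that by (auto intro: real_coords_transition[OF \<tau>] real_coords_transition[OF \<tau>'])
    show "real_coords x n e a \<tau>' j b j \<noteq> 0" if "j \<in> {0..n}" "b \<in> B j" for j b
      using that real_coords_diag by auto
    show "f b = proj_point (real_coords x n e a \<tau> j b)" "f' b = proj_point (real_coords x n e a \<tau>' j b)"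
      if "j \<in> {0..n}" "b \<in> B j" for j b
      using that f f' by (auto simp: is_real_map_def)
    show "homotopic_with (\<lambda>_. True) (top_of_set U) proj_space_inf f f'" by (rule hom)
  qed (rule that)
  \<comment> \<open>The sign of the gauge on \<open>B j\<close> as an element of Z/2. Connectedness
    lets any single point decide it; an empty ball gets 0.\<close>
  define \<beta> :: "nat \<Rightarrow> bit" where "\<beta> j = (if \<exists>b\<in>B j. h j b < 0 then 1 else 0)" for j
  have neg: "h j b < 0 \<longleftrightarrow> \<beta> j = 1" if j: "j \<le> n" and b: "b \<in> B j" for j b
  proof
    assume "\<beta> j = 1"
    then obtain b' where b': "b' \<in> B j" "h j b' < 0" by (auto simp: \<beta>_def split: if_splits)
    have "connected (B j)" using conn sparse_ball_cases[OF j] b by auto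
    then have "connected (h j ` B j)" using h j by (intro connected_continuous_image) auto
    have "h j b \<noteq> 0" using h0[of j b] j b by simp
    moreover have "\<not> 0 < h j b"
    proof
      assume "0 < h j b"
      then have "0 \<in> h j ` B j"
        using b b' \<open>connected (h j ` B j)\<close>
        by (intro connectedD_interval[of "h j ` B j" "h j b'" "h j b" 0]) auto
      then show False using h0[of j] j by auto
    qed
    ultimately show "h j b < 0" by linarith
  qed (use b in \<open>auto simp: \<beta>_def\<close>)
  have sgn_h: "sgn (h j b) = bit_sign (\<beta> j)" if "j \<le> n" "b \<in> B j" for j b
    using neg[OF that] h0[of j b] that by (cases "\<beta> j") (auto simp: bit_sign_def sgn_if)
  have edge: "alt2 \<tau> r t - alt2 \<tau>' r t = \<beta> t - \<beta> r"
    if rt: "{r, t} \<in> K" "\<not> dead a r" "\<not> dead a t" for r t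
  proof -
    have "\<not> dead a s" if "s \<in> {r, t}" for s using that rt(2,3) by blast
    from alive_simplex[OF rt(1) this] obtain b where "\<And>s. s \<in> {r, t} \<Longrightarrow> b \<in> B s" by metis
    then have b: "b \<in> B r" "b \<in> B t" by simp_all
    have n: "r \<le> n" "t \<le> n" using rt(1) by (simp_all add: mem_sparse_cech)
    have "h r b * bit_sign (alt2 \<tau>' r t) = bit_sign (alt2 \<tau> r t) * h t b"
      using gauge[of r t b] n b by simp
    \<comment> \<open>Only the sign of \<open>h\<close> is constant on a ball; taking signs turns
      the gauge relation into an equation in Z/2.\<close>
    from arg_cong[OF this, of sgn]
    have "sgn (h r b) * bit_sign (alt2 \<tau>' r t) = bit_sign (alt2 \<tau> r t) * sgn (h t b)"
      by (simp only: sgn_mult sgn_bit_sign)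
    moreover have "sgn (h r b) = bit_sign (\<beta> r)" "sgn (h t b) = bit_sign (\<beta> t)"
      using sgn_h n b by auto
    ultimately have "bit_sign (\<beta> r + alt2 \<tau>' r t) = bit_sign (alt2 \<tau> r t + \<beta> t)"
      by (simp only: bit_sign_add)
    then have "\<beta> r + alt2 \<tau>' r t = alt2 \<tau> r t + \<beta> t" by (simp only: bit_sign_eq_iff)
    then show ?thesis
      by (cases "alt2 \<tau> r t"; cases "alt2 \<tau>' r t"; cases "\<beta> r"; cases "\<beta> t") simp_all
  qed
  let ?d = "\<lambda>\<sigma>. \<tau> \<sigma> - \<tau>' \<sigma>"
  have d: "?d \<in> cocycles K 1"
    using \<tau> \<tau>' by (rule cocycles_diff)
  \<comment> \<open>So far the difference is a coboundary only on edges between living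
    vertices.\<close>
  obtain \<beta>' where \<beta>': "\<And>r t. {r, t} \<in> K \<Longrightarrow> alt2 ?d r t = \<beta>' t - \<beta>' r"
  proof (rule extend_0_cochain[of "alt2 ?d" \<beta>])
    show "alt2 ?d t r = - alt2 ?d r t" for r t by (rule alt2_swap)
    show "alt2 ?d s t - alt2 ?d r t + alt2 ?d r s = 0" if "{r, s, t} \<in> K" for r s t
      by (rule alt2_cocycle[OF d that])
    show "alt2 ?d r t = \<beta> t - \<beta> r" if "{r, t} \<in> K" "\<not> dead a r" "\<not> dead a t" for r t
      using edge[OF that] by (simp only: alt2_diff)
  qed (auto simp: alt2_diag)
  have "?d \<in> coboundaries K 1"
    by (rule coboundary_0_if_alt2[OF _ \<beta>' sparse_cech_face]) (use d in \<open>auto simp: cocycles_def\<close>)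
  then show ?thesis using cohomology_class_eq_iff[of \<tau> K 0 \<tau>'] \<tau> \<tau>' by simp
qed

section \<open>The complex classifying map\<close>

text \<open>A function-valued 1-cochain in which the weights average out the last index of
  \<open>\<theta>\<close>. Its coboundary at a common point of the balls is integral, by
  \<open>phase_cocycle\<close>.\<close>

definition phase :: "(nat set \<Rightarrow> real) \<Rightarrow> (nat set \<Rightarrow> real) \<Rightarrow> nat \<Rightarrow> nat \<Rightarrow> 'a \<Rightarrow> real" where
  "phase \<theta> \<nu> j k b = alt2 \<nu> j k + (\<Sum>t=0..n. wt t b * alt3 \<theta> j k t)"

lemma complex_coords_eq:
  "complex_coords x n e a \<theta> \<nu> j b r =
    (if r \<le> n then circle_exp (phase \<theta> \<nu> r j b) * of_real (sqrt (wt r b)) else 0)"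
  by (simp add: complex_coords_def circle_exp_def phase_def alt_ext_2 alt_ext_3)

lemma phase_swap: "phase \<theta> \<nu> k j b = - phase \<theta> \<nu> j k b"
  unfolding phase_def alt2_swap[of \<nu> k j] alt3_swap12[of \<theta> k j] by (simp add: sum_negf)

lemma phase_diag: "phase \<theta> \<nu> j j b = 0"
  by (simp add: phase_def alt2_diag alt3_diag)

lemma continuous_on_phase: "continuous_on U (phase \<theta> \<nu> j k)"
  unfolding phase_def[abs_def] by (intro continuous_intros continuous_on_weight)

text \<open>Averaging the cocycle identity of \<open>\<theta>\<close> over the fourth index shows
  that the averaged terms have coboundary \<open>\<theta>\<close>; the coboundary of
  \<open>\<nu>\<close> completes this to the integral \<open>\<eta>\<close>.\<close>

lemma phase_cocycle:
  assumes \<theta>: "\<theta> \<in> cocycles K 2" and corr: "is_correction K \<eta> \<theta> \<nu>"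
    and rst: "r \<le> n" "s \<le> n" "t \<le> n" "b \<in> B r" "b \<in> B s" "b \<in> B t"
  shows "phase \<theta> \<nu> s t b - phase \<theta> \<nu> r t b + phase \<theta> \<nu> r s b = of_int (alt3 \<eta> r s t)"
proof -
  have K: "{r, s, t} \<in> K" using rst by (intro mem_sparse_cechI[of _ b]) auto
  have bU: "b \<in> U" using ball_subset_U rst by blast
  have "(\<Sum>u=0..n. wt u b * (alt3 \<theta> s t u - alt3 \<theta> r t u + alt3 \<theta> r s u)) =
      (\<Sum>u=0..n. wt u b * 0) + alt3 \<theta> r s t"
  proof (rule weighted_sum_shift[OF bU])
    fix u assume "u \<le> n" "b \<in> B u"
    then have "{r, s, t, u} \<in> K" using rst by (intro mem_sparse_cechI[of _ b]) auto
    from alt3_cocycle[OF \<theta> this]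
    show "alt3 \<theta> s t u - alt3 \<theta> r t u + alt3 \<theta> r s u = 0 + alt3 \<theta> r s t" by linarith
  qed
  moreover have "alt3 \<theta> r s t = of_int (alt3 \<eta> r s t) - (alt2 \<nu> s t - alt2 \<nu> r t + alt2 \<nu> r s)"
  proof -
    have "\<theta> = (\<lambda>\<sigma>. int_to_real_cochain \<eta> \<sigma> - coboundary K 1 \<nu> \<sigma>)" using corr by (simp add: is_correction_def)
    then have "alt3 \<theta> r s t = alt3 (int_to_real_cochain \<eta>) r s t - alt3 (coboundary K 1 \<nu>) r s t"
      by (simp add: alt3_diff)
    then show ?thesis by (simp only: alt3_coboundary[OF K] alt3_int_to_real)
  qed
  ultimately show ?thesis
    by (simp add: phase_def sum.distrib sum_subtractf distrib_left right_diff_distrib)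
qed

text \<open>Where coordinate \<open>r\<close> is nonzero, the phases add up correctly except for the
  integer \<open>alt3 \<eta> r j k\<close>, which \<open>circle_exp\<close> does not see.\<close>

lemma complex_coords_transition:
  assumes \<theta>: "\<theta> \<in> cocycles K 2" and corr: "is_correction K \<eta> \<theta> \<nu>"
    and jk: "j \<le> n" "k \<le> n" "b \<in> B j" "b \<in> B k"
  shows "complex_coords x n e a \<theta> \<nu> j b =
    (\<lambda>r. circle_exp (- phase \<theta> \<nu> j k b) * complex_coords x n e a \<theta> \<nu> k b r)"
proof
  fix r
  show "complex_coords x n e a \<theta> \<nu> j b r = circle_exp (- phase \<theta> \<nu> j k b) * complex_coords x n e a \<theta> \<nu> k b r"
  proof (cases "r \<le> n \<and> b \<in> B r")
    case True
    then have "phase \<theta> \<nu> r j b = - phase \<theta> \<nu> j k b + phase \<theta> \<nu> r k b + of_int (alt3 \<eta> r j k)"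
      using phase_cocycle[OF \<theta> corr, of r j k b] jk by linarith
    then have "circle_exp (phase \<theta> \<nu> r j b) = circle_exp (- phase \<theta> \<nu> j k b) * circle_exp (phase \<theta> \<nu> r k b)"
      by (simp only: circle_exp_add circle_exp_of_int mult_1_right)
    then show ?thesis using True by (simp add: complex_coords_eq)
  next
    case False
    then show ?thesis using weight_zero[of b r] by (auto simp: complex_coords_eq)
  qed
qed

lemma complex_coords_diag: "j \<le> n \<Longrightarrow> b \<in> B j \<Longrightarrow> complex_coords x n e a \<theta> \<nu> j b j \<noteq> 0"
  using weight_pos[OF subsetD[OF ball_subset_U], of j b j] by (simp add: complex_coords_eq circle_exp_nonzero)

lemma continuous_on_circle_exp:
  "continuous_on S g \<Longrightarrow> continuous_on S (\<lambda>b. circle_exp (g b))"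
  unfolding circle_exp_def by (intro continuous_intros)

lemma complex_frame:
  assumes \<theta>: "\<theta> \<in> cocycles K 2" and corr: "is_correction K \<eta> \<theta> \<nu>"
  shows "proj_frame U {0..n} B n (complex_coords x n e a \<theta> \<nu>)"
  unfolding proj_frame_def
proof (intro conjI ballI allI impI)
  show "U \<subseteq> \<Union>(B ` {0..n})" by (simp add: Union_sparse_balls)
  fix j assume j: "j \<in> {0..n}"
  then have jU: "B j \<subseteq> U" using ball_subset_U by auto
  show "openin (top_of_set U) (B j)" using j by (simp add: openin_sparse_ball)
  show "continuous_on (B j) (\<lambda>b. complex_coords x n e a \<theta> \<nu> j b i)" for i
  proof (cases "i \<le> n")
    case True
    have "continuous_on (B j) (\<lambda>b. circle_exp (phase \<theta> \<nu> i j b) * of_real (sqrt (wt i b)))"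
      by (intro continuous_intros continuous_on_circle_exp continuous_on_subset[OF continuous_on_weight jU]
          continuous_on_subset[OF continuous_on_phase jU])
    then show ?thesis using True by (simp add: complex_coords_eq)
  qed (simp add: complex_coords_eq)
  show "\<exists>i. complex_coords x n e a \<theta> \<nu> j b i \<noteq> 0" if "b \<in> B j" for b
    using complex_coords_diag[of j b \<theta> \<nu>] j that by auto
  show "complex_coords x n e a \<theta> \<nu> j b i = 0" if "i > n" for b i using that by (simp add: complex_coords_eq)
next
  fix j k b assume "j \<in> {0..n}" "k \<in> {0..n}" "b \<in> B j \<inter> B k"
  then show "\<exists>c. c \<noteq> 0 \<and> complex_coords x n e a \<theta> \<nu> j b = (\<lambda>i. c * complex_coords x n e a \<theta> \<nu> k b i)"
    using complex_coords_transition[OF \<theta> corr, of j k b] circle_exp_nonzero by auto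
qed

text \<open>The quantifiers hide the choice of \<open>\<nu>\<close>, so that homotopy invariance in
  terms of this relation includes independence of that choice.\<close>

definition complex_rep where
  "complex_rep \<eta> f \<longleftrightarrow> (\<exists>\<theta> \<nu>. is_harmonic_rep K \<eta> \<theta> \<and> is_correction K \<eta> \<theta> \<nu> \<and> is_complex_map x n e a \<theta> \<nu> f)"

lemma is_complex_map_exists:
  assumes "\<theta> \<in> cocycles K 2" "is_correction K \<eta> \<theta> \<nu>"
  shows "\<exists>f. is_complex_map x n e a \<theta> \<nu> f"
  by (rule proj_frame_map[OF complex_frame[OF assms]]) (auto simp: is_complex_map_def)

text \<open>By uniqueness of harmonic representatives both maps use the same
  \<open>\<theta>\<close>. Up to an integral cochain, \<open>\<nu>\<close> and \<open>\<nu>'\<close>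
  differ by a real 1-cocycle, and a partition of unity makes it the coboundary of functions; their
  exponentials are the gauge.\<close>

lemma complex_maps_homotopic:
  assumes \<eta>: "\<eta> \<in> cocycles K 2" "\<eta>' \<in> cocycles K 2"
    and eq: "cohomology_class K 2 \<eta> = cohomology_class K 2 \<eta>'"
    and f: "complex_rep \<eta> f" and f': "complex_rep \<eta>' f'"
  shows "homotopic_with (\<lambda>_. True) (top_of_set U) proj_space_inf f f'"
proof -
  obtain \<theta> \<nu> where h: "is_harmonic_rep K \<eta> \<theta>" and corr: "is_correction K \<eta> \<theta> \<nu>"
    and f: "is_complex_map x n e a \<theta> \<nu> f" using f unfolding complex_rep_def by blast
  obtain \<theta>' \<nu>' where h': "is_harmonic_rep K \<eta>' \<theta>'" and corr': "is_correction K \<eta>' \<theta>' \<nu>'"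
    and f': "is_complex_map x n e a \<theta>' \<nu>' f'" using f' unfolding complex_rep_def by blast
  have d: "(\<lambda>\<sigma>. \<eta> \<sigma> - \<eta>' \<sigma>) \<in> coboundaries K (Suc 1)"
    using cohomology_class_eq_iff[of \<eta> K 1 \<eta>'] \<eta> eq by (simp add: numeral_2_eq_2)
  then have \<theta>': "\<theta>' = \<theta>"
    using harmonic_rep_unique[OF finite_sparse_cech \<eta> _ h h'] by (simp add: numeral_2_eq_2)
  have \<theta>: "\<theta> \<in> cocycles K 2" using h by (simp add: is_harmonic_rep_def)
  obtain \<mu> where \<mu>: "(\<lambda>\<sigma>. \<eta> \<sigma> - \<eta>' \<sigma>) = coboundary K 1 \<mu>"
    using d unfolding coboundaries_Suc_iff by blast
  \<comment> \<open>\<open>\<mu>\<close> is subtracted to make \<open>\<zeta>\<close> closed; being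
    integral, it drops out of the gauge relation under \<open>circle_exp\<close>.\<close>
  define \<zeta> where "\<zeta> r s = alt2 \<nu> r s - alt2 \<nu>' r s - of_int (alt2 \<mu> r s)" for r s
  have \<zeta>: "\<zeta> s t - \<zeta> r t + \<zeta> r s = 0" if K: "{r, s, t} \<in> K" for r s t
  proof -
    have "\<theta> = (\<lambda>\<sigma>. int_to_real_cochain \<eta> \<sigma> - coboundary K 1 \<nu> \<sigma>)"
      "\<theta> = (\<lambda>\<sigma>. int_to_real_cochain \<eta>' \<sigma> - coboundary K 1 \<nu>' \<sigma>)"
      using corr corr' by (simp_all add: is_correction_def \<theta>')
    from this[THEN arg_cong, of "\<lambda>\<phi>. alt3 \<phi> r s t"]
    have "of_int (alt3 \<eta> r s t) - (alt2 \<nu> s t - alt2 \<nu> r t + alt2 \<nu> r s) =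
        of_int (alt3 \<eta>' r s t) - (alt2 \<nu>' s t - alt2 \<nu>' r t + alt2 \<nu>' r s)"
      unfolding alt3_diff alt3_coboundary[OF K] alt3_int_to_real by linarith
    moreover have "alt3 \<eta> r s t - alt3 \<eta>' r s t = alt2 \<mu> s t - alt2 \<mu> r t + alt2 \<mu> r s"
      unfolding alt3_diff[symmetric] \<mu> by (rule alt3_coboundary[OF K])
    then have "real_of_int (alt3 \<eta> r s t) - of_int (alt3 \<eta>' r s t) =
        of_int (alt2 \<mu> s t) - of_int (alt2 \<mu> r t) + of_int (alt2 \<mu> r s)" by linarith
    ultimately show ?thesis unfolding \<zeta>_def by linarith
  qed
  define g where "g j b = circle_exp (- (\<Sum>t=0..n. wt t b * \<zeta> j t))" for j b
  show ?thesis
  proof (rule homotopic_if_gauge_equivalent[OF complex_frame[OF \<theta> corr] complex_frame[OF \<theta> corr'[unfolded \<theta>']],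
        where c = "\<lambda>j k b. circle_exp (- phase \<theta> \<nu> j k b)" and d = "\<lambda>j k b. circle_exp (- phase \<theta> \<nu>' j k b)"
          and g = g])
    fix j k b assume "j \<in> {0..n}" "k \<in> {0..n}" and b: "b \<in> B j \<inter> B k"
    then have jk: "j \<le> n" "k \<le> n" by auto
    have bU: "b \<in> U" using ball_subset_U jk b by blast
    have "(\<Sum>t=0..n. wt t b * \<zeta> j t) = (\<Sum>t=0..n. wt t b * \<zeta> k t) + \<zeta> j k"
    proof (rule weighted_sum_shift[OF bU])
      fix t assume "t \<le> n" "b \<in> B t"
      then have "{j, k, t} \<in> K" using jk b by (intro mem_sparse_cechI[of _ b]) auto
      from \<zeta>[OF this] show "\<zeta> j t = \<zeta> k t + \<zeta> j k" by linarith
    qed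
    moreover have "phase \<theta> \<nu> j k b - phase \<theta> \<nu>' j k b = \<zeta> j k + of_int (alt2 \<mu> j k)"
      by (simp add: phase_def \<zeta>_def)
    ultimately have "- (\<Sum>t=0..n. wt t b * \<zeta> j t) + - phase \<theta> \<nu>' j k b =
        (- phase \<theta> \<nu> j k b + - (\<Sum>t=0..n. wt t b * \<zeta> k t)) + of_int (alt2 \<mu> j k)"
      by linarith
    then show "g j b * circle_exp (- phase \<theta> \<nu>' j k b) = circle_exp (- phase \<theta> \<nu> j k b) * g k b"
      unfolding g_def circle_exp_add[symmetric] by (simp only: circle_exp_add[of _ "of_int _"] circle_exp_of_int mult_1_right)
  next
    fix j assume "j \<in> {0..n}"
    then have "B j \<subseteq> U" using ball_subset_U by auto
    then show "continuous_on (B j) (g j)"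
      unfolding g_def by (intro continuous_on_circle_exp continuous_intros continuous_on_subset[OF continuous_on_weight])
  next
    show "complex_coords x n e a \<theta> \<nu> j b = (\<lambda>i. circle_exp (- phase \<theta> \<nu> j k b) * complex_coords x n e a \<theta> \<nu> k b i)"
      "complex_coords x n e a \<theta> \<nu>' j b = (\<lambda>i. circle_exp (- phase \<theta> \<nu>' j k b) * complex_coords x n e a \<theta> \<nu>' k b i)"
      if "j \<in> {0..n}" "k \<in> {0..n}" "b \<in> B j \<inter> B k" for j k b
      using that by (auto intro: complex_coords_transition[OF \<theta> corr]
          complex_coords_transition[OF \<theta> corr'[unfolded \<theta>']])
  qed (use f f' in \<open>auto simp: is_complex_map_def \<theta>' g_def circle_exp_nonzero\<close>)
qed

text \<open>The connecting homomorphism of the exponential sequence in Cech form: choosing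
  logarithms of the gauge leaves integers on the overlaps, whose coboundary is
  \<open>\<eta> - \<eta>'\<close> on living triangles.\<close>

lemma complex_maps_homotopic_imp_eq:
  assumes \<eta>: "\<eta> \<in> cocycles K 2" "\<eta>' \<in> cocycles K 2"
    and f: "complex_rep \<eta> f" and f': "complex_rep \<eta>' f'"
    and hom: "homotopic_with (\<lambda>_. True) (top_of_set U) proj_space_inf f f'"
    and sc: "\<And>C. C \<in> sparse_balls x n e a \<Longrightarrow> locally path_connected C \<and> simply_connected C"
    and conn: "\<And>C D. C \<in> sparse_balls x n e a \<Longrightarrow> D \<in> sparse_balls x n e a \<Longrightarrow> C \<inter> D = {} \<or> connected (C \<inter> D)"
  shows "cohomology_class K 2 \<eta> = cohomology_class K 2 \<eta>'"
proof -
  obtain \<theta> \<nu> where \<theta>: "\<theta> \<in> cocycles K 2" and corr: "is_correction K \<eta> \<theta> \<nu>"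
    and f: "is_complex_map x n e a \<theta> \<nu> f" using f unfolding complex_rep_def is_harmonic_rep_def by blast
  obtain \<theta>' \<nu>' where \<theta>': "\<theta>' \<in> cocycles K 2" and corr': "is_correction K \<eta>' \<theta>' \<nu>'"
    and f': "is_complex_map x n e a \<theta>' \<nu>' f'" using f' unfolding complex_rep_def is_harmonic_rep_def by blast
  obtain h :: "nat \<Rightarrow> 'a \<Rightarrow> complex" where h: "\<And>j. j \<in> {0..n} \<Longrightarrow> continuous_on (B j) (h j)"
    and h0: "\<And>j b. j \<in> {0..n} \<Longrightarrow> b \<in> B j \<Longrightarrow> h j b \<noteq> 0"
    and gauge: "\<And>j k b. j \<in> {0..n} \<Longrightarrow> k \<in> {0..n} \<Longrightarrow> b \<in> B j \<inter> B k \<Longrightarrow>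
      h j b * circle_exp (- phase \<theta>' \<nu>' j k b) = circle_exp (- phase \<theta> \<nu> j k b) * h k b"
  proof (rule gauge_equivalent_if_homotopic[OF complex_frame[OF \<theta> corr] complex_frame[OF \<theta>' corr'], where f = f and f' = f'
        and c = "\<lambda>j k b. circle_exp (- phase \<theta> \<nu> j k b)" and d = "\<lambda>j k b. circle_exp (- phase \<theta>' \<nu>' j k b)"])
    show "complex_coords x n e a \<theta> \<nu> j b = (\<lambda>i. circle_exp (- phase \<theta> \<nu> j k b) * complex_coords x n e a \<theta> \<nu> k b i)"
      "complex_coords x n e a \<theta>' \<nu>' j b = (\<lambda>i. circle_exp (- phase \<theta>' \<nu>' j k b) * complex_coords x n e a \<theta>' \<nu>' k b i)"
      if "j \<in> {0..n}" "k \<in> {0..n}" "b \<in> B j \<inter> B k" for j k b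
      using that by (auto intro: complex_coords_transition[OF \<theta> corr] complex_coords_transition[OF \<theta>' corr'])
    show "complex_coords x n e a \<theta>' \<nu>' j b j \<noteq> 0" if "j \<in> {0..n}" "b \<in> B j" for j b
      using that complex_coords_diag by auto
    show "f b = proj_point (complex_coords x n e a \<theta> \<nu> j b)" "f' b = proj_point (complex_coords x n e a \<theta>' \<nu>' j b)"
      if "j \<in> {0..n}" "b \<in> B j" for j b
      using that f f' by (auto simp: is_complex_map_def)
    show "homotopic_with (\<lambda>_. True) (top_of_set U) proj_space_inf f f'" by (rule hom)
  qed (rule that)
  have "\<exists>g. continuous_on (B j) g \<and> (\<forall>b\<in>B j. h j b = exp (g b))" if j: "j \<in> {0..n}" for j
  proof (cases "B j = {}")
    case False
    then have "simply_connected (B j)" "locally path_connected (B j)"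
      using sparse_ball_cases[of j] sc[of "B j"] j by auto
    from continuous_logarithm_on_simply_connected_metric[OF h[OF j] this h0[OF j]]
    show ?thesis by metis
  qed simp
  then obtain \<psi> where \<psi>: "\<And>j. j \<in> {0..n} \<Longrightarrow> continuous_on (B j) (\<psi> j)"
    "\<And>j b. j \<in> {0..n} \<Longrightarrow> b \<in> B j \<Longrightarrow> h j b = exp (\<psi> j b)" by metis
  \<comment> \<open>The failure of the logarithms to satisfy the gauge relation, in units of 2 pi.
    Only imaginary parts enter because the transition functions have modulus 1.\<close>
  define M where "M j k b = Im (\<psi> j b - \<psi> k b) / (2 * pi) + (phase \<theta> \<nu> j k b - phase \<theta>' \<nu>' j k b)" for j k b
  have Mint: "\<exists>i::int. M j k b = of_int i" if jk: "j \<le> n" "k \<le> n" "b \<in> B j" "b \<in> B k" for j k b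
  proof -
    let ?p = "phase \<theta> \<nu> j k b" and ?p' = "phase \<theta>' \<nu>' j k b"
    have "exp (\<psi> j b) * circle_exp (- ?p') = circle_exp (- ?p) * exp (\<psi> k b)"
      using gauge[of j k b] \<psi>(2)[of j b] \<psi>(2)[of k b] jk by simp
    then have "exp (\<psi> j b + 2 * of_real pi * \<i> * of_real (- ?p')) = exp (2 * of_real pi * \<i> * of_real (- ?p) + \<psi> k b)"
      by (simp only: circle_exp_def exp_add)
    then obtain i :: int where "\<psi> j b + 2 * of_real pi * \<i> * of_real (- ?p') =
        2 * of_real pi * \<i> * of_real (- ?p) + \<psi> k b + (of_int (2 * i) * pi) * \<i>"
      unfolding exp_eq by blast
    from arg_cong[OF this, of Im] have "Im (\<psi> j b) - 2 * pi * ?p' = - 2 * pi * ?p + Im (\<psi> k b) + 2 * of_int i * pi"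
      by simp
    then have "Im (\<psi> j b - \<psi> k b) = 2 * pi * (of_int i - (?p - ?p'))" by (simp add: algebra_simps)
    then have "M j k b = of_int i" by (simp add: M_def)
    then show ?thesis ..
  qed
  have Mconst: "M j k b = M j k b'"
    if jk: "j \<le> n" "k \<le> n" "b \<in> B j \<inter> B k" "b' \<in> B j \<inter> B k" for j k b b'
  proof -
    have sub: "B j \<inter> B k \<subseteq> U" using ball_subset_U jk by blast
    have "connected (B j \<inter> B k)"
      using conn[of "B j" "B k"] sparse_ball_cases[of j] sparse_ball_cases[of k] jk by auto
    moreover have "continuous_on (B j \<inter> B k) (M j k)"
      unfolding M_def
      using continuous_on_subset[OF \<psi>(1)[of j], of "B j \<inter> B k"] continuous_on_subset[OF \<psi>(1)[of k], of "B j \<inter> B k"]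
        continuous_on_subset[OF continuous_on_phase sub] jk
      by (intro continuous_intros) auto
    ultimately have "M j k constant_on (B j \<inter> B k)"
    proof (rule continuous_discrete_range_constant)
      fix c assume c: "c \<in> B j \<inter> B k"
      show "\<exists>e>0. \<forall>d. d \<in> B j \<inter> B k \<and> M j k d \<noteq> M j k c \<longrightarrow> e \<le> norm (M j k d - M j k c)"
      proof (intro exI[of _ 1] conjI allI impI)
        fix d assume d: "d \<in> B j \<inter> B k \<and> M j k d \<noteq> M j k c"
        obtain p q :: int where "M j k d = of_int p" "M j k c = of_int q"
          using Mint[of j k d] Mint[of j k c] jk c d by auto
        moreover from this have "1 \<le> \<bar>p - q\<bar>" using d by auto
        ultimately show "1 \<le> norm (M j k d - M j k c)" by (simp flip: of_int_diff of_int_abs)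
      qed simp
    qed
    then show ?thesis using jk(3,4) unfolding constant_on_def by metis
  qed
  have "\<exists>i::int. \<forall>b\<in>B j \<inter> B k. M j k b = of_int i" if jk: "j \<le> n" "k \<le> n" for j k
  proof (cases "B j \<inter> B k = {}")
    case False
    then obtain b where b: "b \<in> B j \<inter> B k" by blast
    then obtain i :: int where "M j k b = of_int i" using Mint[of j k b] jk by auto
    then show ?thesis using Mconst[OF jk b] by metis
  qed simp
  then obtain m0 :: "nat \<Rightarrow> nat \<Rightarrow> int" where
    m0: "\<And>j k b. j \<le> n \<Longrightarrow> k \<le> n \<Longrightarrow> b \<in> B j \<inter> B k \<Longrightarrow> M j k b = of_int (m0 j k)"
    by metis
  \<comment> \<open>\<open>m0\<close> is arbitrary on empty overlaps, so alternation is imposed by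
    hand; on nonempty overlaps it is that of \<open>M\<close>.\<close>
  define m where "m j k = (if j < k then m0 j k else if k < j then - m0 k j else 0)" for j k
  have Mswap: "M k j b = - M j k b" and Mdiag: "M j j b = 0" for j k b
    unfolding M_def phase_swap[of _ _ k j] by (simp_all add: phase_diag diff_divide_distrib)
  have m: "M j k b = of_int (m j k)" if "j \<le> n" "k \<le> n" "b \<in> B j" "b \<in> B k" for j k b
    using m0[of j k b] m0[of k j b] Mswap[of j k b] Mdiag[of j b] that
    by (cases j k rule: linorder_cases) (auto simp: m_def)
  let ?d = "\<lambda>\<sigma>. \<eta> \<sigma> - \<eta>' \<sigma>"
  have d: "?d \<in> cocycles K 2"
    using \<eta> by (rule cocycles_diff)
  obtain m' where m': "\<And>r s t. {r, s, t} \<in> K \<Longrightarrow> alt3 ?d r s t = m' s t - m' r t + m' r s"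
  proof (rule extend_1_cochain[of "alt3 ?d" m])
    show "alt3 ?d s r t = - alt3 ?d r s t" for r s t by (rule alt3_swap12)
    show "alt3 ?d r t s = - alt3 ?d r s t" for r s t by (rule alt3_swap23)
    show "alt3 ?d s t u - alt3 ?d r t u + alt3 ?d r s u - alt3 ?d r s t = 0" if "{r, s, t, u} \<in> K" for r s t u
      by (rule alt3_cocycle[OF d that])
    show "alt3 ?d r s t = m s t - m r t + m r s"
      if rst: "{r, s, t} \<in> K" "\<not> dead a r" "\<not> dead a s" "\<not> dead a t" for r s t
    proof -
      have "\<not> dead a u" if "u \<in> {r, s, t}" for u using that rst(2-4) by blast
      from alive_simplex[OF rst(1) this] obtain b where "\<And>u. u \<in> {r, s, t} \<Longrightarrow> b \<in> B u" by metis
      then have b: "b \<in> B r" "b \<in> B s" "b \<in> B t" by simp_all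
      have n: "r \<le> n" "s \<le> n" "t \<le> n" using rst(1) by (simp_all add: mem_sparse_cech)
      have "real_of_int (m s t - m r t + m r s) = M s t b - M r t b + M r s b"
        using m n b by simp
      \<comment> \<open>The logarithms cancel around the triangle and leave phases, whose
        coboundaries are the known integers.\<close>
      also have "\<dots> = (phase \<theta> \<nu> s t b - phase \<theta> \<nu> r t b + phase \<theta> \<nu> r s b) -
          (phase \<theta>' \<nu>' s t b - phase \<theta>' \<nu>' r t b + phase \<theta>' \<nu>' r s b)"
        by (simp add: M_def diff_divide_distrib)
      also have "\<dots> = of_int (alt3 \<eta> r s t - alt3 \<eta>' r s t)"
        unfolding phase_cocycle[OF \<theta> corr n b] phase_cocycle[OF \<theta>' corr' n b] by simp
      finally show ?thesis by (simp only: alt3_diff of_int_eq_iff)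
    qed
    show "alt3 ?d r r t = 0" for r t by (rule alt3_diag)
    show "m r r = 0" "m t r = - m r t" for r t by (simp_all add: m_def)
  qed (rule that)
  have "?d \<in> cochains K 2" using d by (simp add: cocycles_def)
  from coboundary_1_if_alt3[OF this m' sparse_cech_face]
  show ?thesis unfolding cohomology_class_eq_iff[of \<eta> K 1 \<eta>', unfolded Suc_1, OF \<eta>] .
qed

end

theorem theorem7p4:
  fixes X :: "'a::metric_space set" and x :: "nat \<Rightarrow> 'a" and n :: nat and e a :: real
  assumes "card X = n + 1"
    and "greedy_permutation X n x"
    and "0 < e" and "e < 1" and "0 \<le> a"
  shows "(\<exists>w1 \<in> cohomology (sparse_cech x n e a) 1 \<rightarrow>
              homotopy_classes (top_of_set (\<Union>(sparse_balls x n e a))) proj_space_inf.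
           (\<forall>\<tau>\<in>cocycles (sparse_cech x n e a) 1. \<exists>f. is_real_map x n e a \<tau> f \<and>
              w1 (cohomology_class (sparse_cech x n e a) 1 \<tau>) =
              homotopy_class (top_of_set (\<Union>(sparse_balls x n e a))) proj_space_inf f) \<and>
           ((\<forall>B\<in>sparse_balls x n e a. connected B) \<longrightarrow>
              inj_on w1 (cohomology (sparse_cech x n e a) 1))) \<and>
         (\<exists>c1 \<in> cohomology (sparse_cech x n e a) 2 \<rightarrow>
              homotopy_classes (top_of_set (\<Union>(sparse_balls x n e a))) proj_space_inf.
           (\<forall>\<eta>\<in>cocycles (sparse_cech x n e a) 2.
              (\<exists>!\<theta>. is_harmonic_rep (sparse_cech x n e a) \<eta> \<theta>) \<and>
              (\<forall>\<theta>. is_harmonic_rep (sparse_cech x n e a) \<eta> \<theta> \<longrightarrow>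
                 (\<exists>\<nu>. is_correction (sparse_cech x n e a) \<eta> \<theta> \<nu>) \<and>
                 (\<forall>\<nu>. is_correction (sparse_cech x n e a) \<eta> \<theta> \<nu> \<longrightarrow>
                    (\<exists>f. is_complex_map x n e a \<theta> \<nu> f \<and>
                       c1 (cohomology_class (sparse_cech x n e a) 2 \<eta>) =
                       homotopy_class (top_of_set (\<Union>(sparse_balls x n e a))) proj_space_inf f)))) \<and>
           ((\<forall>B\<in>sparse_balls x n e a. connected B \<and> locally path_connected B \<and> simply_connected B) \<and>
            (\<forall>B\<in>sparse_balls x n e a. \<forall>C\<in>sparse_balls x n e a. B \<inter> C = {} \<or> connected (B \<inter> C)) \<longrightarrow>
              inj_on c1 (cohomology (sparse_cech x n e a) 2)))"
proof (rule conjI)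
  interpret sparse_filtration X x n e a
    using assms by unfold_locales
  let ?Y = "top_of_set U"
  have real_cont: "continuous_map ?Y proj_space_inf f" if "is_real_map x n e a \<tau> f" for \<tau> f
    using that continuous_map_proj_space_inf by (auto simp: is_real_map_def)
  have complex_cont: "continuous_map ?Y proj_space_inf f" if "complex_rep \<eta> f" for \<eta> f
    using that continuous_map_proj_space_inf by (auto simp: complex_rep_def is_complex_map_def)
  obtain w1 where w1: "w1 \<in> cohomology K 1 \<rightarrow> homotopy_classes ?Y proj_space_inf"
    and w1_eq: "\<And>\<tau> f. \<tau> \<in> cocycles K 1 \<Longrightarrow> is_real_map x n e a \<tau> f \<Longrightarrow>
      w1 (cohomology_class K 1 \<tau>) = homotopy_class ?Y proj_space_inf f"
  proof (rule homotopy_classes_of_cohomology[where P = "is_real_map x n e a" and k = 1 and K = K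
        and X = ?Y and Y = proj_space_inf])
    show "\<exists>f. is_real_map x n e a \<tau> f" if "\<tau> \<in> cocycles K 1" for \<tau> using that by (rule is_real_map_exists)
    show "continuous_map ?Y proj_space_inf f" if "is_real_map x n e a \<tau> f" for \<tau> f
      using that by (rule real_cont)
    show "homotopic_with (\<lambda>_. True) ?Y proj_space_inf f g"
      if "\<tau> \<in> cocycles K 1" "\<tau>' \<in> cocycles K 1" "cohomology_class K 1 \<tau> = cohomology_class K 1 \<tau>'"
        "is_real_map x n e a \<tau> f" "is_real_map x n e a \<tau>' g" for \<tau> \<tau>' f g
      using that by (rule real_maps_homotopic)
  qed (rule that)
  have w1_inj: "inj_on w1 (cohomology K 1)" if conn: "\<forall>C\<in>sparse_balls x n e a. connected C"
  proof (rule inj_onI)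
    fix C D :: "(nat set \<Rightarrow> bit) set" assume "C \<in> cohomology K 1" "D \<in> cohomology K 1" and eq: "w1 C = w1 D"
    then obtain \<tau> \<tau>' where \<tau>: "\<tau> \<in> cocycles K 1" "\<tau>' \<in> cocycles K 1"
      and CD: "C = cohomology_class K 1 \<tau>" "D = cohomology_class K 1 \<tau>'"
      by (auto simp: cohomology_def)
    obtain f f' where f: "is_real_map x n e a \<tau> f" "is_real_map x n e a \<tau>' f'"
      using is_real_map_exists \<tau> by blast
    have "homotopic_with (\<lambda>_. True) ?Y proj_space_inf f f'"
      using eq unfolding CD w1_eq[OF \<tau>(1) f(1)] w1_eq[OF \<tau>(2) f(2)]
      by (rule homotopic_if_homotopy_class_eq[OF real_cont[OF f(2)]])
    from real_maps_homotopic_imp_eq[OF \<tau> f this] show "C = D" unfolding CD using conn by simp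
  qed
  show "\<exists>w1 \<in> cohomology K 1 \<rightarrow> homotopy_classes ?Y proj_space_inf.
      (\<forall>\<tau>\<in>cocycles K 1. \<exists>f. is_real_map x n e a \<tau> f \<and>
         w1 (cohomology_class K 1 \<tau>) = homotopy_class ?Y proj_space_inf f) \<and>
      ((\<forall>B\<in>sparse_balls x n e a. connected B) \<longrightarrow> inj_on w1 (cohomology K 1))"
  proof (intro bexI[OF _ w1] conjI ballI impI w1_inj)
    fix \<tau> :: "nat set \<Rightarrow> bit" assume \<tau>: "\<tau> \<in> cocycles K 1"
    then show "\<exists>f. is_real_map x n e a \<tau> f \<and> w1 (cohomology_class K 1 \<tau>) = homotopy_class ?Y proj_space_inf f"
      using is_real_map_exists w1_eq by blast
  qed auto
  have rep: "\<exists>\<nu>. is_correction K \<eta> \<theta> \<nu>" if "\<eta> \<in> cocycles K 2" "is_harmonic_rep K \<eta> \<theta>" for \<eta> \<theta>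
    using is_correction_exists[OF finite_sparse_cech that] by blast
  have complex_map: "\<exists>f. is_complex_map x n e a \<theta> \<nu> f"
    if "is_harmonic_rep K \<eta> \<theta>" "is_correction K \<eta> \<theta> \<nu>" for \<eta> \<theta> \<nu>
    using that is_complex_map_exists[of \<theta> \<eta> \<nu>] by (auto simp: is_harmonic_rep_def)
  have harmonic: "\<exists>\<theta>. is_harmonic_rep K \<eta> \<theta>" if "\<eta> \<in> cocycles K 2" for \<eta>
    by (rule harmonic_rep_exists[OF finite_sparse_cech sparse_cech_face that]) blast+
  have complex_ex: "\<exists>f. complex_rep \<eta> f" if "\<eta> \<in> cocycles K 2" for \<eta>
    using harmonic[OF that] rep[OF that] complex_map unfolding complex_rep_def by metis
  obtain c1 where c1: "c1 \<in> cohomology K 2 \<rightarrow> homotopy_classes ?Y proj_space_inf"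
    and c1_eq: "\<And>\<eta> f. \<eta> \<in> cocycles K 2 \<Longrightarrow> complex_rep \<eta> f \<Longrightarrow>
      c1 (cohomology_class K 2 \<eta>) = homotopy_class ?Y proj_space_inf f"
  proof (rule homotopy_classes_of_cohomology[where P = complex_rep and k = 2 and K = K
        and X = ?Y and Y = proj_space_inf])
    show "\<exists>f. complex_rep \<eta> f" if "\<eta> \<in> cocycles K 2" for \<eta> using that by (rule complex_ex)
    show "continuous_map ?Y proj_space_inf f" if "complex_rep \<eta> f" for \<eta> f
      using that by (rule complex_cont)
    show "homotopic_with (\<lambda>_. True) ?Y proj_space_inf f g"
      if "\<eta> \<in> cocycles K 2" "\<eta>' \<in> cocycles K 2" "cohomology_class K 2 \<eta> = cohomology_class K 2 \<eta>'"
        "complex_rep \<eta> f" "complex_rep \<eta>' g" for \<eta> \<eta>' f g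
      using that by (rule complex_maps_homotopic)
  qed (rule that)
  show "\<exists>c1 \<in> cohomology K 2 \<rightarrow> homotopy_classes ?Y proj_space_inf.
      (\<forall>\<eta>\<in>cocycles K 2. (\<exists>!\<theta>. is_harmonic_rep K \<eta> \<theta>) \<and>
         (\<forall>\<theta>. is_harmonic_rep K \<eta> \<theta> \<longrightarrow> (\<exists>\<nu>. is_correction K \<eta> \<theta> \<nu>) \<and>
            (\<forall>\<nu>. is_correction K \<eta> \<theta> \<nu> \<longrightarrow> (\<exists>f. is_complex_map x n e a \<theta> \<nu> f \<and>
               c1 (cohomology_class K 2 \<eta>) = homotopy_class ?Y proj_space_inf f)))) \<and>
      ((\<forall>B\<in>sparse_balls x n e a. connected B \<and> locally path_connected B \<and> simply_connected B) \<and>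
       (\<forall>B\<in>sparse_balls x n e a. \<forall>C\<in>sparse_balls x n e a. B \<inter> C = {} \<or> connected (B \<inter> C)) \<longrightarrow>
         inj_on c1 (cohomology K 2))"
  proof (intro bexI[OF _ c1] conjI ballI allI impI)
    fix \<eta> :: "nat set \<Rightarrow> int" assume \<eta>: "\<eta> \<in> cocycles K 2"
    \<comment> \<open>Uniqueness is \<open>harmonic_rep_unique\<close> for two equal cocycles, whose
      zero difference has to be recognised as a coboundary.\<close>
    have "(\<lambda>\<sigma>. \<eta> \<sigma> - \<eta> \<sigma>) \<in> coboundaries K 2"
      using cohomology_class_eq_iff[of \<eta> K 1 \<eta>] \<eta> by (simp add: numeral_2_eq_2)
    then show "\<exists>!\<theta>. is_harmonic_rep K \<eta> \<theta>"
      using harmonic[OF \<eta>] harmonic_rep_unique[OF finite_sparse_cech \<eta> \<eta>] by blast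
    fix \<theta> assume \<theta>: "is_harmonic_rep K \<eta> \<theta>"
    show "\<exists>\<nu>. is_correction K \<eta> \<theta> \<nu>" by (rule rep[OF \<eta> \<theta>])
    fix \<nu> assume \<nu>: "is_correction K \<eta> \<theta> \<nu>"
    obtain f where "is_complex_map x n e a \<theta> \<nu> f" using complex_map[OF \<theta> \<nu>] by blast
    moreover from this have "complex_rep \<eta> f" using \<theta> \<nu> unfolding complex_rep_def by blast
    ultimately show "\<exists>f. is_complex_map x n e a \<theta> \<nu> f \<and>
        c1 (cohomology_class K 2 \<eta>) = homotopy_class ?Y proj_space_inf f"
      using c1_eq[OF \<eta>] by blast
  next
    assume good: "(\<forall>B\<in>sparse_balls x n e a. connected B \<and> locally path_connected B \<and> simply_connected B) \<and>
       (\<forall>B\<in>sparse_balls x n e a. \<forall>C\<in>sparse_balls x n e a. B \<inter> C = {} \<or> connected (B \<inter> C))"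
    show "inj_on c1 (cohomology K 2)"
    proof (rule inj_onI)
      fix C D :: "(nat set \<Rightarrow> int) set" assume "C \<in> cohomology K 2" "D \<in> cohomology K 2" and eq: "c1 C = c1 D"
      then obtain \<eta> \<eta>' where \<eta>: "\<eta> \<in> cocycles K 2" "\<eta>' \<in> cocycles K 2"
        and CD: "C = cohomology_class K 2 \<eta>" "D = cohomology_class K 2 \<eta>'"
        by (auto simp: cohomology_def)
      obtain f f' where f: "complex_rep \<eta> f" "complex_rep \<eta>' f'" using complex_ex \<eta> by blast
      have "homotopic_with (\<lambda>_. True) ?Y proj_space_inf f f'"
        using eq unfolding CD c1_eq[OF \<eta>(1) f(1)] c1_eq[OF \<eta>(2) f(2)]
        by (rule homotopic_if_homotopy_class_eq[OF complex_cont[OF f(2)]])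
      from complex_maps_homotopic_imp_eq[OF \<eta> f this] show "C = D" unfolding CD using good by simp
    qed
  qed
qed

end
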